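(* Let $H$ and $A$ be self-adjoint operators on $\mathcal{H}=L^2(\mathbb{R}^n)$ with $H>0$. Assume that $H$ is of class $C^1(A)$ and that the commutation relation $[H,\mathrm{i}A]=cH$ holds with $c\neq0$ real. For $t\in\mathbb{R}$ put $u_1(t)=\cos(tH)$ and $u_2(t)=\frac{\sin(tH)}{H}$, and for $f,g\in\mathcal{H}$ put $\psi_{f,g}(t)=\langle f,u_1(t)f\rangle+\langle f,u_2(t)g\rangle$. Let $\mathcal{E}=\{h\in\mathcal{H}\mid [h]_H<\infty\}$, where $[h]_H=\|\langle h,u_1(t)h\rangle\|_{L^2_t(\mathbb{R})}^{1/2}+\|\langle h,u_2(t)h\rangle\|_{L^2_t(\mathbb{R})}^{1/2}$. Then for all $f,g\in D(A)\cap\mathcal{E}$ such that $Af,Ag\in\mathcal{E}$ there is a constant $C_{f,g}$ such that $|\psi_{f,g}(t)|\le C_{f,g}\langle t\rangle^{-1/2}$ for all $t\in\mathbb{R}$.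
   Context: Notation: $\langle t\rangle=(1+t^2)^{1/2}$. The function $u(t)=u_1(t)f+u_2(t)g$ solves $\partial_{tt}u+H^2u=0$, $u(0)=f$, $\partial_tu(0)=g$. A bounded operator $S$ on $\mathcal{H}$ is of class $C^1(A)$ if the sesquilinear form $(u,v)\mapsto\langle Au,Sv\rangle-\langle u,SAv\rangle$ on $D(A)$ is continuous for the topology induced by $\mathcal{H}$. A self-adjoint operator $H$ is of class $C^1(A)$ if $(H-z)^{-1}$ is of class $C^1(A)$ for some (hence all) $z$ in the resolvent set of $H$. In that case $D(A)\cap D(H)$ is dense in $D(H)$ (graph topology) and the form $[A,H](u,v)=\langle Au,Hv\rangle-\langle Hu,Av\rangle$ on $D(A)\cap D(H)$ extends uniquely to a continuous sesquilinear form $[A,H]$ on $D(H)$; one sets $[H,\mathrm{i}A]=-\mathrm{i}[A,H]$. The relation $[H,\mathrm{i}A]=cH$ is an equality of forms on $D(H)$. *)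

theory Defs
  imports "HOL-Analysis.Analysis"
begin

section \<open>Complex Hilbert spaces\<close>

text \<open>The inner product is antilinear in its first argument.\<close>

class complex_hilbert_space = real_inner + complete_space +
  fixes scaleC :: "complex \<Rightarrow> 'a \<Rightarrow> 'a"  (infixr "*\<^sub>C" 75)
    and cinner :: "'a \<Rightarrow> 'a \<Rightarrow> complex"
  assumes scaleC_add_right: "a *\<^sub>C (x + y) = a *\<^sub>C x + a *\<^sub>C y"
    and scaleC_add_left: "(a + b) *\<^sub>C x = a *\<^sub>C x + b *\<^sub>C x"
    and scaleC_scaleC: "a *\<^sub>C b *\<^sub>C x = (a * b) *\<^sub>C x"
    and scaleR_scaleC: "r *\<^sub>R x = complex_of_real r *\<^sub>C x"
    and cinner_commute: "cinner x y = cnj (cinner y x)"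
    and cinner_add_right: "cinner x (y + z) = cinner x y + cinner x z"
    and cinner_scaleC_right: "cinner x (a *\<^sub>C y) = a * cinner x y"
    and inner_cinner: "inner x y = Re (cinner x y)"


section \<open>The space of square integrable functions\<close>

definition square_integrable :: "(real ^ 'n::finite \<Rightarrow> complex) \<Rightarrow> bool" where
  "square_integrable f \<longleftrightarrow>
     f \<in> borel_measurable lborel \<and> integrable lborel (\<lambda>x. (cmod (f x))\<^sup>2)"

definition ae_eq :: "(real ^ 'n::finite \<Rightarrow> complex) \<Rightarrow> (real ^ 'n \<Rightarrow> complex) \<Rightarrow> bool" where
  "ae_eq f g \<longleftrightarrow> square_integrable f \<and> square_integrable g \<and> (AE x in lborel. f x = g x)"

lemma square_integrable_measurable [measurable_dest]:
  "square_integrable f \<Longrightarrow> f \<in> borel_measurable borel"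
  by (simp add: square_integrable_def)

lemma square_integrable_integrable:
  "square_integrable f \<Longrightarrow> integrable lborel (\<lambda>x. (cmod (f x))\<^sup>2)"
  by (simp add: square_integrable_def)

lemma square_integrable_0 [simp]: "square_integrable (\<lambda>_. 0)"
  by (simp add: square_integrable_def)

lemma square_integrable_scale:
  assumes "square_integrable f" shows "square_integrable (\<lambda>x. a * f x)"
  using assms by (auto simp: square_integrable_def norm_mult power_mult_distrib)

lemma square_integrable_add:
  assumes f: "square_integrable f" and g: "square_integrable g"
  shows "square_integrable (\<lambda>x. f x + g x)"
proof -
  note [measurable] = square_integrable_measurable[OF f] square_integrable_measurable[OF g]
  have "integrable lborel (\<lambda>x. (cmod (f x + g x))\<^sup>2)"
  proof (rule Bochner_Integration.integrable_bound)
    show "integrable lborel (\<lambda>x. 2 * (cmod (f x))\<^sup>2 + 2 * (cmod (g x))\<^sup>2)"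
      using f g by (simp add: square_integrable_integrable)
    have "(cmod (f x + g x))\<^sup>2 \<le> 2 * (cmod (f x))\<^sup>2 + 2 * (cmod (g x))\<^sup>2" for x
    proof -
      have "(cmod (f x + g x))\<^sup>2 \<le> (cmod (f x) + cmod (g x))\<^sup>2"
        by (simp add: norm_triangle_ineq power_mono)
      also have "\<dots> \<le> 2 * (cmod (f x))\<^sup>2 + 2 * (cmod (g x))\<^sup>2"
        using sum_squares_bound[of "cmod (f x)" "cmod (g x)"] by (simp add: power2_sum)
      finally show ?thesis .
    qed
    then show "AE x in lborel. norm ((cmod (f x + g x))\<^sup>2)
        \<le> norm (2 * (cmod (f x))\<^sup>2 + 2 * (cmod (g x))\<^sup>2)"
      by (intro AE_I2) simp
  qed simp
  then show ?thesis by (simp add: square_integrable_def)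
qed

lemma square_integrable_minus:
  "square_integrable f \<Longrightarrow> square_integrable (\<lambda>x. - f x)"
  using square_integrable_scale[of f "-1"] by simp

lemma square_integrable_diff:
  "square_integrable f \<Longrightarrow> square_integrable g \<Longrightarrow> square_integrable (\<lambda>x. f x - g x)"
  using square_integrable_add[OF _ square_integrable_minus, of f g] by simp

lemma borel_measurable_cnj [measurable (raw)]:
  "f \<in> borel_measurable M \<Longrightarrow> (\<lambda>x. cnj (f x)) \<in> borel_measurable M"
  by (rule measurable_compose[OF _ borel_measurable_continuous_onI]) (auto intro: continuous_intros)

lemma integrable_cnj_mult:
  assumes f: "square_integrable f" and g: "square_integrable g"
  shows "integrable lborel (\<lambda>x. cnj (f x) * g x)"
proof (rule Bochner_Integration.integrable_bound)
  note [measurable] = square_integrable_measurable[OF f] square_integrable_measurable[OF g]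
  show "integrable lborel (\<lambda>x. (cmod (f x))\<^sup>2 + (cmod (g x))\<^sup>2)"
    using f g by (simp add: square_integrable_integrable)
  show "(\<lambda>x. cnj (f x) * g x) \<in> borel_measurable lborel"
    by measurable
  have "cmod (f x) * cmod (g x) \<le> (cmod (f x))\<^sup>2 + (cmod (g x))\<^sup>2" for x
  proof -
    have "0 \<le> cmod (f x) * cmod (g x)" by simp
    then show ?thesis
      using sum_squares_bound[of "cmod (f x)" "cmod (g x)"] by linarith
  qed
  then show "AE x in lborel. norm (cnj (f x) * g x) \<le> norm ((cmod (f x))\<^sup>2 + (cmod (g x))\<^sup>2)"
    by (intro AE_I2) (simp add: norm_mult)
qed

quotient_type 'n L2 = "real ^ 'n::finite \<Rightarrow> complex" / partial: ae_eq
proof (rule part_equivpI)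
  show "\<exists>f. ae_eq f f" by (rule exI[of _ "\<lambda>_. 0"]) (simp add: ae_eq_def)
  show "symp ae_eq" by (rule sympI) (auto simp: ae_eq_def)
  show "transp ae_eq" by (rule transpI) (auto simp: ae_eq_def)
qed

lift_definition L2_cinner :: "'n::finite L2 \<Rightarrow> 'n L2 \<Rightarrow> complex" is
  "\<lambda>f g. \<integral>x. cnj (f x) * g x \<partial>lborel"
proof -
  fix f f' g g' :: "real ^ 'n \<Rightarrow> complex"
  assume "ae_eq f f'" "ae_eq g g'"
  then show "(\<integral>x. cnj (f x) * g x \<partial>lborel) = (\<integral>x. cnj (f' x) * g' x \<partial>lborel)"
    by (intro integral_cong_AE) (auto simp: ae_eq_def square_integrable_def)
qed

lift_definition L2_scaleC :: "complex \<Rightarrow> 'n::finite L2 \<Rightarrow> 'n L2" is "\<lambda>a f x. a * f x"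
  by (auto simp: ae_eq_def square_integrable_scale)

instantiation L2 :: (finite) plus
begin

lift_definition plus_L2 :: "'a L2 \<Rightarrow> 'a L2 \<Rightarrow> 'a L2" is "\<lambda>f g x. f x + g x"
  by (auto simp: ae_eq_def square_integrable_add)

instance ..

end

lemma L2_cinner_commute: "L2_cinner f g = cnj (L2_cinner g f)"
  by transfer (simp add: mult.commute flip: Bochner_Integration.integral_cnj)

lemma L2_cinner_add_right: "L2_cinner f (g + h) = L2_cinner f g + L2_cinner f h"
  by transfer (simp add: ae_eq_def distrib_left integrable_cnj_mult)

lemma L2_cinner_scaleC_right: "L2_cinner f (L2_scaleC a g) = a * L2_cinner f g"
  by transfer (simp add: ae_eq_def mult.left_commute)

lemma cnj_mult_self:
  "(\<integral>x. cnj (f x) * f x \<partial>M) = complex_of_real (\<integral>x. (cmod (f x))\<^sup>2 \<partial>M)"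
proof -
  have "cnj (f x) * f x = complex_of_real ((cmod (f x))\<^sup>2)" for x
    by (simp only: complex_norm_square mult.commute)
  then show ?thesis by (simp only: integral_complex_of_real)
qed

instantiation L2 :: (finite) real_inner
begin

lift_definition zero_L2 :: "'a L2" is "\<lambda>_. 0"
  by (simp add: ae_eq_def)

lift_definition minus_L2 :: "'a L2 \<Rightarrow> 'a L2 \<Rightarrow> 'a L2" is "\<lambda>f g x. f x - g x"
  by (auto simp: ae_eq_def square_integrable_diff)

lift_definition uminus_L2 :: "'a L2 \<Rightarrow> 'a L2" is "\<lambda>f x. - f x"
  by (auto simp: ae_eq_def square_integrable_minus)

definition scaleR_L2 :: "real \<Rightarrow> 'a L2 \<Rightarrow> 'a L2" where
  "scaleR_L2 r f = L2_scaleC (complex_of_real r) f"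

definition inner_L2 :: "'a L2 \<Rightarrow> 'a L2 \<Rightarrow> real" where
  "inner_L2 f g = Re (L2_cinner f g)"

definition norm_L2 :: "'a L2 \<Rightarrow> real" where
  "norm_L2 f = sqrt (inner f f)"

definition dist_L2 :: "'a L2 \<Rightarrow> 'a L2 \<Rightarrow> real" where
  "dist_L2 f g = norm (f - g)"

definition sgn_L2 :: "'a L2 \<Rightarrow> 'a L2" where
  "sgn_L2 f = inverse (norm f) *\<^sub>R f"

definition uniformity_L2 :: "('a L2 \<times> 'a L2) filter" where
  "uniformity_L2 = (INF e\<in>{0<..}. principal {(f, g). dist f g < e})"

definition open_L2 :: "'a L2 set \<Rightarrow> bool" where
  "open_L2 U \<longleftrightarrow> (\<forall>f\<in>U. \<forall>\<^sub>F (f', g) in uniformity. f' = f \<longrightarrow> g \<in> U)"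

instance
proof
  fix f g h :: "'a L2" and r s :: real
  show "f + g + h = f + (g + h)"
    by transfer (simp add: ae_eq_def square_integrable_add add.assoc)
  show "f + g = g + f"
    by transfer (simp add: ae_eq_def square_integrable_add add.commute)
  show "0 + f = f"
    by transfer (simp add: ae_eq_def)
  show "- f + f = 0"
    by transfer (simp add: ae_eq_def)
  show "f - g = f + - g"
    by transfer (simp add: ae_eq_def square_integrable_diff)
  show "r *\<^sub>R (f + g) = r *\<^sub>R f + r *\<^sub>R g"
    unfolding scaleR_L2_def
    by transfer (simp add: ae_eq_def square_integrable_add square_integrable_scale distrib_left)
  show "(r + s) *\<^sub>R f = r *\<^sub>R f + s *\<^sub>R f"
    unfolding scaleR_L2_def
    by transfer (simp add: ae_eq_def square_integrable_add square_integrable_scale distrib_right)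
  show "r *\<^sub>R s *\<^sub>R f = (r * s) *\<^sub>R f"
    unfolding scaleR_L2_def
    by transfer (simp add: ae_eq_def square_integrable_scale mult.assoc)
  show "1 *\<^sub>R f = f"
    unfolding scaleR_L2_def by transfer (simp add: ae_eq_def)
  show "dist f g = norm (f - g)"
    by (rule dist_L2_def)
  show "sgn f = inverse (norm f) *\<^sub>R f"
    by (rule sgn_L2_def)
  show "uniformity = (INF e\<in>{0<..}. principal {(f, g :: 'a L2). dist f g < e})"
    by (rule uniformity_L2_def)
  show "open U \<longleftrightarrow> (\<forall>f\<in>U. \<forall>\<^sub>F (f', g) in uniformity. f' = f \<longrightarrow> g \<in> U)" for U :: "'a L2 set"
    by (rule open_L2_def)
  show "norm f = sqrt (inner f f)"
    by (rule norm_L2_def)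
  show "inner f g = inner g f"
    unfolding inner_L2_def L2_cinner_commute[of f g] by simp
  show "inner (f + g) h = inner f h + inner g h"
    unfolding inner_L2_def L2_cinner_commute[of _ h] by (simp add: L2_cinner_add_right)
  show "inner (r *\<^sub>R f) g = r * inner f g"
    unfolding inner_L2_def scaleR_L2_def L2_cinner_commute[of _ g] by (simp add: L2_cinner_scaleC_right)
  show "0 \<le> inner f f"
    unfolding inner_L2_def
    by transfer (simp add: cnj_mult_self ae_eq_def)
  show "inner f f = 0 \<longleftrightarrow> f = 0"
    unfolding inner_L2_def
  proof transfer
    fix f :: "real ^ 'a \<Rightarrow> complex"
    assume "ae_eq f f"
    then have f: "square_integrable f" by (simp add: ae_eq_def)
    have "Re (\<integral>x. cnj (f x) * f x \<partial>lborel) = 0 \<longleftrightarrow> (AE x in lborel. (cmod (f x))\<^sup>2 = 0)"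
      using integral_nonneg_eq_0_iff_AE[OF square_integrable_integrable[OF f]]
      by (simp add: cnj_mult_self)
    then show "Re (\<integral>x. cnj (f x) * f x \<partial>lborel) = 0 \<longleftrightarrow> ae_eq f (\<lambda>_. 0)"
      using f by (simp add: ae_eq_def)
  qed
qed

end

lemma square_integrable_rep [simp]: "square_integrable (rep_L2 X)"
  using Quotient3_rep_reflp[OF Quotient3_L2, of X] by (simp add: ae_eq_def)

lemma abs_rep_L2 [simp]: "abs_L2 (rep_L2 X) = X"
  by (rule Quotient3_abs_rep[OF Quotient3_L2])

lemma norm_abs_L2_sq:
  assumes "square_integrable f"
  shows "(norm (abs_L2 f))\<^sup>2 = (\<integral>x. (cmod (f x))\<^sup>2 \<partial>lborel)"
proof -
  have "ae_eq f f" using assms by (simp add: ae_eq_def)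
  then have "L2_cinner (abs_L2 f) (abs_L2 f) = (\<integral>x. cnj (f x) * f x \<partial>lborel)"
    by (simp add: L2_cinner.abs_eq)
  then show ?thesis
    unfolding power2_norm_eq_inner[of "abs_L2 f"] inner_L2_def by (simp add: cnj_mult_self)
qed

lemma nn_integral_square_abs_L2:
  assumes "square_integrable f"
  shows "(\<integral>\<^sup>+x. ennreal ((cmod (f x))\<^sup>2) \<partial>lborel) = ennreal ((norm (abs_L2 f))\<^sup>2)"
  unfolding norm_abs_L2_sq[OF assms]
  by (rule nn_integral_eq_integral) (auto simp: square_integrable_integrable[OF assms])

lemma abs_L2_diff:
  assumes "square_integrable f" "square_integrable g"
  shows "abs_L2 (\<lambda>x. f x - g x) = abs_L2 f - abs_L2 g"
  using assms by (subst minus_L2.abs_eq) (auto simp: ae_eq_def)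

lemma nn_integral_rep_diff:
  "(\<integral>\<^sup>+x. ennreal ((cmod (rep_L2 X x - rep_L2 Y x))\<^sup>2) \<partial>lborel) = ennreal ((dist X Y)\<^sup>2)"
  using nn_integral_square_abs_L2[OF square_integrable_diff, of "rep_L2 X" "rep_L2 Y"]
  by (simp add: abs_L2_diff dist_norm)

instance L2 :: (finite) complete_space
proof
  fix X :: "nat \<Rightarrow> 'a L2"
  assume "Cauchy X"
  then have "\<forall>k. \<exists>N. \<forall>m\<ge>N. \<forall>n\<ge>N. dist (X m) (X n) < (1/4)^k"
    unfolding Cauchy_def by simp
  then obtain N where N: "\<And>k m n. m \<ge> N k \<Longrightarrow> n \<ge> N k \<Longrightarrow> dist (X m) (X n) < (1/4)^k"
    by metis
  define r where "r k = (\<Sum>i\<le>k. N i)" for k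
  have r_mono: "r j \<le> r k" if "j \<le> k" for j k
    unfolding r_def using that by (intro sum_mono2) auto
  have N_le_r: "N k \<le> r k" for k
    unfolding r_def by (intro member_le_sum) auto
  define g where "g k = rep_L2 (X (r k))" for k
  have sq_g: "square_integrable (g k)" for k by (simp add: g_def)
  note [measurable] = square_integrable_measurable[OF sq_g]
  define d where "d k x = g (Suc k) x - g k x" for k x
  have [measurable]: "d k \<in> borel_measurable borel" for k
    unfolding d_def by measurable
  have int_d: "(\<integral>\<^sup>+x. ennreal (4^k * (cmod (d k x))\<^sup>2) \<partial>lborel) \<le> ennreal ((1/4)^k)" for k
  proof -
    have "dist (X (r (Suc k))) (X (r k)) \<le> (1/4)^k"
      using N[of k "r (Suc k)" "r k"] N_le_r[of k] r_mono[of k "Suc k"] by simp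
    then have "(dist (X (r (Suc k))) (X (r k)))\<^sup>2 \<le> ((1/4)^k)\<^sup>2"
      by (intro power_mono) auto
    then have "4^k * (dist (X (r (Suc k))) (X (r k)))\<^sup>2 \<le> 4^k * ((1/4)^k)\<^sup>2"
      by (intro mult_left_mono) auto
    also have "\<dots> = (1/4::real)^k"
      by (simp add: power2_eq_square power_divide)
    finally have le: "4^k * (dist (X (r (Suc k))) (X (r k)))\<^sup>2 \<le> (1/4)^k" .
    have "(\<integral>\<^sup>+x. ennreal (4^k * (cmod (d k x))\<^sup>2) \<partial>lborel)
        = ennreal (4^k) * (\<integral>\<^sup>+x. ennreal ((cmod (d k x))\<^sup>2) \<partial>lborel)"
      by (subst nn_integral_cmult[symmetric]) (auto simp: ennreal_mult')
    also have "\<dots> = ennreal (4^k * (dist (X (r (Suc k))) (X (r k)))\<^sup>2)"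
      unfolding d_def g_def nn_integral_rep_diff by (simp add: ennreal_mult')
    finally show ?thesis using le by (simp add: ennreal_leI)
  qed
  have "(\<integral>\<^sup>+x. (\<Sum>k. ennreal (4^k * (cmod (d k x))\<^sup>2)) \<partial>lborel)
      = (\<Sum>k. \<integral>\<^sup>+x. ennreal (4^k * (cmod (d k x))\<^sup>2) \<partial>lborel)"
    by (rule nn_integral_suminf) measurable
  also have "\<dots> \<le> (\<Sum>k. ennreal ((1/4)^k))"
    by (intro suminf_le int_d summableI)
  also have "\<dots> = ennreal (\<Sum>k. (1/4)^k)"
    by (intro suminf_ennreal2) (auto simp: summable_geometric)
  also have "\<dots> < \<infinity>"
    by simp
  finally have "(\<integral>\<^sup>+x. (\<Sum>k. ennreal (4^k * (cmod (d k x))\<^sup>2)) \<partial>lborel) \<noteq> \<infinity>"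
    by simp
  then have "AE x in lborel. (\<Sum>k. ennreal (4^k * (cmod (d k x))\<^sup>2)) \<noteq> \<infinity>"
    by (intro nn_integral_noteq_infinite) measurable
  then have conv: "AE x in lborel. (\<lambda>k. g k x) \<longlonglongrightarrow> lim (\<lambda>k. g k x)"
  proof eventually_elim
    case (elim x)
    then have "summable (\<lambda>k. 4^k * (cmod (d k x))\<^sup>2)"
      by (intro summable_suminf_not_top) auto
    then have "bounded (range (\<lambda>k. 4^k * (cmod (d k x))\<^sup>2))"
      by (rule convergent_imp_bounded[OF summable_LIMSEQ_zero])
    then obtain C where C: "\<And>k. 4^k * (cmod (d k x))\<^sup>2 \<le> C"
      unfolding bounded_real by (auto simp: abs_le_iff)
    have le: "norm (d k x) \<le> sqrt C * (1/2)^k" for k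
    proof -
      have "2^k * cmod (d k x) = sqrt (4^k * (cmod (d k x))\<^sup>2)"
      proof (rule real_sqrt_unique[symmetric])
        have "(2^k::real)\<^sup>2 = 4^k"
          using power_mult_distrib[of "2::real" 2 k] by (simp add: power2_eq_square)
        then show "(2^k * cmod (d k x))\<^sup>2 = 4^k * (cmod (d k x))\<^sup>2"
          by (simp only: power_mult_distrib)
      qed simp
      also have "\<dots> \<le> sqrt C" using C by simp
      finally show ?thesis by (simp add: power_one_over divide_simps mult.commute)
    qed
    have "summable (\<lambda>k. sqrt C * (1/2)^k)"
      by (intro summable_mult summable_geometric) simp
    then have "summable (\<lambda>k. d k x)"
      by (rule summable_comparison_test'[where N = 0]) (rule le)
    then have "(\<lambda>n. \<Sum>k<n. d k x) \<longlonglongrightarrow> (\<Sum>k. d k x)"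
      by (rule summable_LIMSEQ)
    then have "(\<lambda>n. (\<Sum>k<n. d k x) + g 0 x) \<longlonglongrightarrow> (\<Sum>k. d k x) + g 0 x"
      by (intro tendsto_add tendsto_const)
    moreover have "(\<Sum>k<n. d k x) + g 0 x = g n x" for n
      unfolding d_def by (subst sum_lessThan_telescope) simp
    ultimately have "convergent (\<lambda>k. g k x)"
      by (auto simp: convergent_def)
    then show ?case by (simp add: convergent_LIMSEQ_iff)
  qed
  define G where "G x = lim (\<lambda>k. g k x)" for x
  have [measurable]: "G \<in> borel_measurable borel"
    unfolding G_def by measurable
  have bound: "(\<integral>\<^sup>+x. ennreal ((cmod (G x - g k x))\<^sup>2) \<partial>lborel) \<le> ennreal (((1/4)^k)\<^sup>2)" for k
  proof -
    have "(\<integral>\<^sup>+x. ennreal ((cmod (G x - g k x))\<^sup>2) \<partial>lborel)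
        = (\<integral>\<^sup>+x. liminf (\<lambda>j. ennreal ((cmod (g j x - g k x))\<^sup>2)) \<partial>lborel)"
    proof (rule nn_integral_cong_AE)
      show "AE x in lborel. ennreal ((cmod (G x - g k x))\<^sup>2)
          = liminf (\<lambda>j. ennreal ((cmod (g j x - g k x))\<^sup>2))"
        using conv
      proof eventually_elim
        case (elim x)
        then have "(\<lambda>j. ennreal ((cmod (g j x - g k x))\<^sup>2)) \<longlonglongrightarrow> ennreal ((cmod (G x - g k x))\<^sup>2)"
          unfolding G_def by (intro tendsto_intros)
        then show ?case
          by (rule lim_imp_Liminf[OF trivial_limit_sequentially, symmetric])
      qed
    qed
    also have "\<dots> \<le> liminf (\<lambda>j. \<integral>\<^sup>+x. ennreal ((cmod (g j x - g k x))\<^sup>2) \<partial>lborel)"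
      by (rule nn_integral_liminf) measurable
    also have "\<dots> \<le> liminf (\<lambda>j::nat. ennreal (((1/4)^k)\<^sup>2))"
    proof (rule Liminf_mono, rule eventually_sequentiallyI)
      fix j assume "k \<le> j"
      then have "dist (X (r j)) (X (r k)) \<le> (1/4)^k"
        using N[of k "r j" "r k"] N_le_r[of k] r_mono[of k j] by simp
      then have "(dist (X (r j)) (X (r k)))\<^sup>2 \<le> ((1/4)^k)\<^sup>2"
        by (intro power_mono) auto
      then show "(\<integral>\<^sup>+x. ennreal ((cmod (g j x - g k x))\<^sup>2) \<partial>lborel) \<le> ennreal (((1/4)^k)\<^sup>2)"
        unfolding g_def nn_integral_rep_diff by (rule ennreal_leI)
    qed
    also have "\<dots> = ennreal (((1/4)^k)\<^sup>2)"
      by (simp add: Liminf_const)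
    finally show ?thesis .
  qed
  have sq_diff: "square_integrable (\<lambda>x. G x - g k x)" for k
  proof -
    have "(\<integral>\<^sup>+x. ennreal ((cmod (G x - g k x))\<^sup>2) \<partial>lborel) < \<infinity>"
      using bound[of k] by (rule le_less_trans) simp
    then have "integrable lborel (\<lambda>x. (cmod (G x - g k x))\<^sup>2)"
      by (intro integrableI_nonneg) auto
    then show ?thesis by (simp add: square_integrable_def)
  qed
  have sq_G: "square_integrable G"
    using square_integrable_add[OF sq_diff[of 0] sq_g[of 0]] by simp
  have dist_G: "dist (X (r k)) (abs_L2 G) \<le> (1/4)^k" for k
  proof -
    have "ennreal ((dist (X (r k)) (abs_L2 G))\<^sup>2) \<le> ennreal (((1/4)^k)\<^sup>2)"
      using bound[of k] nn_integral_square_abs_L2[OF sq_diff[of k]] abs_L2_diff[OF sq_G sq_g[of k]]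
      by (simp add: g_def dist_norm norm_minus_commute)
    then have "(dist (X (r k)) (abs_L2 G))\<^sup>2 \<le> ((1/4)^k)\<^sup>2"
      by simp
    then show ?thesis by (rule power2_le_imp_le) simp
  qed
  have "X \<longlonglongrightarrow> abs_L2 G"
  proof (rule metric_LIMSEQ_I)
    fix e :: real assume "0 < e"
    then have "\<exists>k. (1/4)^k < e/2"
      by (intro real_arch_pow_inv) auto
    then obtain k where k: "(1/4)^k < e/2" ..
    have "dist (X n) (abs_L2 G) < e" if "n \<ge> r k" for n
    proof -
      have "dist (X n) (X (r k)) < (1/4)^k"
        using N_le_r[of k] that by (intro N) auto
      then show ?thesis
        using dist_G[of k] k dist_triangle[of "X n" "abs_L2 G" "X (r k)"] by linarith
    qed
    then show "\<exists>M. \<forall>n\<ge>M. dist (X n) (abs_L2 G) < e" by blast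
  qed
  then show "convergent X" by (rule convergentI)
qed

instantiation L2 :: (finite) complex_hilbert_space
begin

definition scaleC_L2 :: "complex \<Rightarrow> 'a L2 \<Rightarrow> 'a L2" where
  "scaleC_L2 = L2_scaleC"

definition cinner_L2 :: "'a L2 \<Rightarrow> 'a L2 \<Rightarrow> complex" where
  "cinner_L2 = L2_cinner"

instance
proof
  fix f g h :: "'a L2" and a b :: complex and r :: real
  show "a *\<^sub>C (f + g) = a *\<^sub>C f + a *\<^sub>C g"
    unfolding scaleC_L2_def
    by transfer (simp add: ae_eq_def square_integrable_add square_integrable_scale distrib_left)
  show "(a + b) *\<^sub>C f = a *\<^sub>C f + b *\<^sub>C f"
    unfolding scaleC_L2_def
    by transfer (simp add: ae_eq_def square_integrable_add square_integrable_scale distrib_right)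
  show "a *\<^sub>C b *\<^sub>C f = (a * b) *\<^sub>C f"
    unfolding scaleC_L2_def
    by transfer (simp add: ae_eq_def square_integrable_scale mult.assoc)
  show "r *\<^sub>R f = complex_of_real r *\<^sub>C f"
    by (simp add: scaleC_L2_def scaleR_L2_def)
  show "cinner f g = cnj (cinner g f)"
    unfolding cinner_L2_def by (rule L2_cinner_commute)
  show "cinner f (g + h) = cinner f g + cinner f h"
    unfolding cinner_L2_def by (rule L2_cinner_add_right)
  show "cinner f (a *\<^sub>C g) = a * cinner f g"
    unfolding cinner_L2_def scaleC_L2_def by (rule L2_cinner_scaleC_right)
  show "inner f g = Re (cinner f g)"
    by (simp add: cinner_L2_def inner_L2_def)
qed

end


section \<open>Unbounded operators\<close>

text \<open>An operator with domain \<open>D(T)\<close> is a partial function \<open>T\<close> with \<open>dom T = D(T)\<close>; equality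
  of partial functions is equality of operators, domains included.\<close>

definition app :: "('a \<rightharpoonup> 'b) \<Rightarrow> 'a \<Rightarrow> 'b"  (infixr "\<cdot>" 80) where
  "T \<cdot> u = the (T u)"

definition linear_operator :: "('a::complex_hilbert_space \<rightharpoonup> 'a) \<Rightarrow> bool" where
  "linear_operator T \<longleftrightarrow>
     0 \<in> dom T \<and>
     (\<forall>u\<in>dom T. \<forall>v\<in>dom T. u + v \<in> dom T \<and> T \<cdot> (u + v) = T \<cdot> u + T \<cdot> v) \<and>
     (\<forall>a. \<forall>u\<in>dom T. a *\<^sub>C u \<in> dom T \<and> T \<cdot> (a *\<^sub>C u) = a *\<^sub>C (T \<cdot> u))"

definition adjoint_operator :: "('a::complex_hilbert_space \<rightharpoonup> 'a) \<Rightarrow> ('a \<rightharpoonup> 'a)" where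
  "adjoint_operator T v =
     (if \<exists>w. \<forall>u\<in>dom T. cinner (T \<cdot> u) v = cinner u w
      then Some (THE w. \<forall>u\<in>dom T. cinner (T \<cdot> u) v = cinner u w)
      else None)"

definition self_adjoint :: "('a::complex_hilbert_space \<rightharpoonup> 'a) \<Rightarrow> bool" where
  "self_adjoint T \<longleftrightarrow>
     linear_operator T \<and> closure (dom T) = UNIV \<and> adjoint_operator T = T"

text \<open>Strict positivity \<open>H > 0\<close>: nonnegative with trivial kernel, but not necessarily bounded
  below by a positive constant.\<close>

definition positive_operator :: "('a::complex_hilbert_space \<rightharpoonup> 'a) \<Rightarrow> bool" where
  "positive_operator H \<longleftrightarrow>
     (\<forall>u\<in>dom H. u \<noteq> 0 \<longrightarrow> cinner u (H \<cdot> u) \<in> \<real> \<and> 0 < Re (cinner u (H \<cdot> u)))"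

definition resolvent :: "('a::complex_hilbert_space \<rightharpoonup> 'a) \<Rightarrow> complex \<Rightarrow> 'a \<Rightarrow> 'a" where
  "resolvent H z v = (THE u. u \<in> dom H \<and> H \<cdot> u - z *\<^sub>C u = v)"

definition resolvent_set :: "('a::complex_hilbert_space \<rightharpoonup> 'a) \<Rightarrow> complex set" where
  "resolvent_set H =
     {z. (\<forall>v. \<exists>!u. u \<in> dom H \<and> H \<cdot> u - z *\<^sub>C u = v) \<and> bounded_linear (resolvent H z)}"


section \<open>Commutators\<close>

definition C1_bounded :: "('a::complex_hilbert_space \<rightharpoonup> 'a) \<Rightarrow> ('a \<Rightarrow> 'a) \<Rightarrow> bool" where
  "C1_bounded A S \<longleftrightarrow>
     continuous_on (dom A \<times> dom A) (\<lambda>(u, v). cinner (A \<cdot> u) (S v) - cinner u (S (A \<cdot> v)))"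

definition C1_class :: "('a::complex_hilbert_space \<rightharpoonup> 'a) \<Rightarrow> ('a \<rightharpoonup> 'a) \<Rightarrow> bool" where
  "C1_class A H \<longleftrightarrow> (\<exists>z\<in>resolvent_set H. C1_bounded A (resolvent H z))"

definition sesquilinear_on ::
    "'a::complex_hilbert_space set \<Rightarrow> ('a \<Rightarrow> 'a \<Rightarrow> complex) \<Rightarrow> bool" where
  "sesquilinear_on D q \<longleftrightarrow>
     (\<forall>u\<in>D. \<forall>v\<in>D. \<forall>w\<in>D.
        q (u + v) w = q u w + q v w \<and> q u (v + w) = q u v + q u w) \<and>
     (\<forall>a. \<forall>u\<in>D. \<forall>v\<in>D. q (a *\<^sub>C u) v = cnj a * q u v \<and> q u (a *\<^sub>C v) = a * q u v)"

text \<open>Continuity of a form \<open>q\<close> for the graph topology of \<open>D(H)\<close> is expressed by transporting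
  \<open>q\<close> to the graph of \<open>H\<close>, with the topology inherited from the product space.\<close>

definition is_commutator_form ::
    "('a::complex_hilbert_space \<rightharpoonup> 'a) \<Rightarrow> ('a \<rightharpoonup> 'a) \<Rightarrow> ('a \<Rightarrow> 'a \<Rightarrow> complex) \<Rightarrow> bool" where
  "is_commutator_form A H q \<longleftrightarrow>
     sesquilinear_on (dom H) q \<and>
     continuous_on (Map.graph H \<times> Map.graph H) (\<lambda>(x, y). q (fst x) (fst y)) \<and>
     (\<forall>u\<in>dom A \<inter> dom H. \<forall>v\<in>dom A \<inter> dom H.
        q u v = cinner (A \<cdot> u) (H \<cdot> v) - cinner (H \<cdot> u) (A \<cdot> v))"

text \<open>\<open>[H, iA] = cH\<close> as forms on \<open>D(H)\<close>. If \<open>H\<close> is of class \<open>C\<^sup>1(A)\<close>, the form \<open>q\<close>, which is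
  the continuous extension \<open>[A, H]\<close>, exists and is unique on \<open>D(H)\<close>.\<close>

definition commutation_relation ::
    "('a::complex_hilbert_space \<rightharpoonup> 'a) \<Rightarrow> ('a \<rightharpoonup> 'a) \<Rightarrow> real \<Rightarrow> bool" where
  "commutation_relation H A c \<longleftrightarrow>
     (\<exists>q. is_commutator_form A H q \<and>
        (\<forall>u\<in>dom H. \<forall>v\<in>dom H. - \<i> * q u v = c * cinner u (H \<cdot> v)))"


section \<open>Borel functional calculus\<close>

definition orthogonal_projection :: "('a::complex_hilbert_space \<Rightarrow> 'a) \<Rightarrow> bool" where
  "orthogonal_projection P \<longleftrightarrow>
     (\<forall>u v. P (u + v) = P u + P v) \<and> (\<forall>a u. P (a *\<^sub>C u) = a *\<^sub>C P u) \<and>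
     (\<forall>u. P (P u) = P u) \<and> (\<forall>u v. cinner (P u) v = cinner u (P v))"

definition projection_valued_measure ::
    "(real set \<Rightarrow> 'a::complex_hilbert_space \<Rightarrow> 'a) \<Rightarrow> bool" where
  "projection_valued_measure E \<longleftrightarrow>
     (\<forall>B\<in>sets borel. orthogonal_projection (E B)) \<and>
     E UNIV = id \<and>
     (\<forall>B\<in>sets borel. \<forall>C\<in>sets borel. E (B \<inter> C) = E B \<circ> E C) \<and>
     (\<forall>B u. range B \<subseteq> sets borel \<longrightarrow> disjoint_family B \<longrightarrow>
        (\<lambda>i::nat. E (B i) u) sums E (\<Union>i. B i) u)"

definition scalar_spectral_measure ::
    "(real set \<Rightarrow> 'a::complex_hilbert_space \<Rightarrow> 'a) \<Rightarrow> 'a \<Rightarrow> real measure" where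
  "scalar_spectral_measure E u =
     measure_of UNIV (sets borel) (\<lambda>B. ennreal (Re (cinner u (E B u))))"

text \<open>\<open>T = \<integral> \<phi> dE\<close>. By polarization on the subspace \<open>dom T\<close>, \<open>T\<close> is determined by \<open>E\<close> and \<open>\<phi>\<close>.\<close>

definition is_spectral_integral ::
    "(real set \<Rightarrow> 'a::complex_hilbert_space \<Rightarrow> 'a) \<Rightarrow> (real \<Rightarrow> complex) \<Rightarrow> ('a \<rightharpoonup> 'a) \<Rightarrow> bool" where
  "is_spectral_integral E \<phi> T \<longleftrightarrow>
     linear_operator T \<and>
     dom T = {u. integrable (scalar_spectral_measure E u) (\<lambda>x. (cmod (\<phi> x))\<^sup>2)} \<and>
     (\<forall>u\<in>dom T. cinner u (T \<cdot> u) = (\<integral>x. \<phi> x \<partial>scalar_spectral_measure E u))"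

text \<open>By the spectral theorem, a self-adjoint operator has exactly one spectral measure (up to
  the irrelevant values of \<open>E\<close> at non-Borel sets).\<close>

definition spectral_measure ::
    "('a::complex_hilbert_space \<rightharpoonup> 'a) \<Rightarrow> (real set \<Rightarrow> 'a \<Rightarrow> 'a)" where
  "spectral_measure H =
     (SOME E. projection_valued_measure E \<and> is_spectral_integral E complex_of_real H)"

definition functional_calculus ::
    "(real \<Rightarrow> complex) \<Rightarrow> ('a::complex_hilbert_space \<rightharpoonup> 'a) \<Rightarrow> ('a \<rightharpoonup> 'a)" where
  "functional_calculus \<phi> H = (THE T. is_spectral_integral (spectral_measure H) \<phi> T)"


section \<open>The wave propagators and the norm \<open>[h]\<^sub>H\<close>\<close>

definition u\<^sub>1 :: "('a::complex_hilbert_space \<rightharpoonup> 'a) \<Rightarrow> real \<Rightarrow> 'a \<Rightarrow> 'a" where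
  "u\<^sub>1 H t f = functional_calculus (\<lambda>x. complex_of_real (cos (t * x))) H \<cdot> f"

text \<open>\<open>sin (tx) / x\<close> is extended continuously to \<open>x = 0\<close>; this value does not matter for an
  injective \<open>H\<close>.\<close>

definition u\<^sub>2 :: "('a::complex_hilbert_space \<rightharpoonup> 'a) \<Rightarrow> real \<Rightarrow> 'a \<Rightarrow> 'a" where
  "u\<^sub>2 H t f =
     functional_calculus (\<lambda>x. complex_of_real (if x = 0 then t else sin (t * x) / x)) H \<cdot> f"

definition \<psi> :: "('a::complex_hilbert_space \<rightharpoonup> 'a) \<Rightarrow> 'a \<Rightarrow> 'a \<Rightarrow> real \<Rightarrow> complex" where
  "\<psi> H f g t = cinner f (u\<^sub>1 H t f) + cinner f (u\<^sub>2 H t g)"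

definition sqrt_ennreal :: "ennreal \<Rightarrow> ennreal" where
  "sqrt_ennreal x = (if x = \<infinity> then \<infinity> else ennreal (sqrt (enn2real x)))"

definition L2_norm_time :: "(real \<Rightarrow> complex) \<Rightarrow> ennreal" where
  "L2_norm_time \<phi> = sqrt_ennreal (\<integral>\<^sup>+t. ennreal ((cmod (\<phi> t))\<^sup>2) \<partial>lborel)"

definition H_norm :: "('a::complex_hilbert_space \<rightharpoonup> 'a) \<Rightarrow> 'a \<Rightarrow> ennreal" where
  "H_norm H h =
     sqrt_ennreal (L2_norm_time (\<lambda>t. cinner h (u\<^sub>1 H t h))) +
     sqrt_ennreal (L2_norm_time (\<lambda>t. cinner h (u\<^sub>2 H t h)))"

definition \<E> :: "('a::complex_hilbert_space \<rightharpoonup> 'a) \<Rightarrow> 'a set" where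
  "\<E> H = {h. H_norm H h < \<infinity>}"

definition japanese_bracket :: "real \<Rightarrow> real" where
  "japanese_bracket t = sqrt (1 + t\<^sup>2)"

end

theory Submission
  imports Defs "HOL-Probability.Levy" "HOL-Probability.Helly_Selection"
    "HOL-Probability.Probability_Mass_Function" "HOL-Computational_Algebra.Polynomial" "HOL-Real_Asymp.Real_Asymp"
begin

text \<open>The commutation relation gives \<open>[A, \<phi>(H)] = i c (x \<phi>'(x))(H)\<close>, first for polynomials in
  \<open>(H + 1)\<^sup>-\<^sup>1\<close> and then, by bounded pointwise limits of the symbols, for \<open>\<phi>(x) = sin (t x) / x\<close>, where
  \<open>x \<phi>'(x) = t cos (t x) - \<phi>(x)\<close> is still bounded. Hence \<open>t \<langle>f, u\<^sub>1(t) g\<rangle>\<close> is the sum of \<open>\<langle>f, u\<^sub>2(t) g\<rangle>\<close>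
  and \<open>(i c)\<^sup>-\<^sup>1 (\<langle>A f, u\<^sub>2(t) g\<rangle> - \<langle>f, u\<^sub>2(t) A g\<rangle>)\<close>. Since \<open>u\<^sub>2' = u\<^sub>1\<close> weakly, both matrix elements \<open>y\<close>
  occurring in \<open>\<psi>\<close> are differentiable with \<open>t y'(t)\<close> a combination of matrix elements between
  \<open>f, g, A f, A g\<close>. The space \<open>\<E>\<close> is a vector space, so polarization puts \<open>y\<close> and \<open>t y'\<close> in \<open>L\<^sup>2\<close>;
  then \<open>(t y\<^sup>2)'\<close> is integrable and \<open>t y\<^sup>2\<close> is bounded.

  The spectral theorem for \<open>H\<close> comes from the positive contraction \<open>(H + 1)\<^sup>-\<^sup>1\<close>, whose scalar spectral
  measures are weak limits of the measures with weights
  \<open>(n choose k) \<langle>u, B\<^sup>k (1 - B)\<^sup>n\<^sup>-\<^sup>k u\<rangle>\<close> at \<open>k / n\<close>.\<close>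

section \<open>Complex Hilbert spaces\<close>

text \<open>Two obstacles shape the argument. First, the symbol
  \<open>- t * x * sin (t * x)\<close>, which a commutator of cos(tH) with \<open>A\<close> would
  have, is unbounded in x. Division of the sine by x restores boundedness, and the decay of the
  cosine element comes from differentiating the identity for the sine element. Second,
  \<open>\<E>\<close> speaks of diagonal elements q(h) only, and the parallelogram law controls only
  the sum q(f+g) + q(f-g) as a function of t. What saves the day is that the correlation of any two
  such functions is nonnegative, so that the integrated square of the sum dominates that of each
  term; Gaussian weights give this a meaning before anything is known to be integrable. Polynomials
  in the inverse of H + 1 come first because they preserve \<open>dom A\<close>, on which the
  Leibniz rule relies; limits are then taken for matrix elements on \<open>dom A\<close>. The
  binomial weights are nonnegative without recourse to square roots of operators: pulling out
  squares leaves only 1, B, 1 - B and B (1 - B).\<close>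

lemma cinner_add_left: "cinner (x + y) z = cinner x z + cinner y (z::'a::complex_hilbert_space)"
  by (metis cinner_add_right cinner_commute complex_cnj_add)

lemma cinner_scaleC_left: "cinner (a *\<^sub>C x) (y::'a::complex_hilbert_space) = cnj a * cinner x y"
  by (metis cinner_commute cinner_scaleC_right complex_cnj_mult)

lemma scaleC_one [simp]: "1 *\<^sub>C (x::'a::complex_hilbert_space) = x"
  using scaleR_scaleC[of 1 x] by simp

lemma scaleC_zero_left [simp]: "0 *\<^sub>C (x::'a::complex_hilbert_space) = 0"
  using scaleR_scaleC[of 0 x] by simp

lemma scaleC_zero_right [simp]: "a *\<^sub>C (0::'a::complex_hilbert_space) = 0"
  using scaleC_add_right[of a 0 0] by simp

lemma scaleC_minus_right [simp]: "a *\<^sub>C (- x::'a::complex_hilbert_space) = - (a *\<^sub>C x)"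
  using scaleC_add_right[of a x "-x"] by (simp add: eq_neg_iff_add_eq_0 add.commute)

lemma scaleC_diff_right: "a *\<^sub>C (x - y::'a::complex_hilbert_space) = a *\<^sub>C x - a *\<^sub>C y"
  using scaleC_add_right[of a x "-y"] by simp

lemma scaleC_minus_left [simp]: "(- a) *\<^sub>C (x::'a::complex_hilbert_space) = - (a *\<^sub>C x)"
  using scaleC_add_left[of a "-a" x] by (simp add: eq_neg_iff_add_eq_0 add.commute)

lemma scaleC_scaleR: "a *\<^sub>C r *\<^sub>R (x::'a::complex_hilbert_space) = r *\<^sub>R a *\<^sub>C x"
  by (simp add: scaleR_scaleC scaleC_scaleC mult.commute)

lemma cinner_zero_left [simp]: "cinner 0 (x::'a::complex_hilbert_space) = 0"
  using cinner_add_left[of 0 0 x] by simp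

lemma cinner_zero_right [simp]: "cinner (x::'a::complex_hilbert_space) 0 = 0"
  using cinner_add_right[of x 0 0] by simp

lemma cinner_minus_left [simp]: "cinner (- x) (y::'a::complex_hilbert_space) = - cinner x y"
  using cinner_add_left[of x "-x" y] by (simp add: eq_neg_iff_add_eq_0 add.commute)

lemma cinner_minus_right [simp]: "cinner (x::'a::complex_hilbert_space) (- y) = - cinner x y"
  using cinner_add_right[of x y "-y"] by (simp add: eq_neg_iff_add_eq_0 add.commute)

lemma cinner_diff_left: "cinner (x - y) (z::'a::complex_hilbert_space) = cinner x z - cinner y z"
  using cinner_add_left[of x "-y" z] by simp

lemma cinner_diff_right: "cinner (x::'a::complex_hilbert_space) (y - z) = cinner x y - cinner x z"
  using cinner_add_right[of x y "-z"] by simp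

lemma cinner_scaleR_left: "cinner (r *\<^sub>R x) (y::'a::complex_hilbert_space) = r * cinner x y"
  by (simp add: scaleR_scaleC cinner_scaleC_left)

lemma cinner_scaleR_right: "cinner (x::'a::complex_hilbert_space) (r *\<^sub>R y) = r * cinner x y"
  by (simp add: scaleR_scaleC cinner_scaleC_right)

lemmas cinner_algebra =
  cinner_add_left cinner_add_right cinner_diff_left cinner_diff_right
  cinner_scaleC_left cinner_scaleC_right cinner_scaleR_left cinner_scaleR_right

lemma cinner_self: "cinner x (x::'a::complex_hilbert_space) = (norm x)\<^sup>2"
proof -
  have "Im (cinner x x) = 0" using cinner_commute[of x x] by (metis cnj.sel(2) equal_neg_zero)
  then show ?thesis
    by (simp add: complex_eq_iff power2_norm_eq_inner inner_cinner)
qed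

lemma norm_scaleC: "norm (a *\<^sub>C (x::'a::complex_hilbert_space)) = cmod a * norm x"
proof -
  have "cinner (a *\<^sub>C x) (a *\<^sub>C x) = (a * cnj a) * cinner x x"
    by (simp add: cinner_scaleC_left cinner_scaleC_right)
  also have "\<dots> = complex_of_real ((cmod a)\<^sup>2 * (norm x)\<^sup>2)"
    by (simp only: complex_norm_square[symmetric] cinner_self of_real_mult)
  finally have "(norm (a *\<^sub>C x))\<^sup>2 = (cmod a * norm x)\<^sup>2"
    by (simp only: cinner_self of_real_eq_iff power_mult_distrib)
  then show ?thesis by (rule power2_eq_imp_eq) auto
qed

lemma cinner_eq_inner: "cinner x (y::'a::complex_hilbert_space) = Complex (inner x y) (- inner x (\<i> *\<^sub>C y))"
  by (simp add: complex_eq_iff inner_cinner cinner_scaleC_right)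

text \<open>A scalar \<open>a\<close> of modulus 1 rotates the complex inner product onto the
  positive real axis, where the real Cauchy-Schwarz inequality applies.\<close>

lemma cmod_cinner_le: "cmod (cinner x (y::'a::complex_hilbert_space)) \<le> norm x * norm y"
proof (cases "cinner x y = 0")
  case False
  define a where "a = cnj (cinner x y) / cmod (cinner x y)"
  have "cmod a = 1" using False by (simp add: a_def norm_divide)
  have "a * cinner x y = cmod (cinner x y)"
    using False by (simp add: a_def complex_norm_square[symmetric] power2_eq_square mult.commute field_simps)
  then have "inner x (a *\<^sub>C y) = cmod (cinner x y)"
    by (simp add: inner_cinner cinner_scaleC_right)
  moreover have "inner x (a *\<^sub>C y) \<le> norm x * norm (a *\<^sub>C y)" by (rule norm_cauchy_schwarz)
  ultimately show ?thesis by (simp add: norm_scaleC \<open>cmod a = 1\<close>)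
qed simp

lemma eq_if_inner_eq: "(\<And>u. inner u x = inner u y) \<Longrightarrow> x = (y::'a::real_inner)"
  by (metis inner_diff_right inner_eq_zero_iff right_minus_eq)

lemma bounded_linear_scaleC: "bounded_linear (\<lambda>x::'a::complex_hilbert_space. a *\<^sub>C x)"
  by (rule bounded_linear_intro[where K = "cmod a"])
    (simp_all add: scaleC_add_right scaleC_scaleR norm_scaleC mult.commute)

lemma bounded_linear_cinner_right: "bounded_linear (\<lambda>y::'a::complex_hilbert_space. cinner x y)"
  by (rule bounded_linear_intro[where K = "norm x"])
    (simp_all add: cinner_algebra scaleR_conv_of_real cmod_cinner_le mult.commute[of "norm _" "norm x"])

lemmas tendsto_cinner_right = bounded_linear.tendsto[OF bounded_linear_cinner_right]
lemmas tendsto_scaleC = bounded_linear.tendsto[OF bounded_linear_scaleC]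

text \<open>Valid for every complex linear \<open>T\<close>, symmetric or not, at the price of four
  vectors. Each is \<open>f\<close> plus a complex multiple of \<open>g\<close>, so closure under
  scaling and addition treats them alike.\<close>

lemma cinner_polarization:
  fixes f g :: "'a::complex_hilbert_space"
  assumes add: "\<And>x y. T (x + y) = T x + T y" and scale: "\<And>a x. T (a *\<^sub>C x) = a *\<^sub>C T x"
  shows "4 * cinner f (T g) =
    cinner (f + g) (T (f + g)) - cinner (f + (-1) *\<^sub>C g) (T (f + (-1) *\<^sub>C g))
    - \<i> * cinner (f + \<i> *\<^sub>C g) (T (f + \<i> *\<^sub>C g)) + \<i> * cinner (f + (-\<i>) *\<^sub>C g) (T (f + (-\<i>) *\<^sub>C g))"
  unfolding add scale cinner_add_left cinner_add_right cinner_scaleC_left cinner_scaleC_right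
  by (simp add: algebra_simps)

text \<open>By the parallelogram law a sequence minimising the distance to \<open>a\<close> is
  Cauchy; perturbing its limit inside \<open>S\<close> shows that the residual is
  orthogonal.\<close>

theorem orthogonal_projection_exists:
  fixes S :: "'a::{real_inner,complete_space} set"
  assumes S: "subspace S" "closed S"
  shows "\<exists>p\<in>S. \<forall>y\<in>S. inner (a - p) y = 0"
proof -
  define d where "d = (INF y\<in>S. (norm (a - y))\<^sup>2)"
  have ne: "S \<noteq> {}" using subspace_0[OF S(1)] by auto
  have bdd: "bdd_below ((\<lambda>y. (norm (a - y))\<^sup>2) ` S)" by (rule bdd_belowI[of _ 0]) auto
  have d_le: "d \<le> (norm (a - y))\<^sup>2" if "y \<in> S" for y
    unfolding d_def using that bdd by (rule cINF_lower[rotated])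
  have "\<exists>y\<in>S. (norm (a - y))\<^sup>2 < d + 1 / Suc n" for n
    using cINF_less_iff[OF ne bdd, of "d + 1 / Suc n"] unfolding d_def by simp
  then obtain y where y: "\<And>n. y n \<in> S" "\<And>n. (norm (a - y n))\<^sup>2 < d + 1 / Suc n"
    by metis
  have dist_y: "(norm (y m - y n))\<^sup>2 \<le> 2 / Suc m + 2 / Suc n" for m n
  proof -
    \<comment> \<open>The midpoint lies in \<open>S\<close>, so its distance is at least the
      infimum; this is what bounds the distance from \<open>y m\<close> to
      \<open>y n\<close>.\<close>
    define q where "q = (1/2) *\<^sub>R (y m + y n)"
    have "q \<in> S" unfolding q_def
      using y(1) S(1) by (simp add: subspace_add subspace_scale)
    note d_le[OF this]
    moreover have "(norm (y m - y n))\<^sup>2 = 2 * (norm (a - y m))\<^sup>2 + 2 * (norm (a - y n))\<^sup>2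
        - 4 * (norm (a - q))\<^sup>2"
      unfolding q_def
      by (simp add: power2_norm_eq_inner algebra_simps inner_commute)
    moreover have "N \<le> 2 * x + 2 * z" if "d \<le> Q" "N = 2 * a + 2 * b - 4 * Q" "a < d + x" "b < d + z"
      for N a b Q x z :: real
      using that by linarith
    ultimately have "(norm (y m - y n))\<^sup>2 \<le> 2 * (1 / Suc m) + 2 * (1 / Suc n)"
      using y(2)[of m] y(2)[of n] by blast
    then show ?thesis by simp
  qed
  have "Cauchy y"
  proof (rule metric_CauchyI)
    fix e :: real assume "0 < e"
    obtain N where N: "4 / e\<^sup>2 < real N" using reals_Archimedean2 by blast
    have "dist (y m) (y n) < e" if "m \<ge> N" "n \<ge> N" for m n
    proof -
      have "0 < 4 / e\<^sup>2" using \<open>0 < e\<close> by simp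
      then have "0 < real N" using N by linarith
      then have "0 < N" by simp
      then have "2 / Suc m \<le> 2 / real N" "2 / Suc n \<le> 2 / real N"
        using that by (auto intro!: divide_left_mono)
      moreover have "4 / real N < e\<^sup>2" using N \<open>0 < e\<close> \<open>0 < N\<close> by (simp add: field_simps)
      ultimately have "(norm (y m - y n))\<^sup>2 < e\<^sup>2" using dist_y[of m n] by simp
      then show ?thesis using \<open>0 < e\<close> by (simp add: dist_norm power2_less_imp_less)
    qed
    then show "\<exists>N. \<forall>m\<ge>N. \<forall>n\<ge>N. dist (y m) (y n) < e" by blast
  qed
  then obtain p where p: "y \<longlonglongrightarrow> p" using Cauchy_convergent_iff convergent_def by blast
  have "p \<in> S" using closed_sequentially[OF S(2) _ p] y(1) by blast
  have "(\<lambda>n. (norm (a - y n))\<^sup>2) \<longlonglongrightarrow> (norm (a - p))\<^sup>2"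
    by (intro tendsto_intros p)
  moreover have "(\<lambda>n. d + 1 / Suc n) \<longlonglongrightarrow> d + 0"
    by (intro tendsto_intros LIMSEQ_Suc[OF lim_1_over_n])
  ultimately have pd: "(norm (a - p))\<^sup>2 \<le> d"
    using y(2) by (intro LIMSEQ_le[of _ _ "\<lambda>n. d + 1 / Suc n"]) (auto intro: less_imp_le)
  have "inner (a - p) v = 0" if "v \<in> S" for v
  proof (cases "v = 0")
    case False
    \<comment> \<open>The step along \<open>v\<close> that minimises the distance; a nonzero inner
      product would beat the infimum \<open>d\<close>.\<close>
    define r where "r = inner (a - p) v / inner v v"
    have "p + r *\<^sub>R v \<in> S" using \<open>p \<in> S\<close> that S(1) by (simp add: subspace_add subspace_scale)
    then have "(norm (a - p))\<^sup>2 \<le> (norm (a - (p + r *\<^sub>R v)))\<^sup>2" by (rule order_trans[OF pd d_le])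
    moreover have "a - (p + r *\<^sub>R v) = (a - p) - r *\<^sub>R v" by simp
    moreover have "(norm (w - r *\<^sub>R v))\<^sup>2 = (norm w)\<^sup>2 - 2 * r * inner w v + r * (r * inner v v)" for w
      by (simp add: power2_norm_eq_inner inner_diff_left inner_diff_right inner_commute[of v w] right_diff_distrib)
    moreover have "r * inner v v = inner (a - p) v" using False by (simp add: r_def)
    ultimately have "r * inner (a - p) v \<le> 0" by simp
    then have "(inner (a - p) v)\<^sup>2 / inner v v \<le> 0" by (simp add: r_def power2_eq_square)
    moreover have "inner v v > 0" using False by simp
    ultimately show ?thesis by (simp add: divide_le_0_iff)
  qed simp
  then show ?thesis using \<open>p \<in> S\<close> by blast
qed

lemma subspace_closure:
  fixes G :: "'a::real_normed_vector set"
  assumes "subspace G" shows "subspace (closure G)"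
proof (rule subspaceI)
  show "0 \<in> closure G" using subspace_0[OF assms] closure_subset by blast
  show "x + y \<in> closure G" if xy: "x \<in> closure G" "y \<in> closure G" for x y
  proof -
    obtain a b where "\<And>n. a n \<in> G" "a \<longlonglongrightarrow> x" "\<And>n. b n \<in> G" "b \<longlonglongrightarrow> y"
      using xy unfolding closure_sequential by blast
    then show ?thesis
      unfolding closure_sequential
      by (intro exI[of _ "\<lambda>n. a n + b n"]) (auto intro: tendsto_add subspace_add[OF assms])
  qed
  show "c *\<^sub>R x \<in> closure G" if x: "x \<in> closure G" for c x
  proof -
    obtain a where "\<And>n. a n \<in> G" "a \<longlonglongrightarrow> x" using x unfolding closure_sequential by blast
    then show ?thesis
      unfolding closure_sequential
      by (intro exI[of _ "\<lambda>n. c *\<^sub>R a n"]) (auto intro: tendsto_intros subspace_scale[OF assms])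
  qed
qed

text \<open>The Riesz vector is read off the normal of the closure of the graph of \<open>l\<close> in \<open>'a \<times> real\<close>;
  boundedness says that this closure is not vertical.\<close>

theorem riesz_representation_dense:
  fixes l :: "'a::{real_inner,complete_space} \<Rightarrow> real"
  assumes D: "subspace D" "closure D = UNIV"
    and add: "\<And>u v. u \<in> D \<Longrightarrow> v \<in> D \<Longrightarrow> l (u + v) = l u + l v"
    and scale: "\<And>r u. u \<in> D \<Longrightarrow> l (r *\<^sub>R u) = r * l u"
    and bound: "\<And>u. u \<in> D \<Longrightarrow> \<bar>l u\<bar> \<le> C * norm u"
  shows "\<exists>w. \<forall>u\<in>D. l u = inner w u"
proof -
  define G where "G = (\<lambda>u. (u, l u)) ` D"
  have "l 0 = 0" using scale[of 0 0] D(1) by (simp add: subspace_0)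
  have "subspace G"
  proof (rule subspaceI)
    show "0 \<in> G" using \<open>l 0 = 0\<close> D(1) by (auto simp: G_def zero_prod_def subspace_0 image_iff intro!: bexI[of _ 0])
    show "x + y \<in> G" if "x \<in> G" "y \<in> G" for x y
      using that D(1) by (auto simp: G_def add[symmetric] subspace_add)
    show "c *\<^sub>R x \<in> G" if "x \<in> G" for c x
      using that D(1) by (auto simp: G_def scale[symmetric] subspace_scale)
  qed
  then have "subspace (closure G)" by (rule subspace_closure)
  then obtain p where p: "p \<in> closure G" "\<And>y. y \<in> closure G \<Longrightarrow> inner ((0, 1) - p) y = 0"
    using orthogonal_projection_exists[of "closure G" "(0, 1)"] by auto
  obtain a b where ab: "(0, 1) - p = (a, b)" by fastforce
  have perp: "inner a u + b * l u = 0" if "u \<in> D" for u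
    using p(2)[of "(u, l u)"] that closure_subset[of G] ab by (auto simp: G_def)
  have "closure G \<subseteq> {x. \<bar>snd x\<bar> \<le> C * norm (fst x)}"
    using bound by (intro closure_minimal closed_Collect_le continuous_intros) (auto simp: G_def)
  then have p_bound: "\<bar>snd p\<bar> \<le> C * norm (fst p)" using p(1) by auto
  have "b \<noteq> 0"
  proof
    assume "b = 0"
    have "closure D \<subseteq> {u. inner a u = 0}"
      using perp \<open>b = 0\<close> by (intro closure_minimal closed_Collect_eq continuous_intros) auto
    then have "a \<in> {u. inner a u = 0}" using D(2) by blast
    then have "a = 0" by simp
    then have "p = (0, 1)" using ab \<open>b = 0\<close> by (cases p) auto
    then show False using p_bound by simp
  qed
  have "l u = inner ((- 1 / b) *\<^sub>R a) u" if "u \<in> D" for u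
    using perp[OF that] \<open>b \<noteq> 0\<close> by (simp add: field_simps)
  then show ?thesis by blast
qed

corollary riesz_representation:
  fixes l :: "'a::{real_inner,complete_space} \<Rightarrow> real"
  assumes "bounded_linear l"
  shows "\<exists>w. \<forall>v. l v = inner w v"
proof -
  interpret l: bounded_linear l by fact
  obtain K where "\<And>x. norm (l x) \<le> norm x * K" using l.bounded by blast
  then show ?thesis
    using riesz_representation_dense[of UNIV l K] by (auto simp: l.add l.scaleR mult.commute)
qed

section \<open>Self-adjoint operators\<close>

lemma linear_operatorD:
  assumes "linear_operator T"
  shows "0 \<in> dom T" "u \<in> dom T \<Longrightarrow> v \<in> dom T \<Longrightarrow> u + v \<in> dom T"
    "u \<in> dom T \<Longrightarrow> v \<in> dom T \<Longrightarrow> T \<cdot> (u + v) = T \<cdot> u + T \<cdot> v"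
    "u \<in> dom T \<Longrightarrow> a *\<^sub>C u \<in> dom T" "u \<in> dom T \<Longrightarrow> T \<cdot> (a *\<^sub>C u) = a *\<^sub>C (T \<cdot> u)"
  using assms unfolding linear_operator_def by blast+

lemma linear_operator_diff:
  assumes "linear_operator T" "u \<in> dom T" "v \<in> dom T"
  shows "u - v \<in> dom T" "T \<cdot> (u - v) = T \<cdot> u - T \<cdot> v"
proof -
  have v: "(-1) *\<^sub>C v \<in> dom T" "T \<cdot> ((-1) *\<^sub>C v) = (-1) *\<^sub>C (T \<cdot> v)"
    by (rule linear_operatorD(4,5)[OF assms(1,3)])+
  have "u + (-1) *\<^sub>C v = u - v" by simp
  then show "u - v \<in> dom T" "T \<cdot> (u - v) = T \<cdot> u - T \<cdot> v"
    using linear_operatorD(2,3)[OF assms(1,2) v(1)] v(2) by simp_all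
qed

lemma linear_operator_zero: "linear_operator T \<Longrightarrow> T \<cdot> 0 = 0"
  using linear_operator_diff(2)[of T 0 0] linear_operatorD(1)[of T] by simp

lemma linear_operator_scaleR:
  assumes "linear_operator T" "u \<in> dom T"
  shows "r *\<^sub>R u \<in> dom T" "T \<cdot> (r *\<^sub>R u) = r *\<^sub>R (T \<cdot> u)"
  using linear_operatorD(4,5)[OF assms] by (simp_all add: scaleR_scaleC)

lemma subspace_dom: "linear_operator T \<Longrightarrow> subspace (dom T)"
  by (intro subspaceI) (auto simp: linear_operatorD linear_operator_scaleR)

lemma dense_cinner_unique:
  fixes x y :: "'a::complex_hilbert_space"
  assumes "closure D = UNIV" "\<And>u. u \<in> D \<Longrightarrow> cinner u x = cinner u y"
  shows "x = y"
proof -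
  have "closure D \<subseteq> {u. inner u (x - y) = 0}"
    using assms(2) by (intro closure_minimal closed_Collect_eq continuous_intros)
      (auto simp: inner_cinner cinner_diff_right)
  then have "inner (x - y) (x - y) = 0" using assms(1) by blast
  then show ?thesis by simp
qed

lemma self_adjoint_linear: "self_adjoint T \<Longrightarrow> linear_operator T"
  and self_adjoint_dense: "self_adjoint T \<Longrightarrow> closure (dom T) = UNIV"
  by (simp_all add: self_adjoint_def)

lemma adjoint_operator_eqI:
  assumes "closure (dom T) = UNIV" "\<And>u. u \<in> dom T \<Longrightarrow> cinner (T \<cdot> u) v = cinner u w"
  shows "adjoint_operator T v = Some w"
proof -
  have "(THE w. \<forall>u\<in>dom T. cinner (T \<cdot> u) v = cinner u w) = w"
    using assms(2) by (intro the_equality) (auto intro: dense_cinner_unique[OF assms(1)])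
  then show ?thesis using assms(2) unfolding adjoint_operator_def by auto
qed

text \<open>Since \<open>adjoint_operator T = T\<close> is an equality of partial functions, a value
  of the adjoint at \<open>v\<close> yields membership in the domain along with the value.\<close>

lemma self_adjoint_domI:
  assumes "self_adjoint T" "\<And>u. u \<in> dom T \<Longrightarrow> cinner (T \<cdot> u) v = cinner u w"
  shows "v \<in> dom T" "T \<cdot> v = w"
  using adjoint_operator_eqI[OF self_adjoint_dense[OF assms(1)] assms(2)] assms(1)
  by (auto simp: self_adjoint_def app_def)

lemma self_adjoint_symmetric:
  assumes "self_adjoint T" "u \<in> dom T" "v \<in> dom T"
  shows "cinner (T \<cdot> u) v = cinner u (T \<cdot> v)"
proof -
  have "adjoint_operator T v \<noteq> None" using assms by (simp add: self_adjoint_def domIff)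
  then obtain w where w: "\<And>u. u \<in> dom T \<Longrightarrow> cinner (T \<cdot> u) v = cinner u w"
    unfolding adjoint_operator_def by (auto split: if_splits)
  then show ?thesis using self_adjoint_domI(2)[OF assms(1) w] assms(2) by simp
qed

text \<open>The error functional is bounded on a dense subspace, so the Riesz theorem represents it
  by a vector, which corrects \<open>w\<close> to the true value of \<open>T\<close> at
  \<open>v\<close>. With \<open>T = A\<close> this shows that a resolvent of \<open>H\<close>
  preserves \<open>dom A\<close>; with \<open>T = H\<close> and \<open>w = 0\<close> it identifies
  the domain in the spectral theorem.\<close>

lemma self_adjoint_domI_bounded:
  assumes T: "self_adjoint T"
    and "0 \<le> C" and bound: "\<And>u. u \<in> dom T \<Longrightarrow> cmod (cinner (T \<cdot> u) v - cinner u w) \<le> C * norm u"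
  shows "v \<in> dom T" "norm (T \<cdot> v - w) \<le> C"
proof -
  note lin = self_adjoint_linear[OF T]
  define l where "l u = inner (T \<cdot> u) v - inner u w" for u
  have "\<exists>x. \<forall>u\<in>dom T. l u = inner x u"
  proof (rule riesz_representation_dense[OF subspace_dom[OF lin] self_adjoint_dense[OF T]])
    show "\<bar>l u\<bar> \<le> C * norm u" if "u \<in> dom T" for u
    proof -
      have "\<bar>l u\<bar> = \<bar>Re (cinner (T \<cdot> u) v - cinner u w)\<bar>" by (simp add: l_def inner_cinner)
      also have "\<dots> \<le> C * norm u" using bound[OF that] abs_Re_le_cmod order_trans by blast
      finally show ?thesis .
    qed
  qed (auto simp: l_def linear_operatorD[OF lin] linear_operator_scaleR[OF lin] inner_add_left algebra_simps)
  then obtain x where x: "\<And>u. u \<in> dom T \<Longrightarrow> l u = inner x u" by blast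
  \<comment> \<open>The Riesz vector represents the real part only; replacing \<open>u\<close> by
    \<open>\<i> *\<^sub>C u\<close> recovers the imaginary part.\<close>
  have eq: "cinner (T \<cdot> u) v = cinner u (x + w)" if u: "u \<in> dom T" for u
  proof -
    have Re: "Re (cinner (T \<cdot> u') v) = Re (cinner u' (x + w))" if "u' \<in> dom T" for u'
      using x[OF that] by (simp add: l_def inner_cinner[symmetric] inner_add_right inner_commute)
    have "Re (cinner (T \<cdot> (\<i> *\<^sub>C u)) v) = Re (cinner (\<i> *\<^sub>C u) (x + w))"
      by (rule Re) (use linear_operatorD(4)[OF lin u] in blast)
    then show ?thesis
      using Re[OF u] by (simp add: complex_eq_iff linear_operatorD(5)[OF lin u] cinner_scaleC_left)
  qed
  show "v \<in> dom T" by (rule self_adjoint_domI(1)[OF T eq])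
  have Tv: "T \<cdot> v - w = x" using self_adjoint_domI(2)[OF T eq] by simp
  \<comment> \<open>The bound extends by density to all vectors, in particular to
    \<open>u = x\<close>.\<close>
  have "closure (dom T) \<subseteq> {u. inner x u \<le> C * norm u}"
  proof (intro closure_minimal closed_Collect_le continuous_intros subsetI CollectI)
    fix u assume u: "u \<in> dom T"
    have "inner x u = Re (cinner (T \<cdot> u) v - cinner u w)" using x[OF u] by (simp add: l_def inner_cinner)
    then show "inner x u \<le> C * norm u" using bound[OF u] complex_Re_le_cmod order_trans by metis
  qed
  then have "inner x x \<le> C * norm x" using self_adjoint_dense[OF T] by blast
  then have "norm x * norm x \<le> C * norm x" by (simp add: power2_norm_eq_inner[symmetric] power2_eq_square)
  then have "norm x \<le> C" using \<open>0 \<le> C\<close> by (cases "norm x = 0") auto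
  then show "norm (T \<cdot> v - w) \<le> C" using Tv by simp
qed

text \<open>The lower bound and the closedness of \<open>T\<close> make the range of T - z closed;
  its orthogonal complement is the kernel of T - cnj z, which is trivial. Applied at z = -1 to
  \<open>H\<close> and on the imaginary axis to \<open>A\<close>.\<close>

lemma self_adjoint_shift_surj:
  assumes T: "self_adjoint T" and "0 < \<delta>"
    and lower: "\<And>u. u \<in> dom T \<Longrightarrow> \<delta> * norm u \<le> norm (T \<cdot> u - z *\<^sub>C u)"
    and kernel: "\<And>u. u \<in> dom T \<Longrightarrow> T \<cdot> u = cnj z *\<^sub>C u \<Longrightarrow> u = 0"
  shows "\<exists>u\<in>dom T. T \<cdot> u - z *\<^sub>C u = v"
proof -
  note lin = self_adjoint_linear[OF T]
  define F where "F u = T \<cdot> u - z *\<^sub>C u" for u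
  define S where "S = F ` dom T"
  have F_scale: "F (a *\<^sub>C u) = a *\<^sub>C F u" if "u \<in> dom T" for a u
    using that by (simp add: F_def linear_operatorD[OF lin] scaleC_diff_right scaleC_scaleC mult.commute)
  have F_add: "F (u + v) = F u + F v" if "u \<in> dom T" "v \<in> dom T" for u v
    using that by (simp add: F_def linear_operatorD[OF lin] scaleC_add_right algebra_simps)
  have F_diff: "F (u - v) = F u - F v" if "u \<in> dom T" "v \<in> dom T" for u v
    using that by (simp add: F_def linear_operator_diff[OF lin] scaleC_diff_right algebra_simps)
  have scale_S: "a *\<^sub>C y \<in> S" if y: "y \<in> S" for a y
  proof -
    obtain u where u: "u \<in> dom T" "y = F u" using y unfolding S_def by blast
    have "a *\<^sub>C y = F (a *\<^sub>C u)" using u F_scale by simp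
    then show ?thesis using linear_operatorD(4)[OF lin u(1)] unfolding S_def by blast
  qed
  have "subspace S"
  proof (rule subspaceI)
    show "0 \<in> S" using linear_operatorD(1)[OF lin]
      by (auto simp: S_def F_def linear_operator_zero[OF lin] image_iff intro!: bexI[of _ 0])
    show "x + y \<in> S" if xy: "x \<in> S" "y \<in> S" for x y
    proof -
      obtain u v where u: "u \<in> dom T" "x = F u" and v: "v \<in> dom T" "y = F v"
        using xy unfolding S_def image_iff Bex_def by blast
      have "x + y = F (u + v)" using u v F_add by simp
      then show ?thesis using linear_operatorD(2)[OF lin u(1) v(1)] unfolding S_def by blast
    qed
    show "c *\<^sub>R x \<in> S" if "x \<in> S" for c x
      using scale_S[OF that] by (simp add: scaleR_scaleC)
  qed
  moreover have "closed S"
    unfolding closed_sequential_limits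
  proof (intro allI impI, elim conjE)
    fix y :: "nat \<Rightarrow> 'a" and l assume "\<forall>n. y n \<in> S" and y: "y \<longlonglongrightarrow> l"
    then obtain u where u: "\<And>n. u n \<in> dom T" "\<And>n. y n = F (u n)"
      unfolding S_def image_iff Bex_def by metis
    have "Cauchy u"
    proof (rule metric_CauchyI)
      fix e :: real assume "0 < e"
      then obtain N where N: "\<And>m n. m \<ge> N \<Longrightarrow> n \<ge> N \<Longrightarrow> dist (y m) (y n) < \<delta> * e"
        using LIMSEQ_imp_Cauchy[OF y] \<open>0 < \<delta>\<close> unfolding Cauchy_def by (meson mult_pos_pos)
      have "dist (u m) (u n) < e" if "m \<ge> N" "n \<ge> N" for m n
      proof -
        have "\<delta> * norm (u m - u n) \<le> norm (F (u m - u n))"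
          unfolding F_def by (rule lower) (simp add: linear_operator_diff[OF lin] u)
        also have "\<dots> < \<delta> * e" using N[OF that] by (simp add: F_diff u dist_norm)
        finally show ?thesis using \<open>0 < \<delta>\<close> by (simp add: dist_norm)
      qed
      then show "\<exists>N. \<forall>m\<ge>N. \<forall>n\<ge>N. dist (u m) (u n) < e" by blast
    qed
    then obtain x where x: "u \<longlonglongrightarrow> x" using Cauchy_convergent_iff convergent_def by blast
    have Tu: "(\<lambda>n. T \<cdot> u n) \<longlonglongrightarrow> l + z *\<^sub>C x"
    proof -
      have "(\<lambda>n. y n + z *\<^sub>C u n) \<longlonglongrightarrow> l + z *\<^sub>C x" by (intro tendsto_add y tendsto_scaleC x)
      then show ?thesis by (simp add: u F_def)
    qed
    \<comment> \<open>Passing to the limit in the symmetry relation: a self-adjoint operator is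
      closed.\<close>
    have *: "cinner (T \<cdot> w) x = cinner w (l + z *\<^sub>C x)" if "w \<in> dom T" for w
    proof (rule LIMSEQ_unique)
      show "(\<lambda>n. cinner (T \<cdot> w) (u n)) \<longlonglongrightarrow> cinner (T \<cdot> w) x" by (rule tendsto_cinner_right[OF x])
      show "(\<lambda>n. cinner (T \<cdot> w) (u n)) \<longlonglongrightarrow> cinner w (l + z *\<^sub>C x)"
        unfolding self_adjoint_symmetric[OF T that u(1)] by (rule tendsto_cinner_right[OF Tu])
    qed
    have "x \<in> dom T" "F x = l"
      using self_adjoint_domI[OF T *] by (auto simp: F_def)
    then show "l \<in> S" by (auto simp: S_def)
  qed
  ultimately obtain p where p: "p \<in> S" "\<And>y. y \<in> S \<Longrightarrow> inner (v - p) y = 0"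
    using orthogonal_projection_exists by blast
  \<comment> \<open>The projection is orthogonal for the real inner product; \<open>S\<close> is
    stable under multiplication by i, which upgrades this to the complex one.\<close>
  have perp: "cinner y (v - p) = 0" if "y \<in> S" for y
  proof -
    have "cinner (v - p) y = 0"
      using p(2)[OF that] p(2)[OF scale_S[OF that, of \<i>]] by (simp add: cinner_eq_inner complex_eq_iff)
    then show ?thesis using cinner_commute[of y "v - p"] by simp
  qed
  have "cinner (T \<cdot> u) (v - p) = cinner u (cnj z *\<^sub>C (v - p))" if "u \<in> dom T" for u
    using perp[of "F u"] that by (simp add: S_def F_def cinner_diff_left cinner_scaleC_left cinner_scaleC_right)
  from kernel[OF self_adjoint_domI[OF T this]] have "v = p" by simp
  then show ?thesis using p(1) by (auto simp: S_def F_def)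
qed

section \<open>Bounded operators\<close>

definition clinear :: "('a::complex_hilbert_space \<Rightarrow> 'a) \<Rightarrow> bool" where
  "clinear T \<longleftrightarrow> (\<forall>x y. T (x + y) = T x + T y) \<and> (\<forall>a x. T (a *\<^sub>C x) = a *\<^sub>C T x)"

lemma clinearD:
  assumes "clinear T"
  shows "T (x + y) = T x + T y" "T (a *\<^sub>C x) = a *\<^sub>C T x" "T (x - y) = T x - T y" "T 0 = 0"
    "T (r *\<^sub>R x) = r *\<^sub>R T x" "T (- x) = - T x"
proof -
  show add: "T (x + y) = T x + T y" and scale: "T (a *\<^sub>C x) = a *\<^sub>C T x" for x y a
    using assms by (auto simp: clinear_def)
  show minus: "T (- x) = - T x" for x using scale[of "-1" x] by simp
  show "T (x - y) = T x - T y" using add[of x "-y"] minus[of y] by simp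
  show "T 0 = 0" using scale[of 0 0] by simp
  show "T (r *\<^sub>R x) = r *\<^sub>R T x" by (simp add: scaleR_scaleC scale)
qed

definition symmetric_op :: "('a::complex_hilbert_space \<Rightarrow> 'a) \<Rightarrow> bool" where
  "symmetric_op T \<longleftrightarrow> clinear T \<and> bounded_linear T \<and> (\<forall>x y. cinner (T x) y = cinner x (T y))"

lemma symmetric_opD:
  assumes "symmetric_op T"
  shows "clinear T" "bounded_linear T" "cinner (T x) y = cinner x (T y)" "inner (T x) y = inner x (T y)"
  using assms by (auto simp: symmetric_op_def inner_cinner)

text \<open>Testing the real identity with \<open>\<i> *\<^sub>C y\<close> supplies the imaginary
  part.\<close>

lemma symmetric_opI:
  assumes T: "clinear T" "bounded_linear T" and sym: "\<And>x y. inner (T x) y = inner x (T y)"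
  shows "symmetric_op T"
  unfolding symmetric_op_def
proof (intro conjI T allI)
  fix x y
  have "inner (T x) (\<i> *\<^sub>C y) = inner x (\<i> *\<^sub>C T y)"
    using sym[of x "\<i> *\<^sub>C y"] by (simp add: clinearD[OF T(1)])
  then show "cinner (T x) y = cinner x (T y)"
    by (simp add: cinner_eq_inner sym)
qed

lemma cinner_symmetric_op:
  assumes "symmetric_op T" shows "cinner u (T u) = inner u (T u)"
proof -
  have "cinner u (T u) = cnj (cinner u (T u))"
    by (metis assms cinner_commute symmetric_opD(3))
  then have "Im (cinner u (T u)) = 0" by (metis cnj.sel(2) equal_neg_zero)
  then show ?thesis by (simp add: complex_eq_iff inner_cinner)
qed

lemma symmetric_op_polarization:
  assumes "symmetric_op T"
  shows "inner u (T v) = (inner (u + v) (T (u + v)) - inner (u - v) (T (u - v))) / 4"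
proof -
  have "inner v (T u) = inner u (T v)" using symmetric_opD(4)[OF assms, of u v] by (simp add: inner_commute)
  then show ?thesis
    by (simp add: clinearD[OF symmetric_opD(1)[OF assms]] algebra_simps)
qed

lemma symmetric_op_eqI:
  assumes "symmetric_op S" "symmetric_op T" "\<And>u. inner u (S u) = inner u (T u)"
  shows "S = T"
proof
  fix v show "S v = T v"
  proof (rule eq_if_inner_eq)
    fix u show "inner u (S v) = inner u (T v)"
      using symmetric_op_polarization[OF assms(1), of u v] symmetric_op_polarization[OF assms(2), of u v]
      unfolding assms(3) by (rule trans[OF _ sym])
  qed
qed

lemma symmetric_op_add:
  assumes "symmetric_op S" "symmetric_op T" shows "symmetric_op (\<lambda>x. S x + T x)"
  using assms unfolding symmetric_op_def clinear_def
  by (auto simp: scaleC_add_right cinner_add_left cinner_add_right bounded_linear_add)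

lemma symmetric_op_scale:
  assumes "symmetric_op T" shows "symmetric_op (\<lambda>x. (r::real) *\<^sub>R T x)"
  using assms unfolding symmetric_op_def clinear_def
  by (auto simp: scaleR_add_right scaleC_scaleR cinner_scaleR_left cinner_scaleR_right
      intro: bounded_linear_compose[OF bounded_linear_scaleR_right])

lemma symmetric_op_id: "symmetric_op (\<lambda>x. x)"
  by (simp add: symmetric_op_def clinear_def)

text \<open>Polarization with \<open>T v\<close> rescaled to the length of \<open>v\<close> keeps
  the constant \<open>C\<close>; without the rescaling the parallelogram law would not balance the
  two terms.\<close>

lemma symmetric_op_norm_le:
  assumes T: "symmetric_op T" and bound: "\<And>u. \<bar>inner u (T u)\<bar> \<le> C * (norm u)\<^sup>2"
  shows "norm (T v) \<le> C * norm v"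
proof (cases "T v = 0 \<or> v = 0")
  case True
  have "0 \<le> C" if "v \<noteq> 0"
    using order_trans[OF abs_ge_zero bound[of v]] that by (simp add: zero_le_mult_iff)
  then show ?thesis using True clinearD(4)[OF symmetric_opD(1)[OF T]] by (cases "v = 0") auto
next
  case False
  define s where "s = norm v / norm (T v)"
  have "s > 0" using False by (simp add: s_def)
  define w where "w = s *\<^sub>R T v"
  have nw: "norm w = norm v" using False by (simp add: w_def s_def)
  have "4 * inner w (T v) = inner (w + v) (T (w + v)) - inner (w - v) (T (w - v))"
    using symmetric_op_polarization[OF T, of w v] by simp
  also have "\<dots> \<le> C * (norm (w + v))\<^sup>2 + C * (norm (w - v))\<^sup>2"
    using bound[of "w + v"] bound[of "w - v"] by linarith
  also have "\<dots> = C * (2 * (norm w)\<^sup>2 + 2 * (norm v)\<^sup>2)"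
    by (simp add: power2_norm_eq_inner inner_add_left inner_add_right inner_diff_left inner_diff_right algebra_simps)
  finally have "inner w (T v) \<le> C * (norm v)\<^sup>2" using nw by simp
  moreover have "inner w (T v) = norm v * norm (T v)"
    using False by (simp add: w_def s_def power2_norm_eq_inner[symmetric] power2_eq_square)
  ultimately show ?thesis using False by (simp add: power2_eq_square)
qed

section \<open>Functional calculus from a family of measures\<close>

text \<open>Real symbols suffice because the cosine and sine symbols are real. They give symmetric
  operators, which are determined by their real quadratic forms.\<close>

definition bounded_borel :: "(real \<Rightarrow> real) \<Rightarrow> bool" where
  "bounded_borel \<phi> \<longleftrightarrow> \<phi> \<in> borel_measurable borel \<and> (\<exists>C. \<forall>x. \<bar>\<phi> x\<bar> \<le> C)"

lemma bounded_borelI: "\<phi> \<in> borel_measurable borel \<Longrightarrow> (\<And>x. \<bar>\<phi> x\<bar> \<le> C) \<Longrightarrow> bounded_borel \<phi>"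
  by (auto simp: bounded_borel_def)

lemma bounded_borel_measurable [measurable_dest]: "bounded_borel \<phi> \<Longrightarrow> \<phi> \<in> borel_measurable borel"
  by (simp add: bounded_borel_def)

lemma bounded_borelE:
  assumes "bounded_borel \<phi>" obtains C where "0 \<le> C" "\<And>x. \<bar>\<phi> x\<bar> \<le> C"
  using assms unfolding bounded_borel_def by (meson abs_ge_zero order_trans)

lemma bounded_borel_const [simp]: "bounded_borel (\<lambda>x. c)"
  by (rule bounded_borelI[of _ "\<bar>c\<bar>"]) auto

lemma bounded_borel_add: "bounded_borel \<phi> \<Longrightarrow> bounded_borel \<gamma> \<Longrightarrow> bounded_borel (\<lambda>x. \<phi> x + \<gamma> x)"
  unfolding bounded_borel_def
  by (auto intro: borel_measurable_add order_trans[OF abs_triangle_ineq add_mono])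

lemma bounded_borel_mult: "bounded_borel \<phi> \<Longrightarrow> bounded_borel \<gamma> \<Longrightarrow> bounded_borel (\<lambda>x. \<phi> x * \<gamma> x)"
  unfolding bounded_borel_def abs_mult
  by (auto intro: mult_mono order_trans[OF abs_ge_zero])

lemma bounded_borel_scale: "bounded_borel \<phi> \<Longrightarrow> bounded_borel (\<lambda>x. c * \<phi> x)"
  by (rule bounded_borel_mult) auto

lemma bounded_borel_diff: "bounded_borel \<phi> \<Longrightarrow> bounded_borel \<gamma> \<Longrightarrow> bounded_borel (\<lambda>x. \<phi> x - \<gamma> x)"
  using bounded_borel_add[OF _ bounded_borel_scale[of \<gamma> "-1"], of \<phi>] by simp

lemma bounded_borel_indicator: "B \<in> sets borel \<Longrightarrow> bounded_borel (indicator B)"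
  by (rule bounded_borelI[of _ 1]) (auto simp: indicator_def)

text \<open>The limit clause asks for bounded pointwise convergence, the mode of convergence under
  which represented operators pass to the limit.\<close>

lemma bounded_borel_nonneg_induct [consumes 2, case_names set mult add seq]:
  assumes \<phi>: "bounded_borel \<phi>" "\<And>x. 0 \<le> \<phi> x"
    and set: "\<And>B. B \<in> sets borel \<Longrightarrow> P (indicator B)"
    and mult: "\<And>\<phi> c. P \<phi> \<Longrightarrow> P (\<lambda>x. c * \<phi> x)"
    and add: "\<And>\<phi> \<gamma>. P \<phi> \<Longrightarrow> P \<gamma> \<Longrightarrow> P (\<lambda>x. \<phi> x + \<gamma> x)"
    and seq: "\<And>\<phi> \<gamma> C. (\<And>n. P (\<phi> n)) \<Longrightarrow> (\<And>n x. \<bar>\<phi> n x\<bar> \<le> C) \<Longrightarrow> (\<And>n. bounded_borel (\<phi> n)) \<Longrightarrow>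
      (\<And>x. (\<lambda>n. \<phi> n x) \<longlonglongrightarrow> \<gamma> x) \<Longrightarrow> bounded_borel \<gamma> \<Longrightarrow> P \<gamma>"
  shows "P \<phi>"
proof -
  \<comment> \<open>The induction runs over all nonnegative measurable functions; boundedness enters
    as a premise of the claim and descends from a function to its nonnegative pieces.\<close>
  have "(\<exists>C. \<forall>x. \<bar>\<phi> x\<bar> \<le> C) \<longrightarrow> P \<phi>"
    using bounded_borel_measurable[OF \<phi>(1)] \<phi>(2)
  proof (induct rule: borel_measurable_induct_real)
    case (set A)
    then show ?case using assms(3) by simp
  next
    case (mult u c)
    show ?case
    proof (intro impI)
      assume "\<exists>C. \<forall>x. \<bar>c * u x\<bar> \<le> C"
      then obtain C where C: "\<And>x. \<bar>c * u x\<bar> \<le> C" by blast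
      show "P (\<lambda>x. c * u x)"
      \<comment> \<open>For \<open>c = 0\<close> nothing bounds \<open>u\<close>, so the zero
        function is obtained from the indicator of the empty set instead.\<close>
      proof (cases "c = 0")
        case True
        then show ?thesis using assms(4)[OF set[of "{}"], of 0] by simp
      next
        case False
        then have "\<bar>u x\<bar> \<le> C / \<bar>c\<bar>" for x using C[of x] by (simp add: abs_mult field_simps)
        then show ?thesis using mult assms(4) by blast
      qed
    qed
  next
    case (add u v)
    show ?case
    proof (intro impI)
      assume "\<exists>C. \<forall>x. \<bar>v x + u x\<bar> \<le> C"
      then obtain C where C: "\<And>x. \<bar>v x + u x\<bar> \<le> C" by blast
      have "\<bar>u x\<bar> \<le> C" "\<bar>v x\<bar> \<le> C" for x using C[of x] add(2)[of x] add(5)[of x] by auto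
      then show "P (\<lambda>x. v x + u x)" using add assms(5)[of v u] by blast
    qed
  next
    case (seq U)
    show ?case
    proof (intro impI)
      assume "\<exists>C. \<forall>x. \<bar>\<phi> x\<bar> \<le> C"
      then obtain C where C: "\<And>x. \<bar>\<phi> x\<bar> \<le> C" by blast
      have le: "U n x \<le> \<phi> x" for n x
        using LIMSEQ_le_const[OF seq(5)[of x], of "U n x"] seq(4) by (auto simp: incseq_def le_fun_def)
      have U: "\<bar>U n x\<bar> \<le> C" for n x using le[of n x] seq(2) C[of x] by (auto intro: order_trans)
      show "P \<phi>"
      proof (rule assms(6)[of U C])
        show "P (U n)" for n using seq(3) U by blast
        show "bounded_borel (U n)" for n using seq(1) U by (rule bounded_borelI)
        show "(\<lambda>n. U n x) \<longlonglongrightarrow> \<phi> x" for x using seq(5) by simp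
      qed (use U \<phi>(1) in auto)
    qed
  qed
  then show ?thesis using \<phi>(1) by (simp add: bounded_borel_def)
qed

text \<open>Intended are the scalar spectral measures of an operator. Nothing is assumed about how
  the measure depends on the vector; that information enters through operators whose quadratic forms
  are integrals. The locale serves twice: for moment measures of a contraction and for a given
  projection-valued measure.\<close>

locale measure_family =
  fixes \<mu> :: "'a::complex_hilbert_space \<Rightarrow> real measure"
  assumes sets_\<mu> [measurable_cong, simp]: "sets (\<mu> u) = sets borel"
    and finite_\<mu>: "finite_measure (\<mu> u)"
    and total_\<mu>: "measure (\<mu> u) UNIV = (norm u)\<^sup>2"
begin

lemma space_\<mu> [simp]: "space (\<mu> u) = UNIV"
  using sets_eq_imp_space_eq[OF sets_\<mu>] by simp

lemma measurable_\<mu>: "\<phi> \<in> borel_measurable (\<mu> u) \<longleftrightarrow> \<phi> \<in> borel_measurable borel"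
  by (rule arg_cong2[where f = "(\<in>)"]) (auto simp: measurable_def)

lemma integrable_bounded_borel: "bounded_borel \<phi> \<Longrightarrow> integrable (\<mu> u) \<phi>"
proof -
  assume \<phi>: "bounded_borel \<phi>"
  then obtain C where C: "\<And>x. \<bar>\<phi> x\<bar> \<le> C" using bounded_borelE by blast
  interpret finite_measure "\<mu> u" by (rule finite_\<mu>)
  show ?thesis
    by (rule integrable_const_bound[of _ C]) (use \<phi> C in \<open>auto simp: measurable_\<mu> bounded_borel_def\<close>)
qed

lemma integral_bound:
  assumes "\<phi> \<in> borel_measurable borel" "\<And>x. \<bar>\<phi> x\<bar> \<le> C"
  shows "\<bar>\<integral>x. \<phi> x \<partial>\<mu> u\<bar> \<le> C * (norm u)\<^sup>2"
proof -
  interpret finite_measure "\<mu> u" by (rule finite_\<mu>)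
  have int: "integrable (\<mu> u) \<phi>" by (rule integrable_bounded_borel[OF bounded_borelI[OF assms]])
  have "\<bar>\<integral>x. \<phi> x \<partial>\<mu> u\<bar> \<le> (\<integral>x. \<bar>\<phi> x\<bar> \<partial>\<mu> u)" by (rule integral_abs_bound)
  also have "\<dots> \<le> (\<integral>x. C \<partial>\<mu> u)" by (rule integral_mono) (use int assms in auto)
  finally show ?thesis by (simp add: total_\<mu> mult.commute)
qed

lemma integral_limit:
  fixes \<gamma> :: "real \<Rightarrow> real"
  assumes "\<And>n. \<phi> n \<in> borel_measurable borel" "\<gamma> \<in> borel_measurable borel" "\<And>n x. \<bar>\<phi> n x\<bar> \<le> C"
    and "AE x in \<mu> u. (\<lambda>n. \<phi> n x) \<longlonglongrightarrow> \<gamma> x"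
  shows "(\<lambda>n. \<integral>x. \<phi> n x \<partial>\<mu> u) \<longlonglongrightarrow> (\<integral>x. \<gamma> x \<partial>\<mu> u)"
  by (rule integral_dominated_convergence[where w = "\<lambda>x. C"])
    (use assms integrable_bounded_borel[OF bounded_borel_const, of u C] in \<open>auto simp: measurable_\<mu>\<close>)

text \<open>Reads T as the integral of \<phi> against the spectral measure, on the diagonal only. By
  polarization a symmetric operator is fixed by its diagonal, so T is unique.\<close>

definition represents :: "(real \<Rightarrow> real) \<Rightarrow> ('a \<Rightarrow> 'a) \<Rightarrow> bool" where
  "represents \<phi> T \<longleftrightarrow> symmetric_op T \<and> (\<forall>u. inner u (T u) = (\<integral>x. \<phi> x \<partial>\<mu> u))"

lemma represents_symmetric: "represents \<phi> T \<Longrightarrow> symmetric_op T"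
  and represents_eq: "represents \<phi> T \<Longrightarrow> inner u (T u) = (\<integral>x. \<phi> x \<partial>\<mu> u)"
  by (auto simp: represents_def)

lemma represents_unique: "represents \<phi> S \<Longrightarrow> represents \<phi> T \<Longrightarrow> S = T"
  by (rule symmetric_op_eqI) (auto simp: represents_def)

lemma represents_add:
  "bounded_borel \<phi> \<Longrightarrow> bounded_borel \<gamma> \<Longrightarrow> represents \<phi> S \<Longrightarrow> represents \<gamma> T \<Longrightarrow>
    represents (\<lambda>x. \<phi> x + \<gamma> x) (\<lambda>u. S u + T u)"
  by (simp add: represents_def symmetric_op_add inner_add_right integrable_bounded_borel)

lemma represents_scale:
  "represents \<phi> T \<Longrightarrow> represents (\<lambda>x. c * \<phi> x) (\<lambda>u. c *\<^sub>R T u)"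
  by (simp add: represents_def symmetric_op_scale)

lemma represents_one: "represents (\<lambda>x. 1) (\<lambda>u. u)"
proof -
  interpret finite_measure "\<mu> u" for u by (rule finite_\<mu>)
  show ?thesis
    by (simp add: represents_def symmetric_op_id total_\<mu> power2_norm_eq_inner)
qed

lemma represents_norm_le:
  assumes "represents \<phi> T" "\<phi> \<in> borel_measurable borel" "\<And>x. \<bar>\<phi> x\<bar> \<le> C"
  shows "norm (T u) \<le> C * norm u"
  by (rule symmetric_op_norm_le)
    (use assms integral_bound[OF assms(2,3)] in \<open>auto simp: represents_def\<close>)

lemma represents_inner:
  assumes "represents \<phi> T"
  shows "inner u (T v) = ((\<integral>x. \<phi> x \<partial>\<mu> (u + v)) - (\<integral>x. \<phi> x \<partial>\<mu> (u - v))) / 4"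
  using symmetric_op_polarization[OF represents_symmetric[OF assms], of u v]
  unfolding represents_eq[OF assms] .

text \<open>Dominated convergence gives limits of the diagonal forms, polarization gives limits of
  all matrix elements, and the Riesz theorem turns the limiting bilinear form into an
  operator.\<close>

lemma represents_limit:
  assumes rep: "\<And>n. represents (\<phi> n) (T n)"
    and meas: "\<And>n. \<phi> n \<in> borel_measurable borel" "\<gamma> \<in> borel_measurable borel"
    and bound: "\<And>n x. \<bar>\<phi> n x\<bar> \<le> C"
    and lim: "\<And>u. AE x in \<mu> u. (\<lambda>n. \<phi> n x) \<longlonglongrightarrow> \<gamma> x"
  obtains S where "represents \<gamma> S" "\<And>u v. (\<lambda>n. inner u (T n v)) \<longlonglongrightarrow> inner u (S v)"
proof -
  have C: "0 \<le> C" using order_trans[OF abs_ge_zero bound] .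
  \<comment> \<open>Since measures of different vectors are unrelated, linearity of \<open>L\<close>
    is invisible in this formula; it is inherited from the operators \<open>T n\<close>.\<close>
  define L where "L u v = ((\<integral>x. \<gamma> x \<partial>\<mu> (u + v)) - (\<integral>x. \<gamma> x \<partial>\<mu> (u - v))) / 4" for u v
  have lim_L: "(\<lambda>n. inner u (T n v)) \<longlonglongrightarrow> L u v" for u v
    unfolding represents_inner[OF rep] L_def
    by (intro tendsto_intros integral_limit[OF meas bound lim]) auto
  note clin = clinearD[OF symmetric_opD(1)[OF represents_symmetric[OF rep]]]
  have "\<exists>w. \<forall>u. L u v = inner w u" for v
  proof -
    have "bounded_linear (\<lambda>u. L u v)"
    proof (rule bounded_linear_intro[where K = "C * norm v"])
      show "L (x + y) v = L x v + L y v" for x y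
        by (rule LIMSEQ_unique[OF lim_L]) (auto simp: inner_add_left intro: tendsto_intros lim_L)
      show "L (r *\<^sub>R x) v = r *\<^sub>R L x v" for r x
        by (rule LIMSEQ_unique[OF lim_L]) (auto intro: tendsto_intros lim_L)
      have "norm (inner x (T n v)) \<le> norm x * (C * norm v)" for x n
        using represents_norm_le[OF rep meas(1) bound, of n v] Cauchy_Schwarz_ineq2[of x "T n v"]
          mult_left_mono[of "norm (T n v)" "C * norm v" "norm x"] by simp
      then show "norm (L x v) \<le> norm x * (C * norm v)" for x
        by (intro Lim_norm_ubound[OF _ lim_L]) auto
    qed
    then show ?thesis by (rule riesz_representation)
  qed
  then obtain S where "\<And>v u. L u v = inner (S v) u" by metis
  then have S: "(\<lambda>n. inner u (T n v)) \<longlonglongrightarrow> inner u (S v)" for u v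
    using lim_L[of u v] by (simp add: inner_commute)
  have S_add: "S (x + y) = S x + S y" for x y
    by (rule eq_if_inner_eq, rule LIMSEQ_unique[OF S])
      (auto simp: clin inner_add_right intro: tendsto_intros S)
  have S_scale: "S (a *\<^sub>C x) = a *\<^sub>C S x" for a x
  proof (rule eq_if_inner_eq, rule LIMSEQ_unique[OF S])
    have adj: "inner u (a *\<^sub>C y) = inner (cnj a *\<^sub>C u) y" for u y :: 'a
      by (simp add: inner_cinner cinner_scaleC_left cinner_scaleC_right)
    show "(\<lambda>n. inner u (T n (a *\<^sub>C x))) \<longlonglongrightarrow> inner u (a *\<^sub>C S x)" for u
      unfolding clin adj by (rule S)
  qed
  have S_sym: "inner (S x) y = inner x (S y)" for x y
  proof (rule LIMSEQ_unique)
    show "(\<lambda>n. inner (T n x) y) \<longlonglongrightarrow> inner (S x) y" using S[of y x] by (simp add: inner_commute)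
    show "(\<lambda>n. inner (T n x) y) \<longlonglongrightarrow> inner x (S y)"
      unfolding symmetric_opD(4)[OF represents_symmetric[OF rep]] by (rule S)
  qed
  have S_norm: "norm (S x) \<le> norm x * C" for x
  proof -
    have "inner (S x) (T n x) \<le> norm (S x) * (norm x * C)" for n
      using norm_cauchy_schwarz[of "S x" "T n x"] represents_norm_le[OF rep meas(1) bound, of n x]
        mult_left_mono[of "norm (T n x)" "norm x * C" "norm (S x)"] by (simp add: mult.commute)
    then have "inner (S x) (S x) \<le> norm (S x) * (norm x * C)"
      by (intro LIMSEQ_le_const2[OF S]) auto
    then have "norm (S x) * norm (S x) \<le> norm (S x) * (norm x * C)"
      by (simp add: power2_norm_eq_inner[symmetric] power2_eq_square)
    then show ?thesis using C by (cases "S x = 0") auto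
  qed
  have "clinear S" by (simp add: clinear_def S_add S_scale)
  moreover have "bounded_linear S"
    by (rule bounded_linear_intro[OF S_add _ S_norm]) (simp add: scaleR_scaleC S_scale)
  ultimately have "symmetric_op S" by (rule symmetric_opI) (rule S_sym)
  moreover have "inner u (S u) = (\<integral>x. \<gamma> x \<partial>\<mu> u)" for u
    by (rule LIMSEQ_unique[OF S]) (unfold represents_eq[OF rep], rule integral_limit[OF meas bound lim])
  ultimately have "represents \<gamma> S" by (simp add: represents_def)
  then show ?thesis using S by (rule that)
qed

text \<open>Multiplicativity at a single pair of symbols. It is extended in \<gamma> with \<phi>
  fixed, and in \<phi> after exchanging the two roles.\<close>

definition multiplies :: "(real \<Rightarrow> real) \<Rightarrow> ('a \<Rightarrow> 'a) \<Rightarrow> (real \<Rightarrow> real) \<Rightarrow> ('a \<Rightarrow> 'a) \<Rightarrow> bool" where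
  "multiplies \<phi> S \<gamma> T \<longleftrightarrow> represents \<gamma> T \<and> represents (\<lambda>x. \<phi> x * \<gamma> x) (\<lambda>u. S (T u))"

lemma multiplies_add:
  assumes "bounded_borel \<phi>" "bounded_borel \<gamma>" "bounded_borel \<eta>" "symmetric_op S"
    "multiplies \<phi> S \<gamma> T" "multiplies \<phi> S \<eta> U"
  shows "multiplies \<phi> S (\<lambda>x. \<gamma> x + \<eta> x) (\<lambda>u. T u + U u)"
  using assms represents_add[of "\<lambda>x. \<phi> x * \<gamma> x" "\<lambda>x. \<phi> x * \<eta> x"]
  by (auto simp: multiplies_def distrib_left clinearD[OF symmetric_opD(1)[OF assms(4)]]
      intro: represents_add bounded_borel_mult)

lemma multiplies_scale:
  assumes "symmetric_op S" "multiplies \<phi> S \<gamma> T"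
  shows "multiplies \<phi> S (\<lambda>x. c * \<gamma> x) (\<lambda>u. c *\<^sub>R T u)"
  using assms represents_scale[of "\<lambda>x. \<phi> x * \<gamma> x" "\<lambda>u. S (T u)" c]
  by (auto simp: multiplies_def mult.left_commute clinearD[OF symmetric_opD(1)[OF assms(1)]]
      intro: represents_scale)

lemma multiplies_one: "represents \<phi> S \<Longrightarrow> multiplies \<phi> S (\<lambda>x. 1) (\<lambda>u. u)"
  by (simp add: multiplies_def represents_one)

text \<open>Both \<eta> and \<phi> \<eta> converge boundedly, so both operator sequences have weak
  limits. Moving the symmetric \<open>S\<close> to the other side of the inner product identifies
  the second limit with \<open>S\<close> applied to the first.\<close>

lemma multiplies_limit:
  assumes \<phi>: "bounded_borel \<phi>" "represents \<phi> S"
    and mult: "\<And>n. multiplies \<phi> S (\<eta> n) (T n)"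
    and meas: "\<And>n. \<eta> n \<in> borel_measurable borel" "\<gamma> \<in> borel_measurable borel"
    and bound: "\<And>n x. \<bar>\<eta> n x\<bar> \<le> C"
    and lim: "\<And>u. AE x in \<mu> u. (\<lambda>n. \<eta> n x) \<longlonglongrightarrow> \<gamma> x"
  shows "\<exists>U. multiplies \<phi> S \<gamma> U"
proof -
  note [measurable] = bounded_borel_measurable[OF \<phi>(1)] meas
  obtain D where D: "0 \<le> D" "\<And>x. \<bar>\<phi> x\<bar> \<le> D" using bounded_borelE[OF \<phi>(1)] by blast
  have C: "0 \<le> C" using order_trans[OF abs_ge_zero bound] .
  obtain U where U: "represents \<gamma> U" "\<And>u v. (\<lambda>n. inner u (T n v)) \<longlonglongrightarrow> inner u (U v)"
    using represents_limit[of \<eta> T \<gamma> C] mult meas bound lim unfolding multiplies_def by blast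
  have bound': "\<bar>\<phi> x * \<eta> n x\<bar> \<le> D * C" for n x
    unfolding abs_mult by (rule mult_mono[OF D(2) bound D(1)]) simp
  have lim': "AE x in \<mu> u. (\<lambda>n. \<phi> x * \<eta> n x) \<longlonglongrightarrow> \<phi> x * \<gamma> x" for u
    using lim[of u] by eventually_elim (rule tendsto_mult_left)
  obtain V where V: "represents (\<lambda>x. \<phi> x * \<gamma> x) V"
    "\<And>u v. (\<lambda>n. inner u (S (T n v))) \<longlonglongrightarrow> inner u (V v)"
    using represents_limit[of "\<lambda>n x. \<phi> x * \<eta> n x" "\<lambda>n v. S (T n v)" "\<lambda>x. \<phi> x * \<gamma> x" "D * C"]
      mult bound' lim' unfolding multiplies_def by auto
  have "V = (\<lambda>v. S (U v))"
  proof (rule ext, rule eq_if_inner_eq)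
    fix u v
    note sym = symmetric_opD(4)[OF represents_symmetric[OF \<phi>(2)], symmetric]
    have "(\<lambda>n. inner u (S (T n v))) \<longlonglongrightarrow> inner u (S (U v))"
      unfolding sym by (rule U(2))
    then show "inner u (V v) = inner u (S (U v))" using LIMSEQ_unique V(2) by blast
  qed
  then show ?thesis using U(1) V(1) by (auto simp: multiplies_def)
qed

text \<open>The product \<open>S (T u)\<close> is represented, hence symmetric, and a symmetric
  product of symmetric operators commutes.\<close>

lemma multiplies_commute:
  assumes "represents \<phi> S" "multiplies \<phi> S \<gamma> T"
  shows "multiplies \<gamma> T \<phi> S"
proof -
  have "S (T u) = T (S u)" for u
  proof (rule eq_if_inner_eq)
    fix v
    have "inner v (S (T u)) = inner (S (T v)) u"
      using assms(2) symmetric_opD(4)[of "\<lambda>u. S (T u)" v u] by (simp add: multiplies_def represents_def)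
    also have "\<dots> = inner v (T (S u))"
      using assms by (simp add: multiplies_def represents_def symmetric_opD(4))
    finally show "inner v (S (T u)) = inner v (T (S u))" .
  qed
  then show ?thesis using assms by (simp add: multiplies_def mult.commute)
qed

lemma multiplies_borel:
  assumes \<phi>: "bounded_borel \<phi>" "represents \<phi> S" and \<gamma>: "bounded_borel \<gamma>"
    and ind: "\<And>B. B \<in> sets borel \<Longrightarrow> \<exists>T. multiplies \<phi> S (indicator B) T"
  shows "\<exists>T. multiplies \<phi> S \<gamma> T"
proof -
  note sym = represents_symmetric[OF \<phi>(2)]
  have nonneg: "\<exists>T. multiplies \<phi> S \<gamma> T" if "bounded_borel \<gamma>" "\<And>x. 0 \<le> \<gamma> x" for \<gamma>
  proof -
    have "bounded_borel \<gamma> \<and> (\<exists>T. multiplies \<phi> S \<gamma> T)"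
      using that
    proof (induction rule: bounded_borel_nonneg_induct)
      case (set B)
      then show ?case using ind bounded_borel_indicator by blast
    next
      case (mult \<gamma> c)
      then show ?case using multiplies_scale[OF sym] bounded_borel_scale by blast
    next
      case (add \<gamma> \<eta>)
      then show ?case using multiplies_add[OF \<phi>(1) _ _ sym] bounded_borel_add by blast
    next
      case (seq \<eta> \<gamma> C)
      then obtain T where "\<And>n. multiplies \<phi> S (\<eta> n) (T n)" by metis
      then have "\<exists>U. multiplies \<phi> S \<gamma> U"
        using seq by (intro multiplies_limit[OF \<phi>, of \<eta> T]) (auto simp: bounded_borel_def)
      then show ?case using seq by blast
    qed
    then show ?thesis ..
  qed
  \<comment> \<open>The induction handles nonnegative symbols; adding a bound \<open>C\<close> makes
    \<gamma> nonnegative, and the constant is subtracted afterwards.\<close>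
  obtain C where C: "\<And>x. \<bar>\<gamma> x\<bar> \<le> C" using bounded_borelE[OF \<gamma>] by blast
  have "0 \<le> \<gamma> x + C" for x using C[of x] by auto
  then obtain T where T: "multiplies \<phi> S (\<lambda>x. \<gamma> x + C) T"
    using nonneg[of "\<lambda>x. \<gamma> x + C"] bounded_borel_add[OF \<gamma> bounded_borel_const] by blast
  have "multiplies \<phi> S (\<lambda>x. (\<gamma> x + C) + (- C) * 1) (\<lambda>u. T u + (- C) *\<^sub>R u)"
    by (intro multiplies_add[OF \<phi>(1) _ _ sym] T multiplies_scale[OF sym multiplies_one[OF \<phi>(2)]]
        bounded_borel_add \<gamma>) auto
  then show ?thesis by auto
qed

end

text \<open>Both clauses ask only for the existence of some T, because uniqueness of the represented
  operator forces it to be the value of \<open>op\<close>.\<close>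

locale borel_calculus = measure_family +
  assumes representable: "bounded_borel \<phi> \<Longrightarrow> \<exists>T. represents \<phi> T"
    and multiplicative: "bounded_borel \<phi> \<Longrightarrow> bounded_borel \<gamma> \<Longrightarrow> represents \<phi> S \<Longrightarrow> \<exists>T. multiplies \<phi> S \<gamma> T"
begin

definition op :: "(real \<Rightarrow> real) \<Rightarrow> 'a \<Rightarrow> 'a" where
  "op \<phi> = (THE T. represents \<phi> T)"

lemma op_eqI: "represents \<phi> T \<Longrightarrow> op \<phi> = T"
  unfolding op_def using represents_unique by blast

lemma represents_op: "bounded_borel \<phi> \<Longrightarrow> represents \<phi> (op \<phi>)"
  using representable op_eqI by blast

lemma op_symmetric: "bounded_borel \<phi> \<Longrightarrow> symmetric_op (op \<phi>)"
  by (rule represents_symmetric[OF represents_op])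

lemma op_clinear: "bounded_borel \<phi> \<Longrightarrow> clinear (op \<phi>)"
  by (rule symmetric_opD(1)[OF op_symmetric])

lemma inner_op: "bounded_borel \<phi> \<Longrightarrow> inner u (op \<phi> u) = (\<integral>x. \<phi> x \<partial>\<mu> u)"
  by (rule represents_eq[OF represents_op])

lemma cinner_op: "bounded_borel \<phi> \<Longrightarrow> cinner u (op \<phi> u) = (\<integral>x. \<phi> x \<partial>\<mu> u)"
  by (simp add: cinner_symmetric_op op_symmetric inner_op)

lemma op_one: "op (\<lambda>x. 1) u = u"
  by (simp add: op_eqI[OF represents_one])

lemma op_add: "bounded_borel \<phi> \<Longrightarrow> bounded_borel \<gamma> \<Longrightarrow> op (\<lambda>x. \<phi> x + \<gamma> x) u = op \<phi> u + op \<gamma> u"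
  using op_eqI[OF represents_add[OF _ _ represents_op represents_op]] by metis

lemma op_scale: "bounded_borel \<phi> \<Longrightarrow> op (\<lambda>x. c * \<phi> x) u = c *\<^sub>R op \<phi> u"
  using op_eqI[OF represents_scale[OF represents_op]] by metis

lemma op_diff: "bounded_borel \<phi> \<Longrightarrow> bounded_borel \<gamma> \<Longrightarrow> op (\<lambda>x. \<phi> x - \<gamma> x) u = op \<phi> u - op \<gamma> u"
  using op_add[of \<phi> "\<lambda>x. (-1) * \<gamma> x" u] op_scale[of \<gamma> "-1" u] bounded_borel_scale[of \<gamma> "-1"] by simp

lemma op_mult: "bounded_borel \<phi> \<Longrightarrow> bounded_borel \<gamma> \<Longrightarrow> op (\<lambda>x. \<phi> x * \<gamma> x) u = op \<phi> (op \<gamma> u)"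
  using multiplicative[OF _ _ represents_op] op_eqI unfolding multiplies_def by metis

lemma op_norm_le:
  assumes "\<phi> \<in> borel_measurable borel" "\<And>x. \<bar>\<phi> x\<bar> \<le> C"
  shows "norm (op \<phi> u) \<le> C * norm u"
  by (rule represents_norm_le[OF represents_op[OF bounded_borelI[OF assms]] assms])

text \<open>All three operators are functions of the same underlying operator, so the two outer
  factors \<open>op \<phi>\<close> merge with the inner one into a single symbol.\<close>

lemma integral_op:
  assumes "bounded_borel \<phi>" "bounded_borel \<gamma>"
  shows "(\<integral>x. \<gamma> x \<partial>\<mu> (op \<phi> u)) = (\<integral>x. (\<phi> x)\<^sup>2 * \<gamma> x \<partial>\<mu> u)"
proof -
  note bb = assms bounded_borel_mult[OF assms]
  have "(\<integral>x. \<gamma> x \<partial>\<mu> (op \<phi> u)) = inner u (op \<phi> (op \<gamma> (op \<phi> u)))"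
    by (simp add: inner_op[symmetric] assms symmetric_opD(4)[OF op_symmetric])
  also have "op \<phi> (op \<gamma> (op \<phi> u)) = op (\<lambda>x. \<phi> x * (\<phi> x * \<gamma> x)) u"
    using op_mult[OF bb(1,3), of u] op_mult[OF bb(1,2)] op_mult[OF bb(2,1)] by (simp add: mult.commute)
  finally show ?thesis
    using inner_op[OF bounded_borel_mult[OF bb(1,3)], of u] by (simp add: power2_eq_square mult.assoc)
qed

lemma norm_op: "bounded_borel \<phi> \<Longrightarrow> (norm (op \<phi> u))\<^sup>2 = (\<integral>x. (\<phi> x)\<^sup>2 \<partial>\<mu> u)"
  using integral_op[of \<phi> "\<lambda>x. 1" u] inner_op[of "\<lambda>x. 1"] by (simp add: op_one power2_norm_eq_inner)

lemma cinner_op_limit: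
  assumes "\<And>n. \<phi> n \<in> borel_measurable borel" "\<gamma> \<in> borel_measurable borel" "\<And>n x. \<bar>\<phi> n x\<bar> \<le> C"
    and "\<And>u. AE x in \<mu> u. (\<lambda>n. \<phi> n x) \<longlonglongrightarrow> \<gamma> x"
    and "bounded_borel \<gamma>"
  shows "(\<lambda>n. cinner u (op (\<phi> n) v)) \<longlonglongrightarrow> cinner u (op \<gamma> v)"
proof -
  have bb: "bounded_borel (\<phi> n)" for n by (rule bounded_borelI[OF assms(1,3)])
  have *: "(\<lambda>n. inner u (op (\<phi> n) v)) \<longlonglongrightarrow> inner u (op \<gamma> v)" for u v
    unfolding represents_inner[OF represents_op[OF bb]] represents_inner[OF represents_op[OF assms(5)]]
    by (intro tendsto_intros integral_limit[OF assms(1,2,3,4)]) auto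
  have "(\<lambda>n. inner u (\<i> *\<^sub>C op (\<phi> n) v)) \<longlonglongrightarrow> inner u (\<i> *\<^sub>C op \<gamma> v)"
    using *[of u "\<i> *\<^sub>C v"] by (simp add: clinearD[OF op_clinear] bb assms(5))
  then show ?thesis
    unfolding cinner_eq_inner by (intro tendsto_Complex tendsto_minus *)
qed

lemma op_cong_AE:
  assumes "bounded_borel \<phi>" "bounded_borel \<gamma>" "\<And>u. AE x in \<mu> u. \<phi> x = \<gamma> x"
  shows "op \<phi> = op \<gamma>"
proof (rule symmetric_op_eqI)
  show "inner u (op \<phi> u) = inner u (op \<gamma> u)" for u
    unfolding inner_op[OF assms(1)] inner_op[OF assms(2)]
    by (rule integral_cong_AE) (use assms in \<open>auto simp: measurable_\<mu> bounded_borel_def\<close>)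
qed (use assms op_symmetric in auto)

end

section \<open>Polynomials of a positive contraction\<close>

text \<open>Horner's scheme at the operator \<open>B\<close>. Coefficients are real, so every value
  stays symmetric when \<open>B\<close> is.\<close>

definition poly_op :: "('a::complex_hilbert_space \<Rightarrow> 'a) \<Rightarrow> real poly \<Rightarrow> 'a \<Rightarrow> 'a" where
  "poly_op B p = fold_coeffs (\<lambda>a T u. a *\<^sub>R u + B (T u)) p (\<lambda>u. 0)"

text \<open>Polynomials are unbounded on the line. Composing with the clamp makes them bounded Borel
  symbols and changes no integral over a measure carried by the unit interval.\<close>

definition unit_clamp :: "real \<Rightarrow> real" where "unit_clamp x = max 0 (min 1 x)"

lemma unit_clamp_bounds: "0 \<le> unit_clamp x" "unit_clamp x \<le> 1" and unit_clamp_id: "x \<in> {0..1} \<Longrightarrow> unit_clamp x = x"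
  by (auto simp: unit_clamp_def)

lemma continuous_on_unit_clamp: "continuous_on S unit_clamp"
  unfolding unit_clamp_def by (intro continuous_intros)

lemma borel_measurable_unit_clamp [measurable]: "unit_clamp \<in> borel_measurable borel"
  by (rule borel_measurable_continuous_onI[OF continuous_on_unit_clamp])

lemma bounded_continuous_unit_clamp:
  assumes "continuous_on {0..1} (f::real \<Rightarrow> real)"
  shows "\<exists>C. \<forall>x. \<bar>f (unit_clamp x)\<bar> \<le> C"
proof -
  have "bounded (f ` {0..1})" by (rule compact_imp_bounded[OF compact_continuous_image[OF assms compact_Icc]])
  then obtain C where C: "\<forall>x\<in>{0..1}. \<bar>f x\<bar> \<le> C" unfolding bounded_iff by auto
  have "\<bar>f (unit_clamp x)\<bar> \<le> C" for x using C unit_clamp_bounds[of x] by simp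
  then show ?thesis by blast
qed

lemma continuous_comp_unit_clamp:
  assumes "continuous_on {0..1} (f::real \<Rightarrow> real)" shows "continuous_on UNIV (\<lambda>x. f (unit_clamp x))"
  by (rule continuous_on_compose2[OF assms continuous_on_unit_clamp]) (auto simp: unit_clamp_bounds)

text \<open>The inequality says \<open>B\<^sup>2 \<le> B\<close>, an equivalent of 0 \<le> B \<le> 1
  for symmetric \<open>B\<close>. In this form the positivity of B (1 - B) is immediate, without a
  square root of \<open>B\<close>.\<close>

locale positive_contraction =
  fixes B :: "'a::complex_hilbert_space \<Rightarrow> 'a"
  assumes B_sym: "symmetric_op B" and B_sq_le: "(norm (B u))\<^sup>2 \<le> inner u (B u)"
begin

lemmas B_simps = clinearD[OF symmetric_opD(1)[OF B_sym]]
lemmas B_adj = symmetric_opD(4)[OF B_sym]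

abbreviation P :: "real poly \<Rightarrow> 'a \<Rightarrow> 'a" where "P \<equiv> poly_op B"

lemma P_0 [simp]: "P 0 u = 0"
  by (simp add: poly_op_def)

lemma P_pCons [simp]: "P (pCons a p) u = a *\<^sub>R u + B (P p u)"
proof (cases "p = 0")
  case True
  then show ?thesis
    by (cases "a = 0") (simp_all add: poly_op_def B_simps fold_coeffs_pCons_coeff_not_0_eq)
next
  case False
  then show ?thesis by (simp add: poly_op_def fold_coeffs_pCons_not_0_0_eq)
qed

lemma P_const: "P [:a:] u = a *\<^sub>R u"
  by (simp add: B_simps)

lemma P_one: "P 1 u = u"
  using P_const[of 1] by (simp add: one_pCons)

lemma P_add: "P (p + q) u = P p u + P q u"
  by (induction p q rule: poly_induct2) (simp_all add: B_simps scaleR_add_left)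

lemma P_smult: "P (smult c p) u = c *\<^sub>R P p u"
  by (induction p) (simp_all add: B_simps scaleR_add_right)

lemma P_arg: "P p (x + y) = P p x + P p y" "P p (a *\<^sub>C x) = a *\<^sub>C P p x" "P p (r *\<^sub>R x) = r *\<^sub>R P p x"
  "P p (B x) = B (P p x)"
  by (induction p) (simp_all add: B_simps scaleR_add_right scaleC_add_right scaleC_scaleR mult.commute)

lemma P_mult: "P (p * q) u = P p (P q u)"
  by (induction p) (simp_all add: P_add P_smult B_simps P_arg)

lemma P_adj: "inner (P p u) v = inner u (P p v)"
  by (induction p arbitrary: u v) (simp_all add: inner_add_left inner_add_right B_adj P_arg)

lemma symmetric_P: "symmetric_op (P p)"
proof (rule symmetric_opI)
  show "clinear (P p)" by (simp add: clinear_def P_arg)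
  show "inner (P p u) v = inner u (P p v)" for u v by (rule P_adj)
  have "\<exists>C. \<forall>u. norm (P p u) \<le> norm u * C"
  proof (induction p)
    case 0
    then show ?case by (intro exI[of _ 0]) simp
  next
    case (pCons a p)
    then obtain C where C: "\<And>u. norm (P p u) \<le> norm u * C" by blast
    obtain K where K: "K > 0" "\<And>u. norm (B u) \<le> norm u * K"
      using bounded_linear.pos_bounded[OF symmetric_opD(2)[OF B_sym]] by blast
    have "norm (a *\<^sub>R u + B (P p u)) \<le> norm u * (\<bar>a\<bar> + C * K)" for u
    proof -
      have "norm (B (P p u)) \<le> norm u * C * K"
        by (rule order_trans[OF K(2) mult_right_mono[OF C less_imp_le[OF K(1)]]])
      then show ?thesis
        using norm_triangle_ineq[of "a *\<^sub>R u" "B (P p u)"] by (simp add: algebra_simps)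
    qed
    then show ?case by auto
  qed
  then obtain C where "\<And>u. norm (P p u) \<le> norm u * C" by blast
  then show "bounded_linear (P p)" by (rule bounded_linear_intro[OF P_arg(1,3)])
qed

lemma B_norm_le: "norm (B u) \<le> norm u"
proof -
  have "norm (B u) * norm (B u) \<le> norm u * norm (B u)"
    using B_sq_le[of u] norm_cauchy_schwarz[of u "B u"] by (simp add: power2_eq_square)
  then show ?thesis by (cases "B u = 0") auto
qed

lemma B_le_1: "inner u (B u) \<le> (norm u)\<^sup>2"
proof -
  have "norm u * norm (B u) \<le> norm u * norm u" by (rule mult_left_mono[OF B_norm_le]) simp
  then show ?thesis
    using norm_cauchy_schwarz[of u "B u"] by (simp add: power2_eq_square)
qed

definition X :: "real poly" where "X = [:0, 1:]"
definition Y :: "real poly" where "Y = [:1, -1:]"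

lemma P_X: "P X u = B u" and P_Y: "P Y u = u - B u"
  by (simp_all add: X_def Y_def B_simps)

lemma poly_X: "poly X x = x" and poly_Y: "poly Y x = 1 - x"
  by (simp_all add: X_def Y_def)

text \<open>Even powers move symmetrically to both sides of the inner product. Induction in steps of
  two therefore leaves the four operators 1, B, 1 - B and B (1 - B).\<close>

lemma P_monomial_nonneg: "0 \<le> inner u (P (X ^ k * Y ^ m) u)"
proof (induction k arbitrary: u rule: nat_induct2)
  case 0
  show ?case
  proof (induction m arbitrary: u rule: nat_induct2)
    case 0
    show ?case by (simp add: P_one)
  next
    case 1
    show ?case using B_le_1[of u] by (simp add: P_Y inner_diff_right power2_norm_eq_inner)
  next
    case (step m)
    have "inner u (P (X ^ 0 * Y ^ (m + 2)) u) = inner (P Y u) (P (X ^ 0 * Y ^ m) (P Y u))"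
      by (simp add: P_adj P_mult[symmetric] power_add power2_eq_square mult_ac)
    then show ?case using step by metis
  qed
next
  case 1
  show ?case
  proof (induction m arbitrary: u rule: nat_induct2)
    case 0
    show ?case using order_trans[OF zero_le_power2 B_sq_le[of u]] by (simp add: P_X)
  next
    case 1
    have "inner u (P (X * Y) u) = inner u (B u) - (norm (B u))\<^sup>2"
      by (simp add: P_mult P_X P_Y B_simps inner_diff_right B_adj power2_norm_eq_inner)
    then show ?case using B_sq_le[of u] by simp
  next
    case (step m)
    have "inner u (P (X ^ 1 * Y ^ (m + 2)) u) = inner (P Y u) (P (X ^ 1 * Y ^ m) (P Y u))"
      by (simp add: P_adj P_mult[symmetric] power_add power2_eq_square mult_ac)
    then show ?case using step by metis
  qed
next
  case (step k)
  have "inner u (P (X ^ (k + 2) * Y ^ m) u) = inner (P X u) (P (X ^ k * Y ^ m) (P X u))"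
    by (simp add: P_adj P_mult[symmetric] power_add power2_eq_square mult_ac)
  then show ?case using step by metis
qed

text \<open>The Bernstein basis evaluated at \<open>B\<close>. It is bilinear, not just quadratic,
  because the induction on moments replaces \<open>v\<close> by \<open>B v\<close>.\<close>

definition weight :: "nat \<Rightarrow> nat \<Rightarrow> 'a \<Rightarrow> 'a \<Rightarrow> real" where
  "weight n k v u = (n choose k) * inner v (P (X ^ k * Y ^ (n - k)) u)"

lemma weight_nonneg: "0 \<le> weight n k u u"
  by (simp add: weight_def P_monomial_nonneg)

lemma P_sum: "P (\<Sum>i\<in>I. f i) u = (\<Sum>i\<in>I. P (f i) u)"
  by (induction I rule: infinite_finite_induct) (simp_all add: P_add)

lemma sum_weight: "(\<Sum>k\<le>n. weight n k v u) = inner v u"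
proof -
  have "(\<Sum>k\<le>n. weight n k v u) = inner v (P (\<Sum>k\<le>n. of_nat (n choose k) * X ^ k * Y ^ (n - k)) u)"
    unfolding P_sum inner_sum_right weight_def
    by (intro sum.cong) (simp_all add: P_smult of_nat_poly mult.assoc)
  also have "(\<Sum>k\<le>n. of_nat (n choose k) * X ^ k * Y ^ (n - k)) = (X + Y) ^ n"
    by (simp add: binomial_ring)
  also have "X + Y = 1" by (simp add: X_def Y_def one_pCons)
  finally show ?thesis by (simp add: P_one)
qed

text \<open>Nonnegativity at v + u and v - u gives this arithmetic-mean form of Cauchy-Schwarz. Its
  right-hand side is linear in diagonal weights, so its sum over k is explicit.\<close>

lemma weight_abs_le: "\<bar>weight n k v u\<bar> \<le> (weight n k v v + weight n k u u) / 2"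
proof -
  let ?q = "X ^ k * Y ^ (n - k)"
  have "inner v (P ?q u) = inner u (P ?q v)" using P_adj[of ?q u v] by (simp add: inner_commute)
  then have "0 \<le> inner v (P ?q v) + 2 * s * inner v (P ?q u) + inner u (P ?q u)" if "s = 1 \<or> s = -1" for s
    using P_monomial_nonneg[of "v + s *\<^sub>R u" k "n - k"] that
    by (auto simp: P_arg inner_add_left inner_add_right)
  from this[of 1] this[of "-1"] have "\<bar>inner v (P ?q u)\<bar> \<le> (inner v (P ?q v) + inner u (P ?q u)) / 2"
    unfolding abs_le_iff by auto
  then have "(n choose k) * \<bar>inner v (P ?q u)\<bar> \<le> (n choose k) * ((inner v (P ?q v) + inner u (P ?q u)) / 2)"
    by (rule mult_left_mono) simp
  then show ?thesis by (simp add: weight_def abs_mult algebra_simps)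
qed

text \<open>The induction uses \<open>k (n choose k) = n ((n - 1) choose (k - 1))\<close>, which trades one factor
  \<open>k / n\<close> for one application of \<open>B\<close>, up to an error \<open>O(1 / n)\<close> in the argument.\<close>

lemma bernstein_moments:
  "(\<lambda>n. \<Sum>k\<le>n. (k / n) ^ j * weight n k v u) \<longlonglongrightarrow> inner v (P (X ^ j) u)"
proof (induction j arbitrary: v)
  case 0
  show ?case by (simp add: sum_weight P_one)
next
  case (Suc j)
  define a where "a n = (\<Sum>k\<le>n. (k / n) ^ j * weight n k (B v) u)" for n
  define b where "b n = (\<Sum>k\<le>n. (Suc k / Suc n) ^ j * weight n k (B v) u)" for n :: nat
  have shift: "(\<Sum>k\<le>Suc n. (k / Suc n) ^ Suc j * weight (Suc n) k v u) = b n" for n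
  proof -
    have w: "(Suc k / Suc n) * weight (Suc n) (Suc k) v u = weight n k (B v) u" for k
    proof -
      have "inner v (P (X ^ Suc k * Y ^ (Suc n - Suc k)) u) = inner (B v) (P (X ^ k * Y ^ (n - k)) u)"
        by (simp add: P_mult P_X B_adj mult.assoc)
      moreover have "real (Suc k) * real (Suc n choose Suc k) = real (Suc n) * real (n choose k)"
        using Suc_times_binomial_eq[of n k] by (metis mult.commute of_nat_mult)
      then have "(Suc k / Suc n) * real (Suc n choose Suc k) = real (n choose k)"
        by (simp add: field_simps del: binomial_Suc_Suc of_nat_Suc)
      ultimately show ?thesis unfolding weight_def by (metis mult.assoc)
    qed
    \<comment> \<open>The term at \<open>k = 0\<close> vanishes because the exponent
      \<open>Suc j\<close> is positive, so the index can be shifted.\<close>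
    have "(\<Sum>k\<le>Suc n. (k / Suc n) ^ Suc j * weight (Suc n) k v u)
        = (\<Sum>k\<le>n. (Suc k / Suc n) ^ j * ((Suc k / Suc n) * weight (Suc n) (Suc k) v u))"
      by (subst sum.atMost_Suc_shift) (simp add: mult_ac)
    also have "\<dots> = b n" unfolding w b_def by simp
    finally show ?thesis .
  qed
  have diff: "\<bar>b n - a n\<bar> \<le> j / Suc n * (((norm (B v))\<^sup>2 + (norm u)\<^sup>2) / 2)" for n
  proof -
    have pow: "\<bar>(Suc k / Suc n) ^ j - (k / n) ^ j\<bar> \<le> j / Suc n" if "k \<le> n" for k
    proof (cases "n = 0")
      case False
      have "Suc k / Suc n - k / n = (real n - k) / (real n * Suc n)"
        using False by (simp add: field_simps)
      moreover have "0 \<le> (real n - k) / (real n * Suc n)" using that by simp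
      moreover have "(real n - k) / (real n * Suc n) \<le> n / (real n * Suc n)"
        by (intro divide_right_mono) auto
      moreover have "n / (real n * Suc n) = 1 / Suc n" using False by simp
      ultimately have "\<bar>Suc k / Suc n - k / n\<bar> \<le> 1 / Suc n" by linarith
      \<comment> \<open>Both grid points lie in the unit interval, where the power \<open>j\<close>
        is Lipschitz with constant \<open>j\<close>.\<close>
      moreover have "\<bar>(Suc k / Suc n) ^ j - (k / n) ^ j\<bar> \<le> j * \<bar>Suc k / Suc n - k / n\<bar>"
        using norm_power_diff[of "real (Suc k) / Suc n" "k / n" j] that False by (simp add: divide_le_eq_1)
      ultimately have "\<bar>(Suc k / Suc n) ^ j - (k / n) ^ j\<bar> \<le> j * (1 / Suc n)"
        by (meson mult_left_mono of_nat_0_le_iff order_trans)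
      then show ?thesis by (simp add: add.commute)
    qed (use that in \<open>cases j; simp\<close>)
    have "\<bar>b n - a n\<bar> \<le> (\<Sum>k\<le>n. \<bar>(Suc k / Suc n) ^ j - (k / n) ^ j\<bar> * \<bar>weight n k (B v) u\<bar>)"
      unfolding a_def b_def sum_subtractf[symmetric] left_diff_distrib[symmetric]
      by (rule order_trans[OF sum_abs]) (simp add: abs_mult)
    also have "\<dots> \<le> (\<Sum>k\<le>n. j / Suc n * ((weight n k (B v) (B v) + weight n k u u) / 2))"
      by (intro sum_mono mult_mono pow weight_abs_le) auto
    also have "\<dots> = j / Suc n * (((norm (B v))\<^sup>2 + (norm u)\<^sup>2) / 2)"
      by (simp add: sum_distrib_left[symmetric] sum_divide_distrib[symmetric] sum.distrib sum_weight power2_norm_eq_inner)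
    finally show ?thesis .
  qed
  have "(\<lambda>n. b n - a n) \<longlonglongrightarrow> 0"
  proof (rule tendsto_0_le[of "\<lambda>n. j / Suc n * (((norm (B v))\<^sup>2 + (norm u)\<^sup>2) / 2)" _ _ 1])
    have "(\<lambda>n. j * (1 / Suc n) * (((norm (B v))\<^sup>2 + (norm u)\<^sup>2) / 2)) \<longlonglongrightarrow> real j * 0 * (((norm (B v))\<^sup>2 + (norm u)\<^sup>2) / 2)"
      by (intro tendsto_intros LIMSEQ_Suc[OF lim_1_over_n])
    then show "(\<lambda>n. j / Suc n * (((norm (B v))\<^sup>2 + (norm u)\<^sup>2) / 2)) \<longlonglongrightarrow> 0" by simp
    show "\<forall>\<^sub>F n in sequentially. norm (b n - a n) \<le> norm (j / Suc n * (((norm (B v))\<^sup>2 + (norm u)\<^sup>2) / 2)) * 1"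
      using diff by (intro always_eventually allI) (simp add: abs_mult)
  qed
  moreover have "a \<longlonglongrightarrow> inner (B v) (P (X ^ j) u)"
    unfolding a_def[abs_def] by (rule Suc.IH)
  ultimately have "b \<longlonglongrightarrow> 0 + inner (B v) (P (X ^ j) u)"
    using tendsto_add[of "\<lambda>n. b n - a n" 0 _ a] by fastforce
  then have "(\<lambda>n. \<Sum>k\<le>Suc n. (k / Suc n) ^ Suc j * weight (Suc n) k v u) \<longlonglongrightarrow> inner v (P (X ^ Suc j) u)"
    unfolding shift by (simp add: P_mult P_X B_adj)
  then show ?case by (rule LIMSEQ_imp_Suc)
qed

text \<open>For a unit vector the weights are probabilities on the points k/n of the unit interval.
  Such measures are tight, so a subsequence converges weakly, and \<open>bernstein_moments\<close>
  computes the moments of the limit.\<close>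

lemma unit_moment_measure:
  assumes "norm u = 1"
  shows "\<exists>M. real_distribution M \<and> (AE x in M. x \<in> {0..1}) \<and>
    (\<forall>p. (\<integral>x. poly p (unit_clamp x) \<partial>M) = inner u (P p u))"
proof -
  define w where "w n k = (if k \<le> n then weight n k u u else 0)" for n k
  have w_nonneg: "0 \<le> w n k" for n k by (simp add: w_def weight_nonneg)
  have w_sum: "(\<integral>\<^sup>+k. ennreal (w n k) \<partial>count_space UNIV) = 1" for n
  proof -
    have "(\<integral>\<^sup>+k. ennreal (w n k) \<partial>count_space UNIV) = (\<Sum>k\<le>n. ennreal (w n k))"
      by (rule nn_integral_count_space') (auto simp: w_def)
    also have "\<dots> = ennreal (\<Sum>k\<le>n. w n k)" by (rule sum_ennreal) (simp add: w_nonneg)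
    also have "(\<Sum>k\<le>n. w n k) = inner u u" unfolding sum_weight[symmetric, of _ _ n] by (simp add: w_def)
    finally show ?thesis using assms by (simp add: power2_norm_eq_inner[symmetric])
  qed
  define D where "D n = embed_pmf (w n)" for n
  have pmf_D: "pmf (D n) k = w n k" for n k
    unfolding D_def by (rule pmf_embed_pmf) (auto simp: w_nonneg w_sum)
  have set_D: "set_pmf (D n) \<subseteq> {..n}" for n by (auto simp: set_pmf_iff pmf_D w_def split: if_splits)
  define M where "M n = distr (measure_pmf (D n)) borel (\<lambda>k. k / n)" for n :: nat
  have M_real: "real_distribution (M n)" for n
    unfolding M_def by (rule prob_space.real_distribution_distr[OF measure_pmf.prob_space_axioms]) simp
  have int_M: "(\<integral>x. g x \<partial>M n) = (\<Sum>k\<le>n. g (k / n) * weight n k u u)"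
    if [measurable]: "g \<in> borel_measurable borel" for g :: "real \<Rightarrow> real" and n
  proof -
    have "(\<integral>x. g x \<partial>M n) = (\<integral>k. g (k / n) \<partial>measure_pmf (D n))"
      unfolding M_def by (rule integral_distr) auto
    also have "\<dots> = (\<Sum>k\<le>n. pmf (D n) k *\<^sub>R g (k / n))"
      by (rule integral_measure_pmf) (use set_D in auto)
    also have "\<dots> = (\<Sum>k\<le>n. g (k / n) * weight n k u u)"
      by (intro sum.cong) (auto simp: pmf_D w_def)
    finally show ?thesis .
  qed
  have frac: "real k / real n \<in> {0..1}" if "k \<le> n" for k n
    using that by (cases "n = 0") (auto simp: divide_le_eq_1)
  have "tight M"
    unfolding tight_def
  proof (intro conjI allI impI)
    fix e :: real assume "0 < e"
    \<comment> \<open>Tightness is phrased with half-open intervals; the left end -1 keeps the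
      possible atom at 0 inside.\<close>
    have "measure (M n) {-1<..1} = 1" for n
    proof -
      interpret real_distribution "M n" by (rule M_real)
      have "real k / real n \<in> {-1<..1}" if "k \<in> set_pmf (D n)" for k
      proof -
        have "real k / real n \<in> {0..1}" using frac set_D[of n] that by blast
        then show ?thesis unfolding greaterThanAtMost_iff atLeastAtMost_iff by linarith
      qed
      then have "AE k in measure_pmf (D n). k / n \<in> {-1<..1}"
        unfolding AE_measure_pmf_iff by blast
      moreover have "{x::real. x \<in> {-1<..1}} \<in> sets borel" by simp
      ultimately have "AE x in M n. x \<in> {-1<..1}"
        unfolding M_def by (subst AE_distr_iff) auto
      then show ?thesis by (subst prob_eq_1) auto
    qed
    then show "\<exists>a b. a < b \<and> (\<forall>n. 1 - e < measure (M n) {a<..b})"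
      using \<open>0 < e\<close> by (intro exI[of _ "-1"] exI[of _ 1]) auto
  qed (rule M_real)
  then obtain r N where r: "strict_mono r" and N: "real_distribution N"
    and weak: "weak_conv_m (M \<circ> id \<circ> r) N"
    using tight_imp_convergent_subsubsequence[of M id] by (auto simp: strict_mono_id)
  have conv: "(\<lambda>n. \<integral>x. f x \<partial>M (r n)) \<longlonglongrightarrow> (\<integral>x. f x \<partial>N)"
    if "continuous_on UNIV f" "\<And>x. \<bar>f x\<bar> \<le> C" for f :: "real \<Rightarrow> real" and C
    using weak_conv_imp_integral_bdd_continuous_conv[OF M_real N, of "r" f C] weak that
    by (simp add: o_def continuous_on_eq_continuous_at)
  interpret N: real_distribution N by (rule N)
  have moments: "(\<integral>x. poly p (unit_clamp x) \<partial>N) = inner u (P p u)" for p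
  proof -
    have cont: "continuous_on UNIV (\<lambda>x. poly p (unit_clamp x))"
      by (intro continuous_comp_unit_clamp continuous_intros)
    have meas: "(\<lambda>x. poly p (unit_clamp x)) \<in> borel_measurable borel"
      by (rule borel_measurable_continuous_onI[OF cont])
    obtain C where C: "\<And>x. \<bar>poly p (unit_clamp x)\<bar> \<le> C"
      using bounded_continuous_unit_clamp[OF continuous_on_poly[OF continuous_on_id]] by blast
    have eq: "(\<integral>x. poly p (unit_clamp x) \<partial>M n) = (\<Sum>i\<le>degree p. coeff p i * (\<Sum>k\<le>n. (k / n) ^ i * weight n k u u))" for n
      unfolding int_M[OF meas] sum_distrib_left
      by (subst sum.swap, intro sum.cong refl)
        (simp add: unit_clamp_id[OF frac] poly_altdef sum_distrib_right mult.assoc)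
    have "(\<lambda>n. \<integral>x. poly p (unit_clamp x) \<partial>M n) \<longlonglongrightarrow> (\<Sum>i\<le>degree p. coeff p i * inner u (P (X ^ i) u))"
      unfolding eq by (intro tendsto_intros bernstein_moments)
    also have "(\<Sum>i\<le>degree p. coeff p i * inner u (P (X ^ i) u)) = inner u (P (\<Sum>i\<le>degree p. smult (coeff p i) (X ^ i)) u)"
      by (simp add: P_sum P_smult inner_sum_right)
    also have "(\<Sum>i\<le>degree p. smult (coeff p i) (X ^ i)) = p"
      using poly_as_sum_of_monoms[of p] by (simp add: X_def monom_altdef)
    finally show ?thesis
      using LIMSEQ_unique[OF conv[OF cont C]] LIMSEQ_subseq_LIMSEQ[OF _ r] by (fastforce simp: o_def)
  qed
  have "AE x in N. x \<in> {0..1}"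
  proof -
    \<comment> \<open>A bounded continuous function whose zero set is exactly the unit interval;
      weak convergence thus transfers the support to the limit.\<close>
    define d where "d x = min 1 \<bar>x - unit_clamp x\<bar>" for x
    have cont: "continuous_on UNIV d" unfolding d_def by (intro continuous_intros continuous_on_unit_clamp)
    have meas: "d \<in> borel_measurable borel"
      by (rule borel_measurable_continuous_onI[OF cont])
    have d_bound: "\<bar>d x\<bar> \<le> 1" for x by (simp add: d_def)
    have "(\<integral>x. d x \<partial>M n) = 0" for n
      unfolding int_M[OF meas] by (intro sum.neutral) (auto simp: d_def unit_clamp_id[OF frac])
    then have "(\<integral>x. d x \<partial>N) = 0"
      using conv[OF cont d_bound] LIMSEQ_unique[OF tendsto_const] by fastforce
    moreover have "integrable N d"
      by (rule N.integrable_const_bound[of _ 1]) (use d_bound meas in auto)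
    ultimately have "AE x in N. d x = 0"
      by (subst (asm) integral_nonneg_eq_0_iff_AE) (auto simp: d_def)
    then show ?thesis
      by eventually_elim (auto simp: d_def min_def unit_clamp_def split: if_splits)
  qed
  then show ?thesis using N moments by blast
qed

text \<open>The moments are quadratic in \<open>u\<close>, so the measure of the normalised vector
  is rescaled by the squared norm; the zero vector gets the null measure.\<close>

lemma moment_measure:
  "\<exists>M. sets M = sets (borel :: real measure) \<and> finite_measure M \<and> (AE x in M. x \<in> {0..1}) \<and>
    (\<forall>p. (\<integral>x. poly p (unit_clamp x) \<partial>M) = inner u (P p u))"
proof (cases "u = 0")
  case True
  then show ?thesis
    by (intro exI[of _ "null_measure borel"])
      (auto simp: integral_null_measure intro!: finite_measureI AE_I[of _ _ UNIV])
next
  case False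
  define v where "v = (1 / norm u) *\<^sub>R u"
  have "norm v = 1" using False by (simp add: v_def)
  then obtain N where N: "real_distribution N" "AE x in N. x \<in> {0..1}"
    and mom: "\<And>p. (\<integral>x. poly p (unit_clamp x) \<partial>N) = inner v (P p v)" using unit_moment_measure by blast
  interpret real_distribution N by (rule N)
  define M where "M = scale_measure (ennreal ((norm u)\<^sup>2)) N"
  have M: "M = density N (\<lambda>_. ennreal ((norm u)\<^sup>2))"
    unfolding M_def by (rule measure_eqI) (auto simp: emeasure_density nn_integral_cmult_indicator)
  have "(\<integral>x. poly p (unit_clamp x) \<partial>M) = inner u (P p u)" for p
  proof -
    have meas: "(\<lambda>x. poly p (unit_clamp x)) \<in> borel_measurable borel"
      by (intro borel_measurable_continuous_onI continuous_comp_unit_clamp continuous_intros)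
    have "(\<integral>x. poly p (unit_clamp x) \<partial>M) = (norm u)\<^sup>2 * inner v (P p v)"
      unfolding M by (subst integral_real_density) (use meas in \<open>simp_all add: mom\<close>)
    also have "\<dots> = inner u (P p u)"
      using False by (simp add: v_def P_arg power2_eq_square)
    finally show ?thesis .
  qed
  moreover have "AE x in M. x \<in> {0..1}"
    unfolding M by (subst AE_density) (use N(2) in auto)
  moreover have "finite_measure M"
    by (rule finite_measureI) (simp add: M_def emeasure_space_1 ennreal_mult_eq_top_iff)
  ultimately show ?thesis by (intro exI[of _ M]) (simp add: M_def)
qed

end

section \<open>The spectral theorem for positive operators\<close>

lemma poly_uniform_approximation:
  assumes "continuous_on {0..1} (f::real \<Rightarrow> real)"
  shows "\<exists>p. \<forall>n. \<forall>x\<in>{0..1}. \<bar>f x - poly (p n) x\<bar> < 1 / Suc n"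
proof -
  have "\<exists>p. \<forall>x\<in>{0..1}. \<bar>f x - poly p x\<bar> < 1 / Suc n" for n
  proof -
    obtain g where g: "real_polynomial_function g" "\<And>x. x \<in> {0..1} \<Longrightarrow> \<bar>f x - g x\<bar> < 1 / Suc n"
      using Stone_Weierstrass_real_polynomial_function[OF _ assms, of "1 / Suc n"] by auto
    then obtain a m where "g = (\<lambda>x. \<Sum>i\<le>m. a i * x ^ i)" unfolding real_polynomial_function_iff_sum by blast
    then have eq: "g x = poly (\<Sum>i\<le>m. monom (a i) i) x" for x by (simp add: poly_sum poly_monom)
    show ?thesis using g(2) unfolding eq by blast
  qed
  then have "\<forall>n. \<exists>p. \<forall>x\<in>{0..1}. \<bar>f x - poly p x\<bar> < 1 / Suc n" by blast
  from choice[OF this] show ?thesis .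
qed

section \<open>Multiplicativity: from polynomial to Borel symbols\<close>

context measure_family
begin

lemma multiplies_sum:
  assumes "bounded_borel \<phi>" "represents \<phi> S" "\<And>i::nat. bounded_borel (\<eta> i)" "\<And>i. multiplies \<phi> S (\<eta> i) (T i)"
  shows "multiplies \<phi> S (\<lambda>x. \<Sum>i<n. \<eta> i x) (\<lambda>u. \<Sum>i<n. T i u)"
proof -
  note sym = represents_symmetric[OF assms(2)]
  have "bounded_borel (\<lambda>x. \<Sum>i<n. \<eta> i x) \<and> multiplies \<phi> S (\<lambda>x. \<Sum>i<n. \<eta> i x) (\<lambda>u. \<Sum>i<n. T i u)"
  proof (induction n)
    case 0
    show ?case using multiplies_scale[OF sym assms(4), of 0] by simp
  next
    case (Suc n)
    then show ?case
      using multiplies_add[OF assms(1) _ assms(3) sym _ assms(4)] bounded_borel_add[OF _ assms(3)] by simp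
  qed
  then show ?thesis ..
qed

text \<open>With \<phi> fixed, the admissible second symbols grow by bounded limits: polynomials
  give continuous functions by Weierstrass, these give half-lines, and half-lines are an
  intersection-stable generator from which Dynkin's argument reaches all Borel sets.\<close>

lemma multiplies_indicator_of_polys:
  assumes \<phi>: "bounded_borel \<phi>" "represents \<phi> S"
    and supp: "\<And>u. AE x in \<mu> u. x \<in> {0..1}"
    and poly: "\<And>p. \<exists>T. multiplies \<phi> S (\<lambda>x. poly p (unit_clamp x)) T"
    and B: "B \<in> sets borel"
  shows "\<exists>T. multiplies \<phi> S (indicator B) T"
proof -
  note sym = represents_symmetric[OF \<phi>(2)]
  have cont: "\<exists>T. multiplies \<phi> S (\<lambda>x. f (unit_clamp x)) T" if f: "continuous_on UNIV f" for f :: "real \<Rightarrow> real"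
  proof -
    have f01: "continuous_on {0..1} f" using f continuous_on_subset by blast
    obtain p where p: "\<And>n x. x \<in> {0..1} \<Longrightarrow> \<bar>f x - poly (p n) x\<bar> < 1 / Suc n"
      using poly_uniform_approximation[OF f01] by blast
    obtain C where C: "\<And>x. \<bar>f (unit_clamp x)\<bar> \<le> C"
      using bounded_continuous_unit_clamp[OF f01] by blast
    have "\<forall>n. \<exists>T. multiplies \<phi> S (\<lambda>x. poly (p n) (unit_clamp x)) T" using poly by blast
    from choice[OF this] obtain T where T: "\<And>n. multiplies \<phi> S (\<lambda>x. poly (p n) (unit_clamp x)) (T n)" by blast
    have meas: "(\<lambda>x. f (unit_clamp x)) \<in> borel_measurable borel" "(\<lambda>x. poly (p n) (unit_clamp x)) \<in> borel_measurable borel" for n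
      by (intro borel_measurable_continuous_onI continuous_comp_unit_clamp f01 continuous_intros)+
    have near: "\<bar>f (unit_clamp x) - poly (p n) (unit_clamp x)\<bar> < 1 / Suc n" for n x
      by (rule p) (simp add: unit_clamp_bounds)
    show ?thesis
    proof (rule multiplies_limit[OF \<phi> T meas(2,1), where C = "C + 1"])
      fix n x
      have "1 / real (Suc n) \<le> 1" by simp
      then show "\<bar>poly (p n) (unit_clamp x)\<bar> \<le> C + 1" using near[of x n] C[of x] by linarith
    next
      fix u
      have "(\<lambda>n. poly (p n) (unit_clamp x)) \<longlonglongrightarrow> f (unit_clamp x)" for x
      proof (rule LIM_zero_cancel, rule tendsto_0_le[OF LIMSEQ_Suc[OF lim_1_over_n], of _ 1])
        show "\<forall>\<^sub>F n in sequentially. norm (poly (p n) (unit_clamp x) - f (unit_clamp x)) \<le> norm (1 / real (Suc n)) * 1"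
          using near[of x] by (intro always_eventually allI) (simp add: abs_minus_commute less_imp_le)
      qed
      then show "AE x in \<mu> u. (\<lambda>n. poly (p n) (unit_clamp x)) \<longlonglongrightarrow> f (unit_clamp x)" by simp
    qed
  qed
  have halfline: "\<exists>T. multiplies \<phi> S (indicator {..a}) T" for a
  proof -
    \<comment> \<open>Equal to 1 up to \<open>a\<close>, then falling to 0 with slope
      \<open>n\<close>; the pointwise limit is the closed half-line.\<close>
    define f where "f n x = max 0 (min 1 (1 - real n * (x - a)))" for n x
    have f_cont: "continuous_on UNIV (f n)" for n unfolding f_def by (intro continuous_intros)
    have "\<forall>n. \<exists>T. multiplies \<phi> S (\<lambda>x. f n (unit_clamp x)) T" using cont[OF f_cont] by blast
    from choice[OF this] obtain T where T: "\<And>n. multiplies \<phi> S (\<lambda>x. f n (unit_clamp x)) (T n)" by blast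
    show ?thesis
    proof (rule multiplies_limit[OF \<phi> T, where C = 1])
      show "(\<lambda>x. f n (unit_clamp x)) \<in> borel_measurable borel" for n
        by (intro borel_measurable_continuous_onI continuous_comp_unit_clamp continuous_on_subset[OF f_cont]) auto
      show "\<bar>f n (unit_clamp x)\<bar> \<le> 1" for n x by (simp add: f_def)
      fix u
      show "AE x in \<mu> u. (\<lambda>n. f n (unit_clamp x)) \<longlonglongrightarrow> indicator {..a} x"
        using supp[of u]
      proof eventually_elim
        case (elim x)
        have "(\<lambda>n. f n x) \<longlonglongrightarrow> indicator {..a} x"
        proof (cases "x \<le> a")
          case True
          then have "real n * (x - a) \<le> 0" for n by (simp add: mult_le_0_iff)
          then have "f n x = 1" for n unfolding f_def using \<open>\<And>n. real n * (x - a) \<le> 0\<close>[of n] by simp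
          then show ?thesis using True by simp
        next
          case False
          obtain N where N: "1 / (x - a) < real N" using reals_Archimedean2 by blast
          have "f n x = 0" if "n \<ge> N" for n
          proof -
            have "1 < real N * (x - a)" using N False by (simp add: field_simps)
            also have "\<dots> \<le> real n * (x - a)" using that False by (intro mult_right_mono) auto
            finally show ?thesis by (simp add: f_def)
          qed
          then show ?thesis using False by (intro tendsto_eventually eventually_sequentiallyI[of N]) auto
        qed
        then show ?case by (simp add: unit_clamp_id[OF elim])
      qed
    qed simp
  qed
  have "Int_stable (range (\<lambda>a::real. {..a}))" "range (\<lambda>a::real. {..a}) \<subseteq> Pow UNIV"
    "B \<in> sigma_sets UNIV (range (\<lambda>a::real. {..a}))"
    using B unfolding borel_eq_atMost by (auto simp: Int_stable_def)
  then have "B \<in> sets borel \<and> (\<exists>T. multiplies \<phi> S (indicator B) T)"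
  proof (induct rule: sigma_sets_induct_disjoint)
    case (basic A)
    then show ?case using halfline by auto
  next
    case empty
    show ?case using multiplies_scale[OF sym multiplies_one[OF \<phi>(2)], of 0] by auto
  next
    case (compl A)
    then obtain T where T: "multiplies \<phi> S (indicator A) T" by blast
    have "multiplies \<phi> S (\<lambda>x. 1 + (-1) * indicator A x) (\<lambda>u. u + (-1) *\<^sub>R T u)"
      by (intro multiplies_add[OF \<phi>(1) _ _ sym] multiplies_one[OF \<phi>(2)] multiplies_scale[OF sym T]
          bounded_borel_scale bounded_borel_indicator) (use compl in auto)
    moreover have "(\<lambda>x. 1 + (-1) * indicator A x) = (indicator (UNIV - A) :: real \<Rightarrow> real)"
      by (auto simp: indicator_def)
    ultimately show ?case using compl by auto
  next
    case (union A)
    then have "\<forall>i. \<exists>T. multiplies \<phi> S (indicator (A i)) T" by blast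
    from choice[OF this] obtain T where T: "\<And>i. multiplies \<phi> S (indicator (A i)) (T i)" by blast
    have A: "A i \<in> sets borel" for i using union by blast
    \<comment> \<open>Disjointness makes the partial sums indicators again, hence uniformly bounded
      by 1.\<close>
    have sum_eq: "(\<Sum>i<n. indicator (A i) x) = (indicator (\<Union>i<n. A i) x :: real)" for n x
      using union(1) by (subst indicator_UN_disjoint) (auto simp: disjoint_family_on_def)
    have "\<exists>U. multiplies \<phi> S (indicator (\<Union>i. A i)) U"
    proof (rule multiplies_limit[OF \<phi> multiplies_sum[OF \<phi> bounded_borel_indicator[OF A] T], where C = 1])
      show "(\<lambda>x. \<Sum>i<n. indicator (A i) x :: real) \<in> borel_measurable borel" for n using A by measurable
      show "(indicator (\<Union>i. A i) :: real \<Rightarrow> real) \<in> borel_measurable borel" using A by measurable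
      show "\<bar>\<Sum>i<n. indicator (A i) x :: real\<bar> \<le> 1" for n x unfolding sum_eq by (simp add: indicator_def)
      show "AE x in \<mu> u. (\<lambda>n. \<Sum>i<n. indicator (A i) x) \<longlonglongrightarrow> (indicator (\<Union>i. A i) x :: real)" for u
        unfolding sum_eq by (intro AE_I2 LIMSEQ_indicator_UN)
    qed
    then show ?case using A by blast
  qed
  then show ?thesis by blast
qed

end

section \<open>Spectral projections of a Borel calculus\<close>

context borel_calculus
begin

text \<open>\<open>integral_op\<close> at indicators. The density is what later settles
  integrability questions: vectors in a range \<open>op \<phi>\<close> have a spectral measure
  damped by the square of \<phi>.\<close>

lemma measure_op_eq_density:
  assumes \<phi>: "bounded_borel \<phi>"
  shows "\<mu> (op \<phi> u) = density (\<mu> u) (\<lambda>x. ennreal ((\<phi> x)\<^sup>2))"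
proof (rule measure_eqI)
  fix A assume "A \<in> sets (\<mu> (op \<phi> u))"
  then have A: "A \<in> sets borel" by simp
  interpret finite_measure "\<mu> v" for v by (rule finite_\<mu>)
  note bb = bounded_borel_mult[OF bounded_borel_mult[OF \<phi> \<phi>] bounded_borel_indicator[OF A]]
  have "emeasure (\<mu> (op \<phi> u)) A = ennreal (\<integral>x. indicator A x \<partial>\<mu> (op \<phi> u))"
    using A by (simp add: emeasure_eq_measure)
  also have "\<dots> = ennreal (\<integral>x. (\<phi> x)\<^sup>2 * indicator A x \<partial>\<mu> u)"
    by (simp only: integral_op[OF \<phi> bounded_borel_indicator[OF A]])
  also have "\<dots> = (\<integral>\<^sup>+x. ennreal ((\<phi> x)\<^sup>2 * indicator A x) \<partial>\<mu> u)"
    using integrable_bounded_borel[OF bb] by (intro nn_integral_eq_integral[symmetric]) (auto simp: power2_eq_square)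
  also have "\<dots> = emeasure (density (\<mu> u) (\<lambda>x. ennreal ((\<phi> x)\<^sup>2))) A"
    using A bounded_borel_measurable[OF \<phi>]
    by (subst emeasure_density) (auto simp: measurable_\<mu> ennreal_mult' ennreal_indicator intro!: nn_integral_cong)
  finally show "emeasure (\<mu> (op \<phi> u)) A = emeasure (density (\<mu> u) (\<lambda>x. ennreal ((\<phi> x)\<^sup>2))) A" .
qed simp

text \<open>Weak convergence would be too little for a norm-convergent series. For indicators the
  squared norm of the remainder is itself an integral against \<mu>, and dominated convergence sends
  it to 0.\<close>

lemma indicator_sums:
  assumes A: "\<And>i::nat. A i \<in> sets borel" and disj: "disjoint_family A"
  shows "(\<lambda>i. op (indicator (A i)) u) sums op (indicator (\<Union>i. A i)) u"
proof -
  define R where "R n = (\<Union>i. A i) - (\<Union>i<n. A i)" for n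
  have R: "R n \<in> sets borel" for n using A by (auto simp: R_def)
  have bi: "bounded_borel (indicator (R n))" "bounded_borel (indicator (A n))" for n
    by (intro bounded_borel_indicator R A)+
  have UA: "(\<Union>i. A i) \<in> sets borel" using A by blast
  have partial: "op (indicator (\<Union>i<n. A i)) u = (\<Sum>i<n. op (indicator (A i)) u)" for n
  proof (induction n)
    case 0
    show ?case using op_scale[of "\<lambda>x. 1" 0 u] by (simp add: indicator_def)
  next
    case (Suc n)
    have "(\<Union>i<Suc n. A i) = (\<Union>i<n. A i) \<union> A n" by (auto simp: less_Suc_eq)
    moreover have "A i \<inter> A n = {}" if "i < n" for i
      using disjoint_family_onD[OF disj, of i n] that by simp
    then have "(\<Union>i<n. A i) \<inter> A n = {}" by blast
    ultimately have "(indicator (\<Union>i<Suc n. A i) :: real \<Rightarrow> real) = (\<lambda>x. indicator (\<Union>i<n. A i) x + indicator (A n) x)"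
      by (auto simp: indicator_def fun_eq_iff)
    moreover have "bounded_borel (indicator (\<Union>i<n. A i))"
      using A by (intro bounded_borel_indicator) auto
    ultimately show ?case using op_add[OF _ bi(2)] Suc by simp
  qed
  have rest: "op (indicator (\<Union>i. A i)) u - (\<Sum>i<n. op (indicator (A i)) u) = op (indicator (R n)) u" for n
  proof -
    have "(indicator (R n) :: real \<Rightarrow> real) = (\<lambda>x. indicator (\<Union>i. A i) x - indicator (\<Union>i<n. A i) x)"
      by (auto simp: R_def indicator_def fun_eq_iff)
    moreover have "bounded_borel (indicator (\<Union>i<n. A i))"
      using A by (intro bounded_borel_indicator) auto
    ultimately show ?thesis using op_diff[OF bounded_borel_indicator[OF UA]] partial by simp
  qed
  have "(\<lambda>n. (norm (op (indicator (R n)) u))\<^sup>2) \<longlonglongrightarrow> (\<integral>x. 0 \<partial>\<mu> u)"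
    unfolding norm_op[OF bi(1)]
  proof (rule integral_limit[where C = 1])
    show "(\<lambda>x. (indicator (R n) x)\<^sup>2 :: real) \<in> borel_measurable borel" for n using R by measurable
    show "AE x in \<mu> u. (\<lambda>n. (indicator (R n) x)\<^sup>2 :: real) \<longlonglongrightarrow> 0"
    proof (rule AE_I2)
      fix x
      have "(\<lambda>n. indicator (\<Union>i<n. A i) x :: real) \<longlonglongrightarrow> indicator (\<Union>i. A i) x" by (rule LIMSEQ_indicator_UN)
      then have "(\<lambda>n. (indicator (\<Union>i. A i) x - indicator (\<Union>i<n. A i) x)\<^sup>2) \<longlonglongrightarrow> (indicator (\<Union>i. A i) x - indicator (\<Union>i. A i) x :: real)\<^sup>2"
        by (intro tendsto_intros)
      moreover have "(indicator (\<Union>i. A i) x - indicator (\<Union>i<n. A i) x :: real)\<^sup>2 = (indicator (R n) x)\<^sup>2" for n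
        by (auto simp: R_def indicator_def)
      ultimately show "(\<lambda>n. (indicator (R n) x)\<^sup>2 :: real) \<longlonglongrightarrow> 0" by simp
    qed
  qed (auto simp: indicator_def)
  from tendsto_real_sqrt[OF this] have "(\<lambda>n. norm (op (indicator (R n)) u)) \<longlonglongrightarrow> 0" by simp
  then have "(\<lambda>n. op (indicator (\<Union>i. A i)) u - (\<Sum>i<n. op (indicator (A i)) u)) \<longlonglongrightarrow> 0"
    unfolding rest by (rule tendsto_norm_zero_cancel)
  from tendsto_diff[OF tendsto_const this, of "op (indicator (\<Union>i. A i)) u"] show ?thesis
    unfolding sums_def by simp
qed

end

context borel_calculus
begin

lemma orthogonal_projection_indicator:
  assumes "B \<in> sets borel" shows "orthogonal_projection (op (indicator B))"
proof -
  note bb = bounded_borel_indicator[OF assms]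
  have "op (indicator B) (op (indicator B) u) = op (indicator B) u" for u
    unfolding op_mult[OF bb bb, symmetric] by (simp add: indicator_inter_arith[symmetric])
  then show ?thesis
    unfolding orthogonal_projection_def
    using clinearD(1,2)[OF op_clinear[OF bb]] symmetric_opD(3)[OF op_symmetric[OF bb]] by blast
qed

text \<open>Taking preimages under h transports the spectral measure of an operator to that of h of
  the operator; the intended h sends (H + 1) inverse back to \<open>H\<close>.\<close>

lemma projection_valued_measure_vimage:
  assumes [measurable]: "h \<in> borel_measurable borel"
  shows "projection_valued_measure (\<lambda>S. op (indicator (h -` S)))"
proof -
  have vi: "h -` S \<in> sets borel" if "S \<in> sets borel" for S
    using measurable_sets_borel[OF assms that] by simp
  show ?thesis
    unfolding projection_valued_measure_def
  proof (intro conjI ballI allI impI)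
    show "orthogonal_projection (op (indicator (h -` S)))" if "S \<in> sets borel" for S
      by (rule orthogonal_projection_indicator[OF vi[OF that]])
    have "(indicator (h -` UNIV) :: real \<Rightarrow> real) = (\<lambda>x. 1)" by (simp add: fun_eq_iff)
    then show "op (indicator (h -` UNIV)) = id" by (simp add: op_one fun_eq_iff)
    fix S T :: "real set" assume "S \<in> sets borel" "T \<in> sets borel"
    then have bb: "bounded_borel (indicator (h -` S))" "bounded_borel (indicator (h -` T))"
      by (intro bounded_borel_indicator vi; simp)+
    have "(indicator (h -` (S \<inter> T)) :: real \<Rightarrow> real) = (\<lambda>x. indicator (h -` S) x * indicator (h -` T) x)"
      by (auto simp: fun_eq_iff indicator_def)
    then show "op (indicator (h -` (S \<inter> T))) = op (indicator (h -` S)) \<circ> op (indicator (h -` T))"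
      by (auto simp only: op_mult[OF bb] o_apply intro!: ext)
  next
    fix S :: "nat \<Rightarrow> real set" and u assume S: "range S \<subseteq> sets borel" "disjoint_family S"
    have "disjoint_family (\<lambda>i. h -` S i)" using S(2) by (auto simp: disjoint_family_on_def)
    then show "(\<lambda>i. op (indicator (h -` S i)) u) sums op (indicator (h -` (\<Union>i. S i))) u"
      using indicator_sums[of "\<lambda>i. h -` S i" u] S(1) vi by (auto simp: vimage_UN)
  qed
qed

lemma scalar_spectral_measure_vimage:
  assumes [measurable]: "h \<in> borel_measurable borel"
  shows "scalar_spectral_measure (\<lambda>S. op (indicator (h -` S))) u = distr (\<mu> u) borel h"
proof -
  interpret finite_measure "\<mu> v" for v by (rule finite_\<mu>)
  have h: "h \<in> measurable (\<mu> u) borel" by (simp add: measurable_\<mu>)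
  have "ennreal (Re (cinner u (op (indicator (h -` S)) u))) = emeasure (distr (\<mu> u) borel h) S"
    if S: "S \<in> sets borel" for S
  proof -
    have "h -` S \<in> sets borel" using measurable_sets_borel[OF assms S] by simp
    then have "Re (cinner u (op (indicator (h -` S)) u)) = measure (\<mu> u) (h -` S)"
      by (simp add: inner_cinner[symmetric] inner_op[OF bounded_borel_indicator])
    then show ?thesis using S h by (simp add: emeasure_distr emeasure_eq_measure)
  qed
  then have "scalar_spectral_measure (\<lambda>S. op (indicator (h -` S))) u
      = measure_of UNIV (sets borel) (emeasure (distr (\<mu> u) borel h))"
    unfolding scalar_spectral_measure_def
    by (intro measure_of_eq) (auto simp: sets.sigma_sets_eq[of borel, simplified])
  also have "\<dots> = distr (\<mu> u) borel h"
    using measure_of_of_measure[of "distr (\<mu> u) borel h"] by simp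
  finally show ?thesis .
qed

end

text \<open>Two passes, because each extension keeps one symbol fixed. Products of polynomials start
  the pair (polynomial, polynomial), which extends to (polynomial, Borel); exchanging the roles
  gives (Borel, polynomial), and the same extension ends at (Borel, Borel).\<close>

lemma (in positive_contraction) borel_calculus_exists:
  "\<exists>\<mu>. borel_calculus \<mu> \<and> (\<forall>u. AE x in \<mu> u. x \<in> {0..1}) \<and> borel_calculus.op \<mu> unit_clamp = B"
proof -
  have "\<forall>u. \<exists>M. sets M = sets (borel :: real measure) \<and> finite_measure M \<and> (AE x in M. x \<in> {0..1}) \<and>
      (\<forall>p. (\<integral>x. poly p (unit_clamp x) \<partial>M) = inner u (P p u))"
    using moment_measure by blast
  from choice[OF this] obtain \<mu> where \<mu>: "\<And>u. sets (\<mu> u) = sets (borel :: real measure)"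
    "\<And>u. finite_measure (\<mu> u)" "\<And>u. AE x in \<mu> u. x \<in> {0..1}"
    "\<And>u p. (\<integral>x. poly p (unit_clamp x) \<partial>\<mu> u) = inner u (P p u)"
    by blast
  have space: "space (\<mu> u) = UNIV" for u using sets_eq_imp_space_eq[OF \<mu>(1)] by simp
  interpret measure_family \<mu>
  proof (rule measure_family.intro)
    show "measure (\<mu> u) UNIV = (norm u)\<^sup>2" for u
      using \<mu>(4)[of u 1] by (simp add: P_one power2_norm_eq_inner space)
  qed (rule \<mu>)+
  have bb: "bounded_borel (\<lambda>x. poly p (unit_clamp x))" for p
  proof -
    have "continuous_on {0..1} (poly p)" by (intro continuous_intros)
    then show ?thesis
      unfolding bounded_borel_def
      using bounded_continuous_unit_clamp borel_measurable_continuous_onI[OF continuous_comp_unit_clamp] by blast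
  qed
  have rep: "represents (\<lambda>x. poly p (unit_clamp x)) (P p)" for p
    by (simp add: represents_def symmetric_P \<mu>(4))
  have mult_poly: "multiplies (\<lambda>x. poly p (unit_clamp x)) (P p) (\<lambda>x. poly q (unit_clamp x)) (P q)" for p q
    using rep[of "p * q"] ext[of "P (p * q)" "\<lambda>u. P p (P q u)", OF P_mult] by (simp add: multiplies_def rep)
  have poly_all: "\<exists>T. multiplies (\<lambda>x. poly p (unit_clamp x)) (P p) \<gamma> T" if "bounded_borel \<gamma>" for p \<gamma>
    by (rule multiplies_borel[OF bb rep that], rule multiplies_indicator_of_polys[OF bb rep \<mu>(3)])
      (use mult_poly in blast)+
  have "borel_calculus \<mu>"
  proof unfold_locales
    show "\<exists>T. represents \<phi> T" if "bounded_borel \<phi>" for \<phi>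
      using poly_all[OF that] by (auto simp: multiplies_def)
    fix \<phi> \<gamma> S assume \<phi>: "bounded_borel \<phi>" and \<gamma>: "bounded_borel \<gamma>" and S: "represents \<phi> S"
    have "\<exists>T. multiplies \<phi> S (\<lambda>x. poly p (unit_clamp x)) T" for p
    proof -
      obtain T where "multiplies (\<lambda>x. poly p (unit_clamp x)) (P p) \<phi> T" using poly_all[OF \<phi>] by blast
      moreover from this have "T = S" using represents_unique[OF _ S] by (simp add: multiplies_def)
      ultimately show ?thesis using multiplies_commute[OF rep] by blast
    qed
    then show "\<exists>T. multiplies \<phi> S \<gamma> T"
      by (intro multiplies_borel[OF \<phi> S \<gamma>] multiplies_indicator_of_polys[OF \<phi> S \<mu>(3)])
  qed
  moreover have "borel_calculus.op \<mu> unit_clamp = B"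
  proof -
    have "represents unit_clamp (P X)" using rep[of X] by (simp add: poly_X)
    then show ?thesis using borel_calculus.op_eqI[OF \<open>borel_calculus \<mu>\<close>] by (simp add: P_X fun_eq_iff)
  qed
  ultimately show ?thesis using \<mu>(3) by blast
qed

section \<open>Transfer from the inverse of H + 1 to H\<close>

lemma positive_operator_inner:
  assumes "positive_operator H" "u \<in> dom H"
  shows "0 \<le> inner u (H \<cdot> u)" "Im (cinner u (H \<cdot> u)) = 0" "u \<noteq> 0 \<Longrightarrow> 0 < inner u (H \<cdot> u)"
proof -
  show "u \<noteq> 0 \<Longrightarrow> 0 < inner u (H \<cdot> u)"
    using assms by (auto simp: positive_operator_def inner_cinner)
  then show "0 \<le> inner u (H \<cdot> u)" by (cases "u = 0") auto
  show "Im (cinner u (H \<cdot> u)) = 0"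
    using assms by (cases "u = 0") (auto simp: positive_operator_def complex_is_Real_iff)
qed

text \<open>Nonnegativity of \<open>H\<close> bounds H + 1 from below by 1, which gives injectivity,
  closed range and a trivial cokernel at once.\<close>

lemma positive_operator_shift_inverse:
  fixes H :: "'a::complex_hilbert_space \<rightharpoonup> 'a"
  assumes H: "self_adjoint H" and pos: "positive_operator H"
  obtains B where "positive_contraction B" "\<And>v. B v \<in> dom H" "\<And>v. H \<cdot> B v = v - B v"
    "\<And>u. u \<in> dom H \<Longrightarrow> B (H \<cdot> u + u) = u"
proof -
  note lin = self_adjoint_linear[OF H]
  have lower: "(norm u)\<^sup>2 \<le> inner u (H \<cdot> u + u)" if "u \<in> dom H" for u
    using positive_operator_inner(1)[OF pos that] by (simp add: inner_add_right power2_norm_eq_inner)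
  have norm_lower: "norm u \<le> norm (H \<cdot> u + u)" if "u \<in> dom H" for u
  proof -
    have "norm u * norm u \<le> norm u * norm (H \<cdot> u + u)"
      using lower[OF that] norm_cauchy_schwarz[of u "H \<cdot> u + u"] by (simp add: power2_eq_square)
    then show ?thesis by (cases "u = 0") auto
  qed
  have "\<exists>u\<in>dom H. H \<cdot> u - (-1) *\<^sub>C u = v" for v
  proof (rule self_adjoint_shift_surj[OF H, of 1])
    show "1 * norm u \<le> norm (H \<cdot> u - (-1) *\<^sub>C u)" if "u \<in> dom H" for u
      using norm_lower[OF that] by simp
    show "u = 0" if "u \<in> dom H" "H \<cdot> u = cnj (- 1) *\<^sub>C u" for u
      using norm_lower[OF that(1)] that(2) by simp
  qed simp
  then have "\<forall>v. \<exists>u. u \<in> dom H \<and> H \<cdot> u + u = v"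
    unfolding scaleC_minus_left scaleC_one diff_minus_eq_add Bex_def by blast
  from choice[OF this] obtain B where B: "\<And>v. B v \<in> dom H" "\<And>v. H \<cdot> B v + B v = v" by blast
  have unique: "B v = u" if "u \<in> dom H" "H \<cdot> u + u = v" for u v
  proof -
    have "norm (B v - u) \<le> norm (H \<cdot> (B v - u) + (B v - u))"
      by (rule norm_lower) (simp add: linear_operator_diff[OF lin] B that)
    also have "H \<cdot> (B v - u) + (B v - u) = (H \<cdot> B v + B v) - (H \<cdot> u + u)"
      by (simp add: linear_operator_diff[OF lin] B(1) that(1))
    finally show ?thesis by (simp add: B(2) that(2))
  qed
  have B_add: "B (x + y) = B x + B y" for x y
  proof (rule unique)
    show "B x + B y \<in> dom H" by (rule linear_operatorD(2)[OF lin B(1) B(1)])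
    have "H \<cdot> (B x + B y) + (B x + B y) = (H \<cdot> B x + B x) + (H \<cdot> B y + B y)"
      by (simp add: linear_operatorD(3)[OF lin B(1) B(1)])
    then show "H \<cdot> (B x + B y) + (B x + B y) = x + y" by (simp add: B(2))
  qed
  have B_scale: "B (a *\<^sub>C x) = a *\<^sub>C B x" for a x
  proof (rule unique)
    show "a *\<^sub>C B x \<in> dom H" by (rule linear_operatorD(4)[OF lin B(1)])
    have "H \<cdot> (a *\<^sub>C B x) + a *\<^sub>C B x = a *\<^sub>C (H \<cdot> B x + B x)"
      by (simp add: linear_operatorD(5)[OF lin B(1)] scaleC_add_right)
    then show "H \<cdot> (a *\<^sub>C B x) + a *\<^sub>C B x = a *\<^sub>C x" by (simp add: B(2))
  qed
  have B_sym: "inner (B x) y = inner x (B y)" for x y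
  proof -
    have "cinner (B x) (H \<cdot> B y + B y) = cinner (H \<cdot> B x + B x) (B y)"
      by (simp add: cinner_add_left cinner_add_right self_adjoint_symmetric[OF H B(1) B(1)])
    then show ?thesis by (simp add: B(2) inner_cinner)
  qed
  \<comment> \<open>The lower bound evaluated at \<open>B u\<close> is exactly the defining
    inequality of a positive contraction.\<close>
  have sq: "(norm (B u))\<^sup>2 \<le> inner u (B u)" for u
    using lower[OF B(1)[of u]] by (simp add: B(2) inner_commute)
  have "clinear B" by (simp add: clinear_def B_add B_scale)
  moreover have "bounded_linear B"
  proof (rule bounded_linear_intro[OF B_add, of 1])
    show "norm (B x) \<le> norm x * 1" for x using norm_lower[OF B(1)[of x]] by (simp add: B(2))
  qed (simp add: scaleR_scaleC B_scale)
  ultimately have "positive_contraction B"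
    by (intro positive_contraction.intro symmetric_opI B_sym sq)
  moreover have "H \<cdot> B v = v - B v" for v using B(2)[of v] by (simp add: eq_diff_eq)
  ultimately show ?thesis
    by (rule that[OF _ B(1) _ unique[OF _ refl]])
qed

text \<open>The spectral measure of the inverse \<open>B\<close> of H + 1 is carried over by h(x) =
  1/x - 1. Besides the values of the form, the equality of the domain of \<open>H\<close> with the
  set where the square of h is integrable has to be shown in both directions.\<close>

theorem spectral_theorem_positive:
  fixes H :: "'a::complex_hilbert_space \<rightharpoonup> 'a"
  assumes H: "self_adjoint H" and pos: "positive_operator H"
  shows "\<exists>E. projection_valued_measure E \<and> is_spectral_integral E complex_of_real H"
proof -
  obtain B where "positive_contraction B" and B_dom: "\<And>v. B v \<in> dom H" and H_B: "\<And>v. H \<cdot> B v = v - B v"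
    and B_left: "\<And>u. u \<in> dom H \<Longrightarrow> B (H \<cdot> u + u) = u"
    using positive_operator_shift_inverse[OF H pos] by metis
  interpret PC: positive_contraction B by fact
  obtain \<mu> where "borel_calculus \<mu>" and supp: "\<And>u. AE x in \<mu> u. x \<in> {0..1}"
    and op_B: "borel_calculus.op \<mu> unit_clamp = B"
    using PC.borel_calculus_exists by blast
  interpret borel_calculus \<mu> by fact
  interpret finite_measure "\<mu> u" for u by (rule finite_\<mu>)
  have bb: "bounded_borel unit_clamp"
    by (rule bounded_borelI[of _ 1]) (auto simp: abs_le_iff intro: unit_clamp_bounds order_trans[OF _ unit_clamp_bounds(1)])
  have bb0: "bounded_borel (indicator {0})" by (rule bounded_borel_indicator) simp
  \<comment> \<open>0 is not an eigenvalue of \<open>B\<close>, since \<open>B v = 0\<close> forces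
    \<open>v = H \<cdot> 0\<close>; the singular point of h thus carries no mass.\<close>
  have AE_pos: "AE x in \<mu> u. x \<in> {0<..1}" for u
  proof -
    have zero: "(\<lambda>x. unit_clamp x * indicator {0} x) = (\<lambda>x. 0 * 1)"
      by (auto simp: indicator_def unit_clamp_def fun_eq_iff)
    have "B (op (indicator {0}) u) = 0"
      using op_mult[OF bb bb0, of u] op_scale[of "\<lambda>x. 1" 0 u] unfolding op_B zero by simp
    then have "op (indicator {0}) u = 0"
      using H_B[of "op (indicator {0}) u"] linear_operator_zero[OF self_adjoint_linear[OF H]] by simp
    then have "measure (\<mu> u) {0} = 0"
      using inner_op[OF bb0, of u] by simp
    then have "AE x in \<mu> u. x \<notin> {0}"
      by (intro AE_not_in null_setsI) (simp_all add: emeasure_eq_measure)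
    with supp[of u] show ?thesis by eventually_elim auto
  qed
  define h :: "real \<Rightarrow> real" where "h x = 1 / x - 1" for x
  have h_meas: "h \<in> borel_measurable borel" unfolding h_def by measurable
  then have h_meas_\<mu>: "h \<in> measurable (\<mu> u) borel" for u by (simp add: measurable_\<mu>)
  define E where "E S = op (indicator (h -` S))" for S
  have E_\<mu>: "scalar_spectral_measure E u = distr (\<mu> u) borel h" for u
    unfolding E_def[abs_def] by (rule scalar_spectral_measure_vimage[OF h_meas])
  have clamp_h: "unit_clamp x * h x = 1 - unit_clamp x" if "x \<in> {0<..1}" for x
    using that by (simp add: unit_clamp_id h_def field_simps)
  have density_B: "\<mu> (B v) = density (\<mu> v) (\<lambda>x. ennreal ((unit_clamp x)\<^sup>2))" for v
    using measure_op_eq_density[OF bb, of v] by (simp add: op_B)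
  have bb1: "bounded_borel (\<lambda>x. 1 - unit_clamp x)" by (rule bounded_borel_diff[OF _ bb]) simp
  \<comment> \<open>Writing \<open>u = B v\<close> gives the measure of \<open>u\<close> the density
    \<open>unit_clamp\<^sup>2\<close>, which cancels the singularity of h at 0.\<close>
  have domain: "integrable (\<mu> u) (\<lambda>x. (h x)\<^sup>2)" if "u \<in> dom H" for u
  proof -
    define v where "v = H \<cdot> u + u"
    have u: "u = B v" using B_left[OF that] by (simp add: v_def)
    have "integrable (\<mu> v) (\<lambda>x. (unit_clamp x)\<^sup>2 * (h x)\<^sup>2)"
    proof (subst integrable_cong_AE)
      show "AE x in \<mu> v. (unit_clamp x)\<^sup>2 * (h x)\<^sup>2 = (1 - unit_clamp x) * (1 - unit_clamp x)"
        using AE_pos[of v] by eventually_elim (metis clamp_h power2_eq_square power_mult_distrib)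
      show "integrable (\<mu> v) (\<lambda>x. (1 - unit_clamp x) * (1 - unit_clamp x))"
        by (rule integrable_bounded_borel[OF bounded_borel_mult[OF bb1 bb1]])
    qed (use h_meas in \<open>auto simp: measurable_\<mu>\<close>)
    then show ?thesis
      unfolding u density_B using h_meas by (subst integrable_density) (auto simp: measurable_\<mu>)
  qed
  have in_domain: "u \<in> dom H" if int: "integrable (\<mu> u) (\<lambda>x. (h x)\<^sup>2)" for u
  proof -
    define C where "C = sqrt (\<integral>x. (h x)\<^sup>2 \<partial>\<mu> u)"
    \<comment> \<open>Bounded cut-offs of 1/x: \<open>r n x * x\<close> is an indicator for positive
      x, so \<open>r n\<close> inverts \<open>B\<close> on a spectral subspace. Multiplied by 1 - x
      it is h cut off, whose norm \<open>C\<close> controls.\<close>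
    define r where "r n x = (indicator {1 / Suc n..} x * (1 / x) :: real)" for n x
    have r_meas: "r n \<in> borel_measurable borel" for n unfolding r_def by measurable
    have r_bb: "bounded_borel (r n)" for n
    proof (rule bounded_borelI[OF r_meas])
      fix x show "\<bar>r n x\<bar> \<le> Suc n"
      proof (cases "1 / Suc n \<le> x")
        case True
        moreover have "0 < 1 / real (Suc n)" by simp
        ultimately have "0 < x" by linarith
        then show ?thesis using True by (simp add: r_def field_simps)
      qed (simp add: r_def)
    qed
    have bbr: "bounded_borel (\<lambda>x. r n x * (1 - unit_clamp x))" for n by (rule bounded_borel_mult[OF r_bb bb1])
    have le: "norm (op (\<lambda>x. r n x * (1 - unit_clamp x)) u) \<le> C" for n
      unfolding C_def
    proof (rule real_le_rsqrt, unfold norm_op[OF bbr], rule integral_mono_AE)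
      show "integrable (\<mu> u) (\<lambda>x. (r n x * (1 - unit_clamp x))\<^sup>2)"
        using integrable_bounded_borel[OF bounded_borel_mult[OF bbr bbr]] by (simp add: power2_eq_square)
      show "AE x in \<mu> u. (r n x * (1 - unit_clamp x))\<^sup>2 \<le> (h x)\<^sup>2"
        using AE_pos[of u]
        by eventually_elim (auto simp: r_def indicator_def h_def unit_clamp_id field_simps)
    qed (rule int)
    have bound: "cmod (cinner (H \<cdot> w) u - cinner w 0) \<le> C * norm w" if w: "w \<in> dom H" for w
    proof -
      define v where "v = H \<cdot> w + w"
      have wv: "w = B v" "H \<cdot> w = v - B v" using B_left[OF w] by (simp_all add: v_def)
      have op1: "op (\<lambda>x. 1 - unit_clamp x) v = v - B v"
        using op_diff[of "\<lambda>x. 1" unit_clamp v] bb by (simp add: op_one op_B)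
      have ind: "bounded_borel (indicator {1 / Suc n..})" for n by (rule bounded_borel_indicator) simp
      \<comment> \<open>\<open>H \<cdot> w = v - B v\<close> is rewritten, up to the cut-off, as a
        bounded operator applied to \<open>w = B v\<close>, so that only the norm of
        \<open>w\<close> enters the estimate.\<close>
      have rB: "op (indicator {1 / Suc n..}) (v - B v) = op (\<lambda>x. r n x * (1 - unit_clamp x)) (B v)" for n
      proof -
        have "op (indicator {1 / Suc n..}) (v - B v) = op (\<lambda>x. indicator {1 / Suc n..} x * (1 - unit_clamp x)) v"
          by (simp only: op_mult[OF ind bb1] op1)
        also have "\<dots> = op (\<lambda>x. r n x * (1 - unit_clamp x) * unit_clamp x) v"
        proof (rule fun_cong[OF op_cong_AE[OF bounded_borel_mult[OF ind bb1] bounded_borel_mult[OF bbr bb]]])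
          show "AE x in \<mu> u. indicator {1 / Suc n..} x * (1 - unit_clamp x) = r n x * (1 - unit_clamp x) * unit_clamp x" for u
            using AE_pos[of u] by eventually_elim (auto simp: r_def unit_clamp_id indicator_def)
        qed
        also have "\<dots> = op (\<lambda>x. r n x * (1 - unit_clamp x)) (B v)"
          by (simp add: op_mult[OF bbr bb] op_B)
        finally show ?thesis .
      qed
      have "cmod (cinner u (op (indicator {1 / Suc n..}) (v - B v))) \<le> C * norm w" for n
      proof -
        have "cinner u (op (indicator {1 / Suc n..}) (v - B v)) = cinner (op (\<lambda>x. r n x * (1 - unit_clamp x)) u) w"
          unfolding rB wv(1) by (simp add: symmetric_opD(3)[OF op_symmetric[OF bbr]])
        also have "cmod \<dots> \<le> norm (op (\<lambda>x. r n x * (1 - unit_clamp x)) u) * norm w" by (rule cmod_cinner_le)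
        also have "\<dots> \<le> C * norm w" by (rule mult_right_mono[OF le]) simp
        finally show ?thesis .
      qed
      moreover have "(\<lambda>n. cinner u (op (indicator {1 / Suc n..}) (v - B v))) \<longlonglongrightarrow> cinner u (op (\<lambda>x. 1) (v - B v))"
      proof (rule cinner_op_limit[where C = 1])
        show "AE x in \<mu> u. (\<lambda>n. indicator {1 / real (Suc n)..} x :: real) \<longlonglongrightarrow> 1" for u
          using AE_pos[of u]
        proof eventually_elim
          case (elim x)
          have "\<forall>\<^sub>F n in sequentially. 1 / real (Suc n) < x"
            using order_tendstoD(2)[OF LIMSEQ_Suc[OF lim_1_over_n]] elim by auto
          then show ?case by (intro tendsto_eventually) (auto elim!: eventually_mono)
        qed
      qed (auto simp: indicator_def)
      ultimately have "cmod (cinner u (v - B v)) \<le> C * norm w"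
        unfolding op_one by (intro Lim_norm_ubound[of sequentially]) auto
      then show ?thesis
        using wv(2) by (metis cinner_commute cinner_zero_right complex_mod_cnj diff_zero)
    qed
    show ?thesis
      by (rule self_adjoint_domI_bounded(1)[OF H _ bound]) (auto simp: C_def)
  qed
  have "is_spectral_integral E complex_of_real H"
    unfolding is_spectral_integral_def E_\<mu>
  proof (intro conjI ballI)
    show "linear_operator H" by (rule self_adjoint_linear[OF H])
    show "dom H = {u. integrable (distr (\<mu> u) borel h) (\<lambda>x. (cmod (complex_of_real x))\<^sup>2)}"
      using domain in_domain by (auto simp: integrable_distr_eq[OF h_meas_\<mu>])
    fix u assume u: "u \<in> dom H"
    define v where "v = H \<cdot> u + u"
    have uv: "u = B v" "H \<cdot> u = v - B v" using B_left[OF u] by (simp_all add: v_def)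
    have op1: "op (\<lambda>x. 1 - unit_clamp x) v = v - B v"
      using op_diff[of "\<lambda>x. 1" unit_clamp v] bb by (simp add: op_one op_B)
    have "(\<integral>x. complex_of_real x \<partial>distr (\<mu> u) borel h) = (\<integral>x. complex_of_real (h x) \<partial>\<mu> u)"
      by (rule integral_distr[OF h_meas_\<mu>]) simp
    also have "\<dots> = complex_of_real (\<integral>x. h x \<partial>\<mu> u)" by (rule integral_complex_of_real)
    also have "(\<integral>x. h x \<partial>\<mu> u) = (\<integral>x. (unit_clamp x)\<^sup>2 * h x \<partial>\<mu> v)"
      unfolding uv(1) density_B by (subst integral_density) (use h_meas in \<open>auto simp: measurable_\<mu>\<close>)
    also have "\<dots> = (\<integral>x. unit_clamp x * (1 - unit_clamp x) \<partial>\<mu> v)"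
    proof (rule integral_cong_AE)
      show "AE x in \<mu> v. (unit_clamp x)\<^sup>2 * h x = unit_clamp x * (1 - unit_clamp x)"
        using AE_pos[of v] by eventually_elim (metis clamp_h power2_eq_square mult.assoc)
    qed (use h_meas in \<open>auto simp: measurable_\<mu>\<close>)
    also have "\<dots> = inner v (B (v - B v))"
      using inner_op[OF bounded_borel_mult[OF bb bb1], of v] by (simp add: op_mult[OF bb bb1] op1 op_B)
    also have "\<dots> = inner u (H \<cdot> u)" unfolding uv(2) PC.B_adj[symmetric] uv(1)[symmetric] ..
    finally show "cinner u (H \<cdot> u) = (\<integral>x. complex_of_real x \<partial>distr (\<mu> u) borel h)"
      using positive_operator_inner(2)[OF pos u] by (simp add: complex_eq_iff inner_cinner)
  qed
  moreover have "projection_valued_measure E"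
    unfolding E_def[abs_def] by (rule projection_valued_measure_vimage[OF h_meas])
  ultimately show ?thesis by blast
qed

section \<open>Functional calculus of a spectral measure\<close>

lemma projection_valued_measureD:
  assumes "projection_valued_measure E"
  shows "B \<in> sets borel \<Longrightarrow> orthogonal_projection (E B)" "E UNIV = id"
    "B \<in> sets borel \<Longrightarrow> C \<in> sets borel \<Longrightarrow> E (B \<inter> C) = E B \<circ> E C"
    "range D \<subseteq> sets borel \<Longrightarrow> disjoint_family D \<Longrightarrow> (\<lambda>i::nat. E (D i) u) sums E (\<Union>i. D i) u"
  using assms unfolding projection_valued_measure_def by blast+

lemma symmetric_op_orthogonal_projection:
  assumes "orthogonal_projection P"
  shows "symmetric_op P" "inner u (P u) = (norm (P u))\<^sup>2"
proof -
  have P: "P (x + y) = P x + P y" "P (a *\<^sub>C x) = a *\<^sub>C P x" "P (P x) = P x" "cinner (P x) y = cinner x (P y)" for x y a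
    using assms unfolding orthogonal_projection_def by simp_all
  show sq: "inner u (P u) = (norm (P u))\<^sup>2" for u
    using P(4)[of u "P u"] by (simp add: P(3) power2_norm_eq_inner inner_cinner)
  have "norm (P u) \<le> norm u" for u
  proof -
    have "norm (P u) * norm (P u) \<le> norm u * norm (P u)"
      using sq[of u] norm_cauchy_schwarz[of u "P u"] by (simp add: power2_eq_square)
    then show ?thesis by (cases "P u = 0") auto
  qed
  then have "bounded_linear P"
    by (intro bounded_linear_intro[of P 1]) (simp_all add: P scaleR_scaleC)
  then show "symmetric_op P" by (simp add: symmetric_op_def clinear_def P)
qed

locale pvm =
  fixes E :: "real set \<Rightarrow> 'a::complex_hilbert_space \<Rightarrow> 'a"
  assumes pvm: "projection_valued_measure E"
begin

abbreviation \<mu> :: "'a \<Rightarrow> real measure" where "\<mu> \<equiv> scalar_spectral_measure E"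

lemma inner_E: "B \<in> sets borel \<Longrightarrow> inner u (E B u) = (norm (E B u))\<^sup>2"
  by (rule symmetric_op_orthogonal_projection(2)[OF projection_valued_measureD(1)[OF pvm]])

text \<open>A convergent series whose terms all equal \<open>E {} u\<close> has zero terms.\<close>

lemma E_empty: "E {} u = 0"
proof -
  have "(\<lambda>i::nat. E ((\<lambda>_. {}) i) u) sums E (\<Union>i::nat. (\<lambda>_. {}) i) u"
    by (rule projection_valued_measureD(4)[OF pvm]) (auto simp: disjoint_family_on_def)
  then have "(\<lambda>i::nat. E {} u) \<longlonglongrightarrow> 0" by (intro summable_LIMSEQ_zero) (auto simp: sums_iff)
  then show ?thesis using LIMSEQ_unique[OF tendsto_const] by blast
qed

text \<open>\<open>measure_of\<close> takes the prescribed values only once countable additivity is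
  known; it follows from strong additivity of \<open>E\<close> by continuity of the inner
  product.\<close>

lemma emeasure_\<mu>:
  assumes B: "B \<in> sets borel"
  shows "emeasure (\<mu> u) B = ennreal (inner u (E B u))"
proof (subst emeasure_measure_of[OF scalar_spectral_measure_def])
  have sets: "sets (\<mu> u) = sets borel"
    unfolding scalar_spectral_measure_def by (simp add: sets.sigma_sets_eq[of borel, simplified])
  show "positive (sets (\<mu> u)) (\<lambda>B. ennreal (Re (cinner u (E B u))))"
    by (simp add: positive_def E_empty)
  show "countably_additive (sets (\<mu> u)) (\<lambda>B. ennreal (Re (cinner u (E B u))))"
  proof (rule countably_additiveI)
    fix D :: "nat \<Rightarrow> real set" assume D: "range D \<subseteq> sets (\<mu> u)" "disjoint_family D"
    have "(\<lambda>i. inner u (E (D i) u)) sums inner u (E (\<Union>i. D i) u)"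
      using D sets by (intro bounded_linear.sums[OF bounded_linear_inner_right] projection_valued_measureD(4)[OF pvm]) auto
    moreover have "0 \<le> inner u (E (D i) u)" for i
      using D sets by (subst inner_E) auto
    ultimately show "(\<Sum>i. ennreal (Re (cinner u (E (D i) u)))) = ennreal (Re (cinner u (E (\<Union>i. D i) u)))"
      unfolding inner_cinner[symmetric] by (intro suminf_ennreal_eq)
  qed
qed (use B in \<open>auto simp: inner_cinner scalar_spectral_measure_def sets.sigma_sets_eq[of borel, simplified]\<close>)

text \<open>The same two passes as for polynomials, now started from pairs of indicators, where
  multiplicativity is part of the definition of a projection-valued measure.\<close>

sublocale borel_calculus \<mu>
proof -
  have sets: "sets (\<mu> u) = sets borel" for u
    unfolding scalar_spectral_measure_def by (simp add: sets.sigma_sets_eq[of borel, simplified])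
  have space: "space (\<mu> u) = UNIV" for u using sets_eq_imp_space_eq[OF sets] by simp
  have meas: "measure (\<mu> u) B = inner u (E B u)" if "B \<in> sets borel" for B u
    using that by (simp add: measure_def emeasure_\<mu> inner_E)
  interpret measure_family \<mu>
  proof (rule measure_family.intro)
    show "finite_measure (\<mu> u)" for u
      by (rule finite_measureI) (simp add: emeasure_\<mu> space)
    show "measure (\<mu> u) UNIV = (norm u)\<^sup>2" for u
      by (simp add: meas projection_valued_measureD(2)[OF pvm] power2_norm_eq_inner)
  qed (rule sets)
  have rep: "represents (indicator B) (E B)" if B: "B \<in> sets borel" for B
    using symmetric_op_orthogonal_projection(1)[OF projection_valued_measureD(1)[OF pvm B]] B
    by (simp add: represents_def meas)
  have mult: "multiplies (indicator B) (E B) (indicator C) (E C)" if "B \<in> sets borel" "C \<in> sets borel" for B C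
  proof -
    have "(\<lambda>x. indicator B x * indicator C x) = (indicator (B \<inter> C) :: real \<Rightarrow> real)"
      by (auto simp: indicator_def fun_eq_iff)
    moreover have "(\<lambda>u. E B (E C u)) = E (B \<inter> C)"
      using projection_valued_measureD(3)[OF pvm that] by (simp add: o_def)
    ultimately show ?thesis using rep[of "B \<inter> C"] rep[of C] that by (simp add: multiplies_def)
  qed
  have ind: "\<exists>T. multiplies (indicator B) (E B) \<gamma> T" if "B \<in> sets borel" "bounded_borel \<gamma>" for B \<gamma>
    using multiplies_borel[OF bounded_borel_indicator[OF that(1)] rep[OF that(1)] that(2)] mult[OF that(1)] by blast
  show "borel_calculus \<mu>"
  proof (intro borel_calculus.intro borel_calculus_axioms.intro)
    show "measure_family \<mu>" by (rule measure_family_axioms)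
    show "\<exists>T. represents \<phi> T" if "bounded_borel \<phi>" for \<phi>
      using ind[of UNIV, OF _ that] by (auto simp: multiplies_def)
    fix \<phi> \<gamma> S assume \<phi>: "bounded_borel \<phi>" and \<gamma>: "bounded_borel \<gamma>" and S: "represents \<phi> S"
    have "\<exists>T. multiplies \<phi> S (indicator B) T" if B: "B \<in> sets borel" for B
    proof -
      obtain T where T: "multiplies (indicator B) (E B) \<phi> T" using ind[OF B \<phi>] by blast
      then have "T = S" using represents_unique[OF _ S] by (simp add: multiplies_def)
      then show ?thesis using multiplies_commute[OF rep[OF B] T] by blast
    qed
    then show "\<exists>T. multiplies \<phi> S \<gamma> T" by (rule multiplies_borel[OF \<phi> S \<gamma>])
  qed
qed

text \<open>This resolves the definite description in \<open>functional_calculus\<close>: a bounded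
  symbol forces the full space as domain, and there polarization leaves a single operator.\<close>

lemma is_spectral_integral_op:
  assumes \<phi>: "bounded_borel \<phi>"
  shows "is_spectral_integral E (\<lambda>x. complex_of_real (\<phi> x)) T \<longleftrightarrow> T = (\<lambda>u. Some (op \<phi> u))"
proof
  have int: "integrable (\<mu> u) (\<lambda>x. (cmod (complex_of_real (\<phi> x)))\<^sup>2)" for u
    using integrable_bounded_borel[OF bounded_borel_mult[OF \<phi> \<phi>]] by (simp add: power2_eq_square)
  note clin = clinearD[OF op_clinear[OF \<phi>]]
  show "is_spectral_integral E (\<lambda>x. complex_of_real (\<phi> x)) T" if "T = (\<lambda>u. Some (op \<phi> u))"
    unfolding that is_spectral_integral_def linear_operator_def
    using int by (auto simp: app_def dom_def clin cinner_op[OF \<phi>])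
  assume T: "is_spectral_integral E (\<lambda>x. complex_of_real (\<phi> x)) T"
  then have lin: "linear_operator T" and dom: "dom T = UNIV"
    using int by (auto simp: is_spectral_integral_def)
  have eq: "cinner u (T \<cdot> u) = cinner u (op \<phi> u)" for u
    using T dom by (simp add: is_spectral_integral_def cinner_op[OF \<phi>])
  have "T \<cdot> u = op \<phi> u" for u
  proof (rule dense_cinner_unique[of UNIV])
    fix v
    have "T \<cdot> (x + y) = T \<cdot> x + T \<cdot> y" "T \<cdot> (a *\<^sub>C x) = a *\<^sub>C (T \<cdot> x)" for x y a
      by (simp_all add: linear_operatorD[OF lin] dom)
    from cinner_polarization[of "\<lambda>u. T \<cdot> u" v u, OF this]
    have "4 * cinner v (T \<cdot> u) = 4 * cinner v (op \<phi> u)"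
      unfolding eq cinner_polarization[of "op \<phi>" v u, OF clin(1,2)] .
    then show "cinner v (T \<cdot> u) = cinner v (op \<phi> u)" by simp
  qed simp
  moreover have "T u = Some (T \<cdot> u)" for u
    using dom by (metis UNIV_I app_def domIff option.collapse)
  ultimately show "T = (\<lambda>u. Some (op \<phi> u))" by (simp add: fun_eq_iff)
qed

end

locale positive_self_adjoint =
  fixes H :: "'a::complex_hilbert_space \<rightharpoonup> 'a"
  assumes self_adjoint_H: "self_adjoint H" and positive_H: "positive_operator H"
begin

text \<open>The choice operator hides the construction. From here on only the two defining
  properties of the chosen measure are available, so its support and the symbol of the inverse of H
  + 1 are derived from them.\<close>

lemma spectral_measure_H:
  "projection_valued_measure (spectral_measure H)"
  "is_spectral_integral (spectral_measure H) complex_of_real H"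
  using someI_ex[OF spectral_theorem_positive[OF self_adjoint_H positive_H]]
  unfolding spectral_measure_def by blast+

sublocale pvm "spectral_measure H"
  by (rule pvm.intro[OF spectral_measure_H(1)])

lemma functional_calculus_op:
  assumes "bounded_borel \<phi>"
  shows "functional_calculus (\<lambda>x. complex_of_real (\<phi> x)) H \<cdot> f = op \<phi> f"
  unfolding functional_calculus_def is_spectral_integral_op[OF assms] by (simp add: app_def)

lemma linear_H: "linear_operator H"
  by (rule self_adjoint_linear[OF self_adjoint_H])

lemma dom_H_iff: "u \<in> dom H \<longleftrightarrow> integrable (\<mu> u) (\<lambda>x. x\<^sup>2)"
  using spectral_measure_H(2) by (auto simp: is_spectral_integral_def)

lemma cinner_H: "u \<in> dom H \<Longrightarrow> cinner u (H \<cdot> u) = (\<integral>x. x \<partial>\<mu> u)"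
  using spectral_measure_H(2) by (simp add: is_spectral_integral_def)

text \<open>The spectral part \<open>v\<close> of \<open>u\<close> over a bounded set of nonpositive
  numbers lies in \<open>dom H\<close> and has a nonpositive form, which strict positivity allows
  only for \<open>v = 0\<close>.\<close>

lemma AE_not_in_nonpos: "AE x in \<mu> u. x \<notin> {- real n..0}"
proof -
    interpret finite_measure "\<mu> w" for w by (rule finite_\<mu>)
    define S where "S = {- real n..0}"
    have S: "S \<in> sets borel" by (simp add: S_def)
    note bb = bounded_borel_indicator[OF S]
    define v where "v = op (indicator S) u"
    have dens: "\<mu> v = density (\<mu> u) (\<lambda>x. ennreal ((indicator S x)\<^sup>2))"
      unfolding v_def by (rule measure_op_eq_density[OF bb])
    have "bounded_borel (\<lambda>x. (indicator S x)\<^sup>2 * x\<^sup>2)"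
    proof (rule bounded_borelI)
      show "\<bar>(indicator S x)\<^sup>2 * x\<^sup>2\<bar> \<le> (real n)\<^sup>2" for x
        by (auto simp: indicator_def S_def abs_le_square_iff[symmetric])
    qed (use S in measurable)
    then have "v \<in> dom H"
      unfolding dom_H_iff dens
      by (subst integrable_density) (use S in \<open>auto simp: measurable_\<mu> intro: integrable_bounded_borel\<close>)
    moreover have "(\<integral>x. x \<partial>\<mu> v) = (\<integral>x. (indicator S x)\<^sup>2 * x \<partial>\<mu> u)"
      unfolding dens by (subst integral_density) (use S in \<open>auto simp: measurable_\<mu>\<close>)
    moreover have "0 \<le> (\<integral>x. - ((indicator S x)\<^sup>2 * x) \<partial>\<mu> u)"
      by (rule integral_nonneg_AE) (auto simp: indicator_def S_def)
    ultimately have "v = 0"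
      using cinner_H[of v] positive_operator_inner(3)[OF positive_H, of v] by (auto simp: inner_cinner)
    then have "measure (\<mu> u) S = 0"
      using inner_op[OF bb, of u] S by (simp add: v_def)
    then show ?thesis
      unfolding S_def[symmetric] using S by (intro AE_not_in null_setsI) (simp_all add: emeasure_eq_measure)
  qed

lemma AE_positive: "AE x in \<mu> u. 0 < x"
proof -
  have "AE x in \<mu> u. \<forall>n. x \<notin> {- real n..0}"
    unfolding AE_all_countable using AE_not_in_nonpos by blast
  moreover have "(\<forall>n. x \<notin> {- real n..0}) \<longrightarrow> 0 < x" for x
  proof
    assume x: "\<forall>n. x \<notin> {- real n..0}"
    obtain n where "- x \<le> real n" using real_arch_simple by blast
    then show "0 < x" using x[rule_format, of n] by auto
  qed
  ultimately show ?thesis by (rule AE_mp[OF _ AE_I2])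
qed

text \<open>The symbol of the inverse of H + 1. The maximum keeps it bounded on the whole line; on
  the support, which is positive, it has no effect.\<close>

definition b :: "real \<Rightarrow> real" where "b x = 1 / (1 + max 0 x)"

lemma b_bounds: "0 < b x" "b x \<le> 1"
  by (auto simp: b_def)

lemma bounded_borel_b: "bounded_borel b"
proof (rule bounded_borelI[of _ 1])
  show "b \<in> borel_measurable borel" unfolding b_def by measurable
  show "\<bar>b x\<bar> \<le> 1" for x using b_bounds[of x] by simp
qed

text \<open>The spectral integral describes \<open>H\<close> on the diagonal of its domain only.
  Hence the defect of the claimed identity is multiplied by \<open>op b\<close> from the left: the
  resulting operator is defined everywhere with vanishing diagonal, so it is 0 by polarization, and
  \<open>op b\<close> is injective because \<open>b\<close> is positive.\<close>

lemma op_b: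
  shows "op b v \<in> dom H" "H \<cdot> op b v = v - op b v"
proof -
  interpret finite_measure "\<mu> w" for w by (rule finite_\<mu>)
  note bb = bounded_borel_b
  note [measurable] = bounded_borel_measurable[OF bb]
  have bb1: "bounded_borel (\<lambda>x. 1 - b x)" by (rule bounded_borel_diff[OF _ bb]) simp
  have b1: "op (\<lambda>x. 1 - b x) v = v - op b v" for v
    using op_diff[of "\<lambda>x. 1" b v] bb by (simp add: op_one)
  have dens: "\<mu> (op b v) = density (\<mu> v) (\<lambda>x. ennreal ((b x)\<^sup>2))" for v by (rule measure_op_eq_density[OF bb])
  have xb: "b x * x = 1 - b x" if "0 < x" for x using that by (simp add: b_def field_simps)
  show dom: "op b v \<in> dom H" for v
    unfolding dom_H_iff dens
  proof (subst integrable_density)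
    show "integrable (\<mu> v) (\<lambda>x. (b x)\<^sup>2 *\<^sub>R x\<^sup>2)"
    proof (subst integrable_cong_AE)
      show "AE x in \<mu> v. (b x)\<^sup>2 *\<^sub>R x\<^sup>2 = (1 - b x) * (1 - b x)"
        using AE_positive[of v] by eventually_elim (metis power_mult_distrib real_scaleR_def power2_eq_square xb)
      show "integrable (\<mu> v) (\<lambda>x. (1 - b x) * (1 - b x))"
        by (rule integrable_bounded_borel[OF bounded_borel_mult[OF bb1 bb1]])
    qed (auto simp: measurable_\<mu>)
  qed (auto simp: measurable_\<mu>)
  define D where "D v = op b (H \<cdot> op b v - (v - op b v))" for v
  note cl = clinearD[OF op_clinear[OF bb]]
  have quad: "cinner v (D v) = 0" for v
  proof -
    have "cinner (op b v) (H \<cdot> op b v) = (\<integral>x. x \<partial>\<mu> (op b v))" by (rule cinner_H[OF dom])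
    also have "(\<integral>x. x \<partial>\<mu> (op b v)) = (\<integral>x. (b x)\<^sup>2 * x \<partial>\<mu> v)"
      unfolding dens by (subst integral_density) (auto simp: measurable_\<mu>)
    also have "\<dots> = (\<integral>x. b x * (1 - b x) \<partial>\<mu> v)"
    proof (rule integral_cong_AE)
      show "AE x in \<mu> v. (b x)\<^sup>2 * x = b x * (1 - b x)"
        using AE_positive[of v] by eventually_elim (metis mult.assoc power2_eq_square xb)
    qed (auto simp: measurable_\<mu>)
    also have "complex_of_real \<dots> = cinner v (op b (v - op b v))"
      using cinner_op[OF bounded_borel_mult[OF bb bb1], of v] by (simp add: op_mult[OF bb bb1] b1)
    also have "\<dots> = cinner (op b v) (v - op b v)" by (simp add: symmetric_opD(3)[OF op_symmetric[OF bb]])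
    finally show ?thesis
      by (simp add: D_def symmetric_opD(3)[OF op_symmetric[OF bb], symmetric] cinner_diff_right)
  qed
  define G where "G v = H \<cdot> op b v - (v - op b v)" for v
  have D_G: "D v = op b (G v)" for v by (simp add: D_def G_def)
  have "G (x + y) = G x + G y" "G (a *\<^sub>C x) = a *\<^sub>C G x" for x y a
    by (simp_all add: G_def cl(1,2) linear_operatorD[OF linear_H] dom scaleC_diff_right)
  then have D_add: "D (x + y) = D x + D y" and D_scale: "D (a *\<^sub>C x) = a *\<^sub>C D x" for x y a
    by (simp_all add: D_G cl(1,2))
  have "D v = 0"
  proof (rule dense_cinner_unique[of UNIV])
    fix w
    have "4 * cinner w (D v) = 0"
      by (subst cinner_polarization[OF D_add D_scale]) (simp add: quad)
    then show "cinner w (D v) = cinner w 0" by simp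
  qed simp
  moreover have "w = 0" if "op b w = 0" for w
  proof -
    have "(\<integral>x. (b x)\<^sup>2 \<partial>\<mu> w) = 0" using norm_op[OF bb, of w] that by simp
    then have "AE x in \<mu> w. (b x)\<^sup>2 = 0"
      using integrable_bounded_borel[OF bounded_borel_mult[OF bb bb], of w]
      by (subst (asm) integral_nonneg_eq_0_iff_AE) (auto simp: power2_eq_square)
    moreover have "AE x in \<mu> w. (b x)\<^sup>2 \<noteq> 0" using b_bounds(1) by (simp add: less_imp_neq[symmetric])
    ultimately have "AE x in \<mu> w. False" by eventually_elim simp
    then have "emeasure (\<mu> w) UNIV = 0" using AE_iff_measurable[of UNIV "\<mu> w" "\<lambda>_. False"] by simp
    then show "w = 0" using total_\<mu>[of w] by (simp add: measure_def)
  qed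
  ultimately show "H \<cdot> op b v = v - op b v" unfolding D_def by (metis right_minus_eq)
qed

end

section \<open>Commutators with a conjugate operator\<close>

locale conjugate_operator = positive_self_adjoint +
  fixes A :: "'a \<rightharpoonup> 'a" and c :: real
  assumes self_adjoint_A: "self_adjoint A" and C1_H: "C1_class A H"
    and commutation: "commutation_relation H A c"
begin

lemma linear_A: "linear_operator A"
  by (rule self_adjoint_linear[OF self_adjoint_A])

abbreviation B :: "'a \<Rightarrow> 'a" where "B \<equiv> op b"

lemmas B_clinear = clinearD[OF op_clinear[OF bounded_borel_b]]

lemma B_left: assumes u: "u \<in> dom H" shows "B (H \<cdot> u + u) = u"
proof -
  define w where "w = B (H \<cdot> u + u) - u"
  have w: "w \<in> dom H" unfolding w_def by (rule linear_operator_diff(1)[OF linear_H op_b(1) u])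
  have "H \<cdot> w = - w"
    unfolding w_def linear_operator_diff(2)[OF linear_H op_b(1) u] op_b(2) by simp
  then have "(norm w)\<^sup>2 \<le> 0"
    using positive_operator_inner(1)[OF positive_H w] by (simp add: power2_norm_eq_inner)
  then have "w = 0" by simp
  then show ?thesis by (simp add: w_def)
qed

text \<open>The form of the symmetric \<open>A\<close> is real, so the imaginary part of the shifted
  form is -\<eta> times the squared norm. Both signs of \<eta> occur: one for the lower bound, the
  other for the kernel of the adjoint.\<close>

lemma A_shift_lower:
  assumes "u \<in> dom A" shows "\<bar>\<eta>\<bar> * norm u \<le> norm (A \<cdot> u - (\<i> * complex_of_real \<eta>) *\<^sub>C u)"
proof -
  have "Im (cinner u (A \<cdot> u)) = 0"
    using self_adjoint_symmetric[OF self_adjoint_A assms assms] cinner_commute[of u "A \<cdot> u"]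
    by (metis cnj.sel(2) equal_neg_zero)
  then have "\<bar>\<eta>\<bar> * (norm u)\<^sup>2 = \<bar>Im (cinner u (A \<cdot> u - (\<i> * complex_of_real \<eta>) *\<^sub>C u))\<bar>"
    by (simp add: cinner_diff_right cinner_scaleC_right cinner_self abs_mult flip: of_real_power)
  also have "\<dots> \<le> norm u * norm (A \<cdot> u - (\<i> * complex_of_real \<eta>) *\<^sub>C u)"
    using abs_Im_le_cmod cmod_cinner_le order_trans by blast
  finally have "norm u * (\<bar>\<eta>\<bar> * norm u) \<le> norm u * norm (A \<cdot> u - (\<i> * complex_of_real \<eta>) *\<^sub>C u)"
    by (simp add: power2_eq_square mult_ac)
  then show ?thesis by (cases "u = 0") auto
qed

lemma A_shift_surj:
  assumes "0 < \<eta>" shows "\<exists>u\<in>dom A. A \<cdot> u - (\<i> * complex_of_real \<eta>) *\<^sub>C u = v"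
proof (rule self_adjoint_shift_surj[OF self_adjoint_A assms])
  show "\<eta> * norm u \<le> norm (A \<cdot> u - (\<i> * complex_of_real \<eta>) *\<^sub>C u)" if "u \<in> dom A" for u
    using A_shift_lower[OF that, of \<eta>] assms by simp
  show "u = 0" if "u \<in> dom A" "A \<cdot> u = cnj (\<i> * complex_of_real \<eta>) *\<^sub>C u" for u
    using A_shift_lower[OF that(1), of "- \<eta>"] assms that(2) by (simp add: mult_le_0_iff)
qed

text \<open>Continuity at the origin bounds the form on a small ball, and homogeneity spreads the
  bound to all of \<open>dom A\<close>.\<close>

lemma sesquilinear_bound:
  assumes cont: "continuous_on (dom A \<times> dom A) (\<lambda>(u, v). q u v)"
    and scale: "\<And>r s u v. u \<in> dom A \<Longrightarrow> v \<in> dom A \<Longrightarrow> q (r *\<^sub>R u) (s *\<^sub>R v) = complex_of_real (r * s) * q u v"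
  shows "\<exists>C\<ge>0. \<forall>u\<in>dom A. \<forall>v\<in>dom A. cmod (q u v) \<le> C * norm u * norm v"
proof -
  have 0: "0 \<in> dom A" by (rule linear_operatorD(1)[OF linear_A])
  have q0: "q 0 0 = 0" using scale[OF 0 0, of 0 0] by simp
  have "(0, 0) \<in> dom A \<times> dom A" using 0 by blast
  then obtain d where d0: "d > 0" "\<forall>x\<in>dom A \<times> dom A. dist x (0, 0) < d \<longrightarrow>
      dist (case x of (u, v) \<Rightarrow> q u v) (case (0, 0) of (u, v) \<Rightarrow> q u v) < 1"
    using cont[unfolded continuous_on_iff] zero_less_one by blast
  have d: "d > 0" "\<And>u v. u \<in> dom A \<Longrightarrow> v \<in> dom A \<Longrightarrow> norm (u, v) < d \<Longrightarrow> cmod (q u v) < 1"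
  proof -
    fix u v assume "u \<in> dom A" "v \<in> dom A" "norm (u, v) < d"
    then show "cmod (q u v) < 1"
      using d0(2)[rule_format, of "(u, v)"] unfolding split dist_norm q0 by simp
  qed (rule d0(1))
  have "cmod (q u v) \<le> 9 / d\<^sup>2 * norm u * norm v" if u: "u \<in> dom A" and v: "v \<in> dom A" for u v
  proof (cases "u = 0 \<or> v = 0")
    case True
    then have "q u v = 0" using scale[OF u v, of 0 1] scale[OF u v, of 1 0] by auto
    then show ?thesis by simp
  next
    case False
    \<comment> \<open>Both components receive norm \<open>d / 3\<close>, so the pair stays within
      distance \<open>d\<close>; \<open>1 / (r * s)\<close> yields the factor
      \<open>9 / d\<^sup>2\<close>.\<close>
    define r s where "r = d / (3 * norm u)" and "s = d / (3 * norm v)"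
    have rs: "r > 0" "s > 0" using False d by (auto simp: r_def s_def)
    have "norm (r *\<^sub>R u, s *\<^sub>R v) \<le> norm (r *\<^sub>R u) + norm (s *\<^sub>R v)" by (rule norm_Pair_le)
    also have "\<dots> = d / 3 + d / 3" using False d by (simp add: r_def s_def)
    also have "\<dots> < d" using d by simp
    finally have "cmod (q (r *\<^sub>R u) (s *\<^sub>R v)) < 1"
      by (intro d(2) linear_operator_scaleR[OF linear_A] u v)
    then have "r * s * cmod (q u v) < 1" using rs by (simp add: scale[OF u v] norm_mult)
    then show ?thesis using False d by (simp add: r_def s_def field_simps power2_eq_square)
  qed
  then show ?thesis using d by (intro exI[of _ "9 / d\<^sup>2"]) auto
qed

text \<open>Writing \<open>S = 1 + (z + 1) R\<close> with \<open>R = (H - z)\<^sup>-\<^sup>1\<close>, one has \<open>B = R T\<close> for \<open>T = S\<^sup>-\<^sup>1\<close>. That \<open>T\<close> preserves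
  \<open>D(A)\<close> follows from \<open>T J (1 + K J T) = J T\<close>, where \<open>J = (A - i \<eta>)\<^sup>-\<^sup>1\<close> and \<open>K = [A, S]\<close>: for large
  \<open>\<eta>\<close> the factor \<open>1 + K J T\<close> is onto, so \<open>T\<close> maps the range of \<open>J\<close> into itself.\<close>

lemma B_dom_A:
  assumes v: "v \<in> dom A" shows "B v \<in> dom A"
proof -
  obtain z where z: "z \<in> resolvent_set H" and C1: "C1_bounded A (resolvent H z)"
    using C1_H unfolding C1_class_def by blast
  define R where "R = resolvent H z"
  have ex1: "\<exists>!u. u \<in> dom H \<and> H \<cdot> u - z *\<^sub>C u = v" for v
    using z unfolding resolvent_set_def by blast
  have R: "R v \<in> dom H" "H \<cdot> R v - z *\<^sub>C R v = v" for v
    using theI'[OF ex1[of v]] unfolding R_def resolvent_def by blast+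
  have R_eqI: "R v = u" if "u \<in> dom H" "H \<cdot> u - z *\<^sub>C u = v" for u v
    using ex1[of v] R[of v] that by blast
  have R_add: "R (x + y) = R x + R y" for x y
  proof (rule R_eqI)
    show "R x + R y \<in> dom H" by (rule linear_operatorD(2)[OF linear_H R(1) R(1)])
    have "H \<cdot> (R x + R y) - z *\<^sub>C (R x + R y) = (H \<cdot> R x - z *\<^sub>C R x) + (H \<cdot> R y - z *\<^sub>C R y)"
      by (simp add: linear_operatorD(3)[OF linear_H R(1) R(1)] scaleC_add_right)
    then show "H \<cdot> (R x + R y) - z *\<^sub>C (R x + R y) = x + y" by (simp add: R(2))
  qed
  have R_scale: "R (a *\<^sub>C x) = a *\<^sub>C R x" for a x
  proof (rule R_eqI)
    show "a *\<^sub>C R x \<in> dom H" by (rule linear_operatorD(4)[OF linear_H R(1)])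
    have "H \<cdot> (a *\<^sub>C R x) - z *\<^sub>C a *\<^sub>C R x = a *\<^sub>C (H \<cdot> R x - z *\<^sub>C R x)"
      by (simp add: linear_operatorD(5)[OF linear_H R(1)] scaleC_diff_right scaleC_scaleC mult.commute)
    then show "H \<cdot> (a *\<^sub>C R x) - z *\<^sub>C a *\<^sub>C R x = a *\<^sub>C x" by (simp add: R(2))
  qed
  have R_clin: "clinear R" by (simp add: clinear_def R_add R_scale)
  note Rl = clinearD[OF R_clin]
  have "\<exists>C\<ge>0. \<forall>u\<in>dom A. \<forall>v\<in>dom A. cmod (cinner (A \<cdot> u) (R v) - cinner u (R (A \<cdot> v))) \<le> C * norm u * norm v"
  proof (rule sesquilinear_bound)
    show "continuous_on (dom A \<times> dom A) (\<lambda>(u, v). cinner (A \<cdot> u) (R v) - cinner u (R (A \<cdot> v)))"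
      using C1 by (simp add: C1_bounded_def R_def)
    show "cinner (A \<cdot> (r *\<^sub>R u)) (R (s *\<^sub>R v)) - cinner (r *\<^sub>R u) (R (A \<cdot> (s *\<^sub>R v)))
        = complex_of_real (r * s) * (cinner (A \<cdot> u) (R v) - cinner u (R (A \<cdot> v)))"
      if "u \<in> dom A" "v \<in> dom A" for r s u v
      using that by (simp add: linear_operator_scaleR[OF linear_A] Rl cinner_scaleR_left cinner_scaleR_right algebra_simps)
  qed
  then obtain C where C: "0 \<le> C" and C_bound: "\<And>u v. u \<in> dom A \<Longrightarrow> v \<in> dom A \<Longrightarrow>
      cmod (cinner (A \<cdot> u) (R v) - cinner u (R (A \<cdot> v))) \<le> C * norm u * norm v" by blast
  have bound': "cmod (cinner (A \<cdot> u) (R v) - cinner u (R (A \<cdot> v))) \<le> C * norm v * norm u"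
    if "v \<in> dom A" "u \<in> dom A" for u v
    using C_bound[OF that(2,1)] by (simp add: mult_ac)
  \<comment> \<open>Boundedness of the commutator form is the hypothesis of
    \<open>self_adjoint_domI_bounded\<close> with \<open>w = R (A \<cdot> v)\<close>; invariance of
    \<open>dom A\<close> and the norm bound come together.\<close>
  have R_dom: "R v \<in> dom A" "norm (A \<cdot> R v - R (A \<cdot> v)) \<le> C * norm v" if "v \<in> dom A" for v
    using self_adjoint_domI_bounded[OF self_adjoint_A _ bound'[OF that]] C by auto
  define k where "k = z + 1"
  define S where "S v = v + k *\<^sub>C R v" for v
  define T where "T v = v - k *\<^sub>C B v" for v
  have B_RT: "B v = R (T v)" for v
  proof (rule R_eqI[symmetric])
    have "H \<cdot> B v - z *\<^sub>C B v = v - (z *\<^sub>C B v + 1 *\<^sub>C B v)" by (simp add: op_b(2))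
    then show "H \<cdot> B v - z *\<^sub>C B v = T v" unfolding T_def k_def scaleC_add_left[symmetric] .
  qed (rule op_b(1))
  have ST: "S (T v) = v" for v unfolding S_def B_RT[symmetric] by (simp add: T_def)
  have TS: "T (S v) = v" for v
  proof -
    have "H \<cdot> R v + R v = S v"
      using R(2)[of v] by (simp add: S_def k_def scaleC_add_left diff_eq_eq)
    then have "B (S v) = R v" using B_left[OF R(1), of v] by simp
    then show ?thesis by (simp add: T_def S_def)
  qed
  define K where "K v = A \<cdot> S v - S (A \<cdot> v)" for v
  have S_dom: "S v \<in> dom A" if "v \<in> dom A" for v
    unfolding S_def by (intro linear_operatorD(2,4)[OF linear_A] R_dom that)
  have K_eq: "K v = k *\<^sub>C (A \<cdot> R v - R (A \<cdot> v))" if "v \<in> dom A" for v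
    using that R_dom(1)[OF that] by (simp add: K_def S_def linear_operatorD[OF linear_A] scaleC_diff_right)
  have K_diff: "K (x - y) = K x - K y" if "x \<in> dom A" "y \<in> dom A" for x y
    using that by (simp add: K_eq linear_operator_diff[OF linear_A] Rl R_dom(1) scaleC_diff_right[symmetric] algebra_simps)
  have K_norm: "norm (K v) \<le> cmod k * C * norm v" if "v \<in> dom A" for v
    using mult_left_mono[OF R_dom(2)[OF that], of "cmod k"] by (simp add: K_eq[OF that] norm_scaleC mult.assoc)
  have T_norm: "norm (T v) \<le> (1 + cmod k) * norm v" for v
  proof -
    have "norm (B v) \<le> 1 * norm v"
      using b_bounds by (intro op_norm_le bounded_borel_measurable[OF bounded_borel_b]) (auto simp: less_imp_le)
    then have "cmod k * norm (B v) \<le> cmod k * norm v" by (intro mult_left_mono) auto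
    then show ?thesis
      using norm_triangle_ineq4[of v "k *\<^sub>C B v"] by (simp add: T_def norm_scaleC algebra_simps)
  qed
  have T_diff: "T (x - y) = T x - T y" for x y by (simp add: T_def B_clinear scaleC_diff_right)
  \<comment> \<open>Since \<open>norm (J v) \<le> norm v / \<eta>\<close>, the quotient \<kappa> /
    \<eta> bounds the map K J T; the choice of \<eta> keeps it below 1/2.\<close>
  define \<kappa> where "\<kappa> = cmod k * C * (1 + cmod k)"
  define \<eta> where "\<eta> = 2 * \<kappa> + 1"
  have \<kappa>: "0 \<le> \<kappa>" using C by (simp add: \<kappa>_def)
  then have \<eta>: "0 < \<eta>" by (simp add: \<eta>_def)
  let ?i = "\<i> * complex_of_real \<eta>"
  have "\<forall>v. \<exists>u. u \<in> dom A \<and> A \<cdot> u - ?i *\<^sub>C u = v" using A_shift_surj[OF \<eta>] by blast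
  from choice[OF this] obtain J where J: "\<And>v. J v \<in> dom A" "\<And>v. A \<cdot> J v - ?i *\<^sub>C J v = v" by blast
  have J_norm: "norm (J v) \<le> norm v / \<eta>" for v
    using A_shift_lower[OF J(1)[of v], of \<eta>] \<eta> J(2)[of v] by (simp add: field_simps)
  have J_eqI: "J v = u" if "u \<in> dom A" "A \<cdot> u - ?i *\<^sub>C u = v" for u v
  proof -
    have d: "J v - u \<in> dom A" by (rule linear_operator_diff(1)[OF linear_A J(1) that(1)])
    have "A \<cdot> (J v - u) - ?i *\<^sub>C (J v - u) = (A \<cdot> J v - ?i *\<^sub>C J v) - (A \<cdot> u - ?i *\<^sub>C u)"
      by (simp add: linear_operator_diff(2)[OF linear_A J(1) that(1)] scaleC_diff_right)
    then have "A \<cdot> (J v - u) - ?i *\<^sub>C (J v - u) = 0" unfolding J(2) that(2) by simp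
    then have "\<eta> * norm (J v - u) \<le> 0" using A_shift_lower[OF d, of \<eta>] \<eta> by simp
    then show ?thesis using \<eta> by (simp add: mult_le_0_iff)
  qed
  have J_diff: "J (x - y) = J x - J y" for x y
  proof (rule J_eqI)
    show "J x - J y \<in> dom A" by (rule linear_operator_diff(1)[OF linear_A J(1) J(1)])
    have "A \<cdot> (J x - J y) - ?i *\<^sub>C (J x - J y) = (A \<cdot> J x - ?i *\<^sub>C J x) - (A \<cdot> J y - ?i *\<^sub>C J y)"
      by (simp add: linear_operator_diff(2)[OF linear_A J(1) J(1)] scaleC_diff_right)
    then show "A \<cdot> (J x - J y) - ?i *\<^sub>C (J x - J y) = x - y" unfolding J(2) .
  qed
  have KJT_norm: "norm (K (J (T x))) \<le> 1 / 2 * norm x" for x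
  proof -
    have "norm (K (J (T x))) \<le> cmod k * C * norm (J (T x))" by (rule K_norm[OF J(1)])
    also have "\<dots> \<le> cmod k * C * ((1 + cmod k) * norm x / \<eta>)"
      using C order_trans[OF J_norm divide_right_mono[OF T_norm]] \<eta> by (intro mult_left_mono) auto
    also have "\<dots> = \<kappa> / \<eta> * norm x" by (simp add: \<kappa>_def)
    also have "\<dots> \<le> 1 / 2 * norm x" using \<kappa> by (intro mult_right_mono) (auto simp: \<eta>_def field_simps)
    finally show ?thesis .
  qed
  have T_dom: "T x \<in> dom A" if x: "x \<in> dom A" for x
  proof -
    define w where "w = A \<cdot> x - ?i *\<^sub>C x"
    have Jw: "J w = x" by (rule J_eqI[OF x]) (simp add: w_def)
    \<comment> \<open>Solves (1 + K J T) y = w as the fixed point of a contraction.\<close>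
    have "\<exists>!y. w - K (J (T y)) = y"
    proof (rule banach_fix_type[of "1/2"], simp, simp, intro allI)
      fix x y
      have "K (J (T y)) - K (J (T x)) = K (J (T (y - x)))"
        by (simp add: T_diff J_diff K_diff J(1))
      then show "dist (w - K (J (T x))) (w - K (J (T y))) \<le> 1 / 2 * dist x y"
        using KJT_norm[of "y - x"] by (simp add: dist_norm norm_minus_commute)
    qed
    then obtain w' where w': "w - K (J (T w')) = w'" by blast
    define y where "y = J (T w')"
    have y: "y \<in> dom A" by (simp add: y_def J(1))
    \<comment> \<open>Commuting A - i \<eta> past \<open>S\<close> costs \<open>K y\<close>, and the
      fixed point equation makes the total equal \<open>w\<close>. So \<open>S y = J w = x\<close>,
      and \<open>T x\<close> is the vector \<open>y\<close> of \<open>dom A\<close>.\<close>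
    have "A \<cdot> S y - ?i *\<^sub>C S y = S (A \<cdot> y - ?i *\<^sub>C y) + K y"
      by (simp add: K_def S_def Rl scaleC_add_right scaleC_diff_right scaleC_scaleC mult.commute algebra_simps)
    also have "\<dots> = w" using w' by (simp add: y_def J(2) ST diff_eq_eq)
    finally have "S y = x" using J_eqI[OF S_dom[OF y]] Jw by simp
    then show ?thesis using TS[of y] y by simp
  qed
  show ?thesis unfolding B_RT by (rule R_dom(1)[OF T_dom[OF v]])
qed

text \<open>The relation [A, \<phi>(H)] = i c \<gamma>(H) as a form on \<open>dom A\<close>, with x
  \<phi>'(x) as the intended \<gamma>. As a form it makes sense even if \<open>op \<phi>\<close>
  does not preserve \<open>dom A\<close>, and it survives weak limits.\<close>

definition comm :: "(real \<Rightarrow> real) \<Rightarrow> (real \<Rightarrow> real) \<Rightarrow> bool" where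
  "comm \<phi> \<gamma> \<longleftrightarrow> (\<forall>u\<in>dom A. \<forall>v\<in>dom A.
     cinner (A \<cdot> u) (op \<phi> v) - cinner (op \<phi> u) (A \<cdot> v) = \<i> * c * cinner u (op \<gamma> v))"

text \<open>The identity [A, B] = - B [A, H] B together with [A, H] = i c H; the symbol is x b'(x) =
  - b (1 - b). Invariance of \<open>dom A\<close> under \<open>B\<close> is what allows the
  commutator form to be evaluated at \<open>B u\<close> and \<open>B v\<close>.\<close>

lemma comm_b: "comm b (\<lambda>x. - (b x * (1 - b x)))"
  unfolding comm_def
proof (intro ballI)
  fix u v assume u: "u \<in> dom A" and v: "v \<in> dom A"
  obtain q where q: "is_commutator_form A H q"
    and qc: "\<And>u v. u \<in> dom H \<Longrightarrow> v \<in> dom H \<Longrightarrow> - \<i> * q u v = c * cinner u (H \<cdot> v)"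
    using commutation unfolding commutation_relation_def by blast
  have q_eq: "q (B u) (B v) = cinner (A \<cdot> B u) (H \<cdot> B v) - cinner (H \<cdot> B u) (A \<cdot> B v)"
    using q B_dom_A[OF u] B_dom_A[OF v] op_b(1) by (simp add: is_commutator_form_def)
  have "\<i> * (- \<i> * q (B u) (B v)) = \<i> * (c * cinner (B u) (H \<cdot> B v))"
    by (simp only: qc[OF op_b(1) op_b(1)])
  then have q_val: "q (B u) (B v) = \<i> * c * cinner (B u) (H \<cdot> B v)" by simp
  have "cinner (A \<cdot> u) (B v) = cinner (H \<cdot> B u) (A \<cdot> B v) + cinner (B u) (A \<cdot> B v)"
    unfolding self_adjoint_symmetric[OF self_adjoint_A u B_dom_A[OF v]] cinner_add_left[symmetric]
    by (simp add: op_b(2))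
  moreover have "cinner (B u) (A \<cdot> v) = cinner (A \<cdot> B u) (H \<cdot> B v) + cinner (A \<cdot> B u) (B v)"
    unfolding self_adjoint_symmetric[OF self_adjoint_A B_dom_A[OF u] v, symmetric] cinner_add_right[symmetric]
    by (simp add: op_b(2))
  moreover have "cinner (B u) (A \<cdot> B v) = cinner (A \<cdot> B u) (B v)"
    by (rule self_adjoint_symmetric[OF self_adjoint_A B_dom_A[OF u] B_dom_A[OF v], symmetric])
  ultimately have "cinner (A \<cdot> u) (B v) - cinner (B u) (A \<cdot> v) = - q (B u) (B v)"
    by (simp add: q_eq)
  also have "\<dots> = \<i> * c * cinner u (- B (v - B v))"
    by (simp add: q_val op_b(2) symmetric_opD(3)[OF op_symmetric[OF bounded_borel_b]])
  also have "- B (v - B v) = op (\<lambda>x. - (b x * (1 - b x))) v"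
  proof -
    have b1: "bounded_borel (\<lambda>x. 1 - b x)" by (rule bounded_borel_diff[OF _ bounded_borel_b]) simp
    have "op (\<lambda>x. - (b x * (1 - b x))) v = - op (\<lambda>x. b x * (1 - b x)) v"
      using op_scale[OF bounded_borel_mult[OF bounded_borel_b b1], of "-1" v] by simp
    also have "\<dots> = - B (op (\<lambda>x. 1 - b x) v)" by (simp add: op_mult[OF bounded_borel_b b1])
    also have "op (\<lambda>x. 1 - b x) v = v - B v"
      using op_diff[of "\<lambda>x. 1" b v] bounded_borel_b by (simp add: op_one)
    finally show ?thesis by simp
  qed
  finally show "cinner (A \<cdot> u) (B v) - cinner (B u) (A \<cdot> v) = \<i> * c * cinner u (op (\<lambda>x. - (b x * (1 - b x))) v)" .
qed

lemma comm_const: "comm (\<lambda>x. a) (\<lambda>x. 0)"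
proof -
  have a: "op (\<lambda>x. a) v = a *\<^sub>R v" for a v using op_scale[of "\<lambda>x. 1" a v] by (simp add: op_one)
  show ?thesis
    by (simp add: comm_def a cinner_scaleR_left cinner_scaleR_right self_adjoint_symmetric[OF self_adjoint_A])
qed

lemma comm_add:
  assumes "comm \<phi>1 \<gamma>1" "comm \<phi>2 \<gamma>2"
    and "bounded_borel \<phi>1" "bounded_borel \<phi>2" "bounded_borel \<gamma>1" "bounded_borel \<gamma>2"
  shows "comm (\<lambda>x. \<phi>1 x + \<phi>2 x) (\<lambda>x. \<gamma>1 x + \<gamma>2 x)"
  unfolding comm_def
proof (intro ballI)
  fix u v assume "u \<in> dom A" "v \<in> dom A"
  then have "cinner (A \<cdot> u) (op \<phi>1 v) - cinner (op \<phi>1 u) (A \<cdot> v) = \<i> * c * cinner u (op \<gamma>1 v)"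
    "cinner (A \<cdot> u) (op \<phi>2 v) - cinner (op \<phi>2 u) (A \<cdot> v) = \<i> * c * cinner u (op \<gamma>2 v)"
    using assms(1,2) by (auto simp: comm_def)
  then show "cinner (A \<cdot> u) (op (\<lambda>x. \<phi>1 x + \<phi>2 x) v) - cinner (op (\<lambda>x. \<phi>1 x + \<phi>2 x) u) (A \<cdot> v)
      = \<i> * c * cinner u (op (\<lambda>x. \<gamma>1 x + \<gamma>2 x) v)"
    by (simp add: op_add assms cinner_add_left cinner_add_right algebra_simps)
qed

text \<open>The Leibniz rule. Its intermediate terms apply \<open>A\<close> to
  \<open>op \<phi>1 u\<close> and \<open>op \<phi>2 v\<close>, which is why invariance of
  \<open>dom A\<close> is demanded.\<close>

lemma comm_mult:
  assumes c12: "comm \<phi>1 \<gamma>1" "comm \<phi>2 \<gamma>2"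
    and dom: "\<And>u. u \<in> dom A \<Longrightarrow> op \<phi>1 u \<in> dom A" "\<And>u. u \<in> dom A \<Longrightarrow> op \<phi>2 u \<in> dom A"
    and bb: "bounded_borel \<phi>1" "bounded_borel \<phi>2" "bounded_borel \<gamma>1" "bounded_borel \<gamma>2"
  shows "comm (\<lambda>x. \<phi>1 x * \<phi>2 x) (\<lambda>x. \<gamma>1 x * \<phi>2 x + \<phi>1 x * \<gamma>2 x)"
  unfolding comm_def
proof (intro ballI)
  fix u v assume u: "u \<in> dom A" and v: "v \<in> dom A"
  have 1: "cinner (A \<cdot> u) (op \<phi>1 (op \<phi>2 v)) - cinner (op \<phi>1 u) (A \<cdot> op \<phi>2 v) = \<i> * c * cinner u (op \<gamma>1 (op \<phi>2 v))"
    using c12(1) u dom(2)[OF v] by (simp add: comm_def)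
  have 2: "cinner (A \<cdot> op \<phi>1 u) (op \<phi>2 v) - cinner (op \<phi>2 (op \<phi>1 u)) (A \<cdot> v) = \<i> * c * cinner (op \<phi>1 u) (op \<gamma>2 v)"
    using c12(2) v dom(1)[OF u] by (simp add: comm_def)
  have 3: "cinner (op \<phi>1 u) (A \<cdot> op \<phi>2 v) = cinner (A \<cdot> op \<phi>1 u) (op \<phi>2 v)"
    by (rule self_adjoint_symmetric[OF self_adjoint_A dom(1)[OF u] dom(2)[OF v], symmetric])
  have 4: "op \<phi>2 (op \<phi>1 u) = op (\<lambda>x. \<phi>1 x * \<phi>2 x) u"
    using op_mult[OF bb(2,1), of u] by (simp add: mult.commute)
  have "cinner u (op (\<lambda>x. \<gamma>1 x * \<phi>2 x + \<phi>1 x * \<gamma>2 x) v) = cinner u (op \<gamma>1 (op \<phi>2 v)) + cinner (op \<phi>1 u) (op \<gamma>2 v)"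
    by (simp add: op_add[OF bounded_borel_mult[OF bb(3,2)] bounded_borel_mult[OF bb(1,4)]] op_mult bb
        cinner_add_right symmetric_opD(3)[OF op_symmetric[OF bb(1)]])
  then show "cinner (A \<cdot> u) (op (\<lambda>x. \<phi>1 x * \<phi>2 x) v) - cinner (op (\<lambda>x. \<phi>1 x * \<phi>2 x) u) (A \<cdot> v)
      = \<i> * c * cinner u (op (\<lambda>x. \<gamma>1 x * \<phi>2 x + \<phi>1 x * \<gamma>2 x) v)"
    using arg_cong2[OF 1 2, of "(+)"] 3 by (simp add: 4 op_mult[OF bb(1,2)] distrib_left)
qed

text \<open>Both sides are matrix elements between fixed vectors, so weak convergence suffices.
  Convergence is asked for positive x only, as the spectral measures live there.\<close>

lemma comm_limit:
  assumes comm: "\<And>n. comm (\<phi> n) (\<gamma> n)"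
    and \<phi>: "\<And>n. \<phi> n \<in> borel_measurable borel" "\<And>n x. \<bar>\<phi> n x\<bar> \<le> C" "bounded_borel \<phi>'"
    and \<gamma>: "\<And>n. \<gamma> n \<in> borel_measurable borel" "\<And>n x. \<bar>\<gamma> n x\<bar> \<le> D" "bounded_borel \<gamma>'"
    and lim: "\<And>x. 0 < x \<Longrightarrow> (\<lambda>n. \<phi> n x) \<longlonglongrightarrow> \<phi>' x" "\<And>x. 0 < x \<Longrightarrow> (\<lambda>n. \<gamma> n x) \<longlonglongrightarrow> \<gamma>' x"
  shows "comm \<phi>' \<gamma>'"
  unfolding comm_def
proof (intro ballI)
  fix u v assume u: "u \<in> dom A" and v: "v \<in> dom A"
  have AE: "AE x in \<mu> u. (\<lambda>n. \<phi> n x) \<longlonglongrightarrow> \<phi>' x" "AE x in \<mu> u. (\<lambda>n. \<gamma> n x) \<longlonglongrightarrow> \<gamma>' x" for u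
    using AE_positive[of u] lim by (auto elim!: eventually_mono)
  have L\<phi>: "(\<lambda>n. cinner u (op (\<phi> n) v)) \<longlonglongrightarrow> cinner u (op \<phi>' v)" for u v
    by (rule cinner_op_limit[OF \<phi>(1) bounded_borel_measurable[OF \<phi>(3)] \<phi>(2) AE(1) \<phi>(3)])
  have L\<gamma>: "(\<lambda>n. cinner u (op (\<gamma> n) v)) \<longlonglongrightarrow> cinner u (op \<gamma>' v)" for u v
    by (rule cinner_op_limit[OF \<gamma>(1) bounded_borel_measurable[OF \<gamma>(3)] \<gamma>(2) AE(2) \<gamma>(3)])
  have bb: "bounded_borel (\<phi> n)" for n by (rule bounded_borelI[OF \<phi>(1,2)])
  have l1: "(\<lambda>n. cinner (A \<cdot> u) (op (\<phi> n) v) - cinner (op (\<phi> n) u) (A \<cdot> v)) \<longlonglongrightarrow>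
      cinner (A \<cdot> u) (op \<phi>' v) - cinner (op \<phi>' u) (A \<cdot> v)"
    unfolding symmetric_opD(3)[OF op_symmetric[OF bb]] symmetric_opD(3)[OF op_symmetric[OF \<phi>(3)]]
    by (intro tendsto_intros L\<phi>)
  have eq: "(\<lambda>n. cinner (A \<cdot> u) (op (\<phi> n) v) - cinner (op (\<phi> n) u) (A \<cdot> v)) = (\<lambda>n. \<i> * c * cinner u (op (\<gamma> n) v))"
    using comm u v by (auto simp: comm_def)
  have l2: "(\<lambda>n. \<i> * c * cinner u (op (\<gamma> n) v)) \<longlonglongrightarrow> \<i> * c * cinner u (op \<gamma>' v)"
    by (intro tendsto_intros L\<gamma>)
  show "cinner (A \<cdot> u) (op \<phi>' v) - cinner (op \<phi>' u) (A \<cdot> v) = \<i> * c * cinner u (op \<gamma>' v)"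
    by (rule LIMSEQ_unique[OF l1[unfolded eq] l2])
qed

lemma bounded_borel_poly_b: "bounded_borel (\<lambda>x. poly p (b x))"
  by (induction p) (simp_all add: bounded_borel_add bounded_borel_mult bounded_borel_b)

text \<open>The chain rule for p(b(x)), by Horner induction; invariance of \<open>dom A\<close> is
  carried along for the product step.\<close>

lemma comm_poly: "comm (\<lambda>x. poly p (b x)) (\<lambda>x. - (b x * (1 - b x)) * poly (pderiv p) (b x))"
proof -
  have bm: "bounded_borel (\<lambda>x. - (b x * (1 - b x)))"
    using bounded_borel_scale[OF bounded_borel_mult[OF bounded_borel_b
      bounded_borel_diff[OF bounded_borel_const bounded_borel_b]], of "-1" 1] by simp
  have "comm (\<lambda>x. poly p (b x)) (\<lambda>x. - (b x * (1 - b x)) * poly (pderiv p) (b x)) \<and>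
      (\<forall>u\<in>dom A. op (\<lambda>x. poly p (b x)) u \<in> dom A)"
  proof (induction p)
    case 0
    have "op (\<lambda>x. 0) u = 0" for u using op_scale[of "\<lambda>x. 1" 0 u] by simp
    then show ?case using comm_const[of 0] linear_operatorD(1)[OF linear_A] by simp
  next
    case (pCons a p)
    define \<gamma> where "\<gamma> x = - (b x * (1 - b x)) * poly (pderiv p) (b x)" for x
    have \<gamma>: "bounded_borel \<gamma>"
      unfolding \<gamma>_def[abs_def] by (rule bounded_borel_mult[OF bm bounded_borel_poly_b])
    have IH: "comm (\<lambda>x. poly p (b x)) \<gamma>" "\<And>u. u \<in> dom A \<Longrightarrow> op (\<lambda>x. poly p (b x)) u \<in> dom A"
      using pCons unfolding \<gamma>_def by auto
    have bp: "bounded_borel (\<lambda>x. b x * poly p (b x))"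
      by (rule bounded_borel_mult[OF bounded_borel_b bounded_borel_poly_b])
    have "comm (\<lambda>x. b x * poly p (b x)) (\<lambda>x. - (b x * (1 - b x)) * poly p (b x) + b x * \<gamma> x)"
      by (rule comm_mult[OF comm_b IH(1) B_dom_A IH(2) bounded_borel_b bounded_borel_poly_b bm \<gamma>])
    then have "comm (\<lambda>x. a + b x * poly p (b x)) (\<lambda>x. 0 + (- (b x * (1 - b x)) * poly p (b x) + b x * \<gamma> x))"
      by (intro comm_add comm_const bounded_borel_const bp bounded_borel_add bounded_borel_mult bm \<gamma>
          bounded_borel_b bounded_borel_poly_b)
    also have "(\<lambda>x. 0 + (- (b x * (1 - b x)) * poly p (b x) + b x * \<gamma> x))
        = (\<lambda>x. - (b x * (1 - b x)) * poly (pderiv (pCons a p)) (b x))"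
      by (simp add: \<gamma>_def pderiv_pCons fun_eq_iff algebra_simps)
    finally have 1: "comm (\<lambda>x. poly (pCons a p) (b x)) (\<lambda>x. - (b x * (1 - b x)) * poly (pderiv (pCons a p)) (b x))"
      by simp
    have "op (\<lambda>x. poly (pCons a p) (b x)) u \<in> dom A" if "u \<in> dom A" for u
    proof -
      have "op (\<lambda>x. poly (pCons a p) (b x)) u = op (\<lambda>x. a) u + B (op (\<lambda>x. poly p (b x)) u)"
        by (simp add: op_add[OF bounded_borel_const bp] op_mult[OF bounded_borel_b bounded_borel_poly_b])
      also have "op (\<lambda>x. a) u = a *\<^sub>R u" using op_scale[of "\<lambda>x. 1" a u] by (simp add: op_one)
      finally show ?thesis
        using that by (simp add: linear_operatorD[OF linear_A] linear_operator_scaleR[OF linear_A] B_dom_A IH(2))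
    qed
    then show ?case using 1 by blast
  qed
  then show ?thesis ..
qed

end

text \<open>Serves to approximate a derivative first and the function afterwards; the value is
  prescribed at 1 because b = 1 corresponds to x = 0.\<close>

lemma poly_antiderivative: "\<exists>P. pderiv P = (p::real poly) \<and> poly P 1 = r"
proof -
  define Q where "Q = (\<Sum>i\<le>degree p. monom (coeff p i / (i + 1)) (Suc i))"
  have "pderiv (\<Sum>i\<in>I. f i) = (\<Sum>i\<in>I. pderiv (f i))" for f :: "nat \<Rightarrow> real poly" and I
    by (induction I rule: infinite_finite_induct) (simp_all add: pderiv_add)
  then have "pderiv Q = (\<Sum>i\<le>degree p. monom (coeff p i) i)"
    by (simp add: Q_def pderiv_monom del: of_nat_Suc)
  also have "\<dots> = p" by (rule poly_as_sum_of_monoms)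
  finally have "pderiv (Q + [:r - poly Q 1:]) = p" by (simp add: pderiv_add)
  then show ?thesis by (intro exI[of _ "Q + [:r - poly Q 1:]"]) simp
qed

lemma abs_sin_le: "0 \<le> x \<Longrightarrow> \<bar>sin (t * x)\<bar> \<le> \<bar>t\<bar> * (x::real)"
  using abs_sin_x_le_abs_x[of "t * x"] by (simp add: abs_mult)

definition cosf :: "real \<Rightarrow> real \<Rightarrow> real" where "cosf t x = cos (t * x)"
definition sincf :: "real \<Rightarrow> real \<Rightarrow> real" where "sincf t x = (if x = 0 then t else sin (t * x) / x)"

lemma abs_sincf_le: "\<bar>sincf t x\<bar> \<le> \<bar>t\<bar>"
  using abs_sin_x_le_abs_x[of "t * x"] by (simp add: sincf_def abs_mult divide_le_eq)

lemma bounded_borel_cosf: "bounded_borel (cosf t)"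
  by (rule bounded_borelI[of _ 1]) (simp_all add: cosf_def[abs_def])

lemma bounded_borel_sincf: "bounded_borel (sincf t)"
proof (rule bounded_borelI[OF _ abs_sincf_le])
  show "sincf t \<in> borel_measurable borel" unfolding sincf_def[abs_def] by measurable
qed

section \<open>Commutators with smooth symbols and with sin(tx)/x\<close>

context conjugate_operator
begin

text \<open>In the variable y = 1/(1+x) the half-line becomes the interval (0, 1]. Approximating the
  derivative there uniformly by polynomials and integrating from y = 1 gives polynomials in b that
  converge together with their commutator symbols.\<close>

lemma comm_smooth:
  assumes deriv: "\<And>x. 0 \<le> x \<Longrightarrow> (\<phi> has_real_derivative \<phi>' x) (at x)"
    and cont: "continuous_on {0..} \<phi>'"
    and decay: "((\<lambda>x. (1 + x)\<^sup>2 * \<phi>' x) \<longlongrightarrow> 0) at_top"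
  shows "comm (\<lambda>x. \<phi> (max 0 x)) (\<lambda>x. max 0 x * \<phi>' (max 0 x))"
proof -
  define F where "F y = \<phi> (1 / y - 1)" for y
  \<comment> \<open>The derivative of \<open>F\<close>. It equals
    \<open>- (1 + x)\<^sup>2 * \<phi>' x\<close> at y = 1/(1+x), so the decay hypothesis makes it
    continuous at 0 with value 0.\<close>
  define G where "G y = (if y = 0 then 0 else - \<phi>' (1 / y - 1) / y\<^sup>2)" for y
  have G_lim: "(G \<longlongrightarrow> 0) (at_right 0)"
  proof -
    have "filterlim (\<lambda>y::real. 1 / y - 1) at_top (at_right 0)" by real_asymp
    from filterlim_compose[OF decay this]
    have "((\<lambda>y. - ((1 + (1 / y - 1))\<^sup>2 * \<phi>' (1 / y - 1))) \<longlongrightarrow> - 0) (at_right 0)" by (rule tendsto_minus)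
    moreover have "\<forall>\<^sub>F y in at_right 0. - ((1 + (1 / y - 1))\<^sup>2 * \<phi>' (1 / y - 1)) = G y"
      by (intro eventually_at_rightI[of 0 1]) (auto simp: G_def power_divide)
    ultimately show ?thesis by (simp add: filterlim_cong)
  qed
  have G_cont: "continuous_on {0..1} G"
    unfolding continuous_on_eq_continuous_within
  proof
    fix y :: real assume y: "y \<in> {0..1}"
    show "continuous (at y within {0..1}) G"
    proof (cases "y = 0")
      case True
      then show ?thesis using G_lim by (simp add: continuous_within at_within_Icc_at_right G_def)
    next
      case False
      have "continuous_on {0<..1} (\<lambda>y. - \<phi>' (1 / y - 1) / y\<^sup>2)"
        by (intro continuous_intros continuous_on_compose2[OF cont]) (auto simp: field_simps)
      then have "continuous_on {0<..1} G" by (rule continuous_on_cong[THEN iffD1, rotated 2]) (auto simp: G_def)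
      then have "continuous (at y within {0<..1}) G"
        using y False by (simp add: continuous_on_eq_continuous_within)
      moreover have "at y within {0..1} = at y within {0<..1}"
        using y False by (intro at_within_nhd[of y "{0<..}"]) auto
      ultimately show ?thesis by simp
    qed
  qed
  have "\<exists>M. \<forall>y\<in>{0..1}. \<bar>G y\<bar> \<le> M"
    using compact_imp_bounded[OF compact_continuous_image[OF G_cont compact_Icc]] unfolding bounded_iff by auto
  then obtain M where M: "\<And>y. y \<in> {0..1} \<Longrightarrow> \<bar>G y\<bar> \<le> M" by blast
  have F_deriv: "(F has_real_derivative G y) (at y)" if "0 < y" "y \<le> 1" for y
  proof -
    have "((\<lambda>y. 1 / y - 1) has_real_derivative - 1 / y\<^sup>2) (at y)"
      using that by (auto intro!: derivative_eq_intros simp: power2_eq_square)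
    moreover have "0 \<le> 1 / y - 1" using that by simp
    ultimately have "(F has_real_derivative \<phi>' (1 / y - 1) * (- 1 / y\<^sup>2)) (at y)"
      unfolding F_def[abs_def] by (intro DERIV_chain2[of \<phi>] deriv)
    then show ?thesis using that by (simp add: G_def)
  qed
  obtain p where p: "\<And>n y. y \<in> {0..1} \<Longrightarrow> \<bar>G y - poly (p n) y\<bar> < 1 / Suc n"
    using poly_uniform_approximation[OF G_cont] by blast
  have "\<forall>n. \<exists>P. pderiv P = p n \<and> poly P 1 = \<phi> 0" using poly_antiderivative by blast
  from choice[OF this] obtain P where P: "\<And>n. pderiv (P n) = p n" "\<And>n. poly (P n) 1 = \<phi> 0" by blast
  have p_bound: "\<bar>poly (p n) y\<bar> \<le> M + 1" if "y \<in> {0..1}" for n y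
  proof -
    have "1 / real (Suc n) \<le> 1" by simp
    then show ?thesis using p[OF that, of n] M[OF that] by linarith
  qed
  \<comment> \<open>\<open>P n\<close> and \<open>F\<close> agree at 1; the mean value theorem
    carries the uniform error of the derivatives over to the functions.\<close>
  have P_F: "\<bar>poly (P n) y - F y\<bar> \<le> 1 / Suc n" if y: "0 < y" "y \<le> 1" for n y
  proof (cases "y = 1")
    case False
    have "((\<lambda>y. poly (P n) y - F y) has_real_derivative poly (p n) x - G x) (at x)" if "y \<le> x" "x \<le> 1" for x
      using that y F_deriv[of x] poly_DERIV[of "P n" x] by (intro DERIV_diff) (simp_all add: P(1))
    then obtain \<xi> where \<xi>: "y < \<xi>" "\<xi> < 1"
      "(poly (P n) 1 - F 1) - (poly (P n) y - F y) = (1 - y) * (poly (p n) \<xi> - G \<xi>)"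
      using MVT2[of y 1 "\<lambda>y. poly (P n) y - F y" "\<lambda>y. poly (p n) y - G y"] y False by auto
    have "poly (P n) 1 - F 1 = 0" by (simp add: P(2) F_def)
    then have "poly (P n) y - F y = (1 - y) * (G \<xi> - poly (p n) \<xi>)"
      using \<xi>(3) by (simp add: algebra_simps)
    then have "\<bar>poly (P n) y - F y\<bar> = (1 - y) * \<bar>G \<xi> - poly (p n) \<xi>\<bar>"
      using y by (simp add: abs_mult)
    also have "\<dots> \<le> 1 * (1 / Suc n)"
      using y \<xi> p[of \<xi> n] by (intro mult_mono) auto
    finally show ?thesis by simp
  qed (simp add: P(2) F_def)
  have P_bound: "\<bar>poly (P n) y\<bar> \<le> \<bar>\<phi> 0\<bar> + (M + 1)" if y: "0 < y" "y \<le> 1" for n y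
  proof (cases "y = 1")
    case True
    then show ?thesis using M[of 0] by (simp add: P(2))
  next
    case False
    then obtain \<xi> where \<xi>: "y < \<xi>" "\<xi> < 1" "poly (P n) 1 - poly (P n) y = (1 - y) * poly (p n) \<xi>"
      using MVT2[of y 1 "poly (P n)" "poly (p n)"] y poly_DERIV[of "P n"] P(1) by auto
    have "\<bar>poly (P n) 1 - poly (P n) y\<bar> \<le> 1 * (M + 1)"
      unfolding \<xi>(3) abs_mult using y \<xi> p_bound[of \<xi> n] by (intro mult_mono) auto
    then have "\<bar>\<phi> 0 - poly (P n) y\<bar> \<le> M + 1" by (simp add: P(2))
    then show ?thesis by (simp add: abs_le_iff) linarith
  qed
  have b_inv: "1 / b x - 1 = max 0 x" for x by (simp add: b_def)
  define \<phi>n where "\<phi>n n x = poly (P n) (b x)" for n x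
  define \<gamma>n where "\<gamma>n n x = - (b x * (1 - b x)) * poly (pderiv (P n)) (b x)" for n x
  note bm = bounded_borel_measurable[OF bounded_borel_b]
  have lim\<phi>: "(\<lambda>n. \<phi>n n x) \<longlonglongrightarrow> \<phi> (max 0 x)" for x
  proof (rule LIM_zero_cancel, rule tendsto_0_le[OF LIMSEQ_Suc[OF lim_1_over_n], of _ 1])
    show "\<forall>\<^sub>F n in sequentially. norm (\<phi>n n x - \<phi> (max 0 x)) \<le> norm (1 / real (Suc n)) * 1"
      using P_F[OF b_bounds, of _ x] by (intro always_eventually allI) (simp add: \<phi>n_def F_def b_inv)
  qed
  have lim\<gamma>: "(\<lambda>n. \<gamma>n n x) \<longlonglongrightarrow> max 0 x * \<phi>' (max 0 x)" for x
  proof -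
    have bx: "b x \<in> {0..1}" using b_bounds[of x] by simp
    have "(\<lambda>n. poly (p n) (b x)) \<longlonglongrightarrow> G (b x)"
    proof (rule LIM_zero_cancel, rule tendsto_0_le[OF LIMSEQ_Suc[OF lim_1_over_n], of _ 1])
      show "\<forall>\<^sub>F n in sequentially. norm (poly (p n) (b x) - G (b x)) \<le> norm (1 / real (Suc n)) * 1"
        using p[OF bx] by (intro always_eventually allI) (simp add: abs_minus_commute less_imp_le)
    qed
    then have "(\<lambda>n. - (b x * (1 - b x)) * poly (p n) (b x)) \<longlonglongrightarrow> - (b x * (1 - b x)) * G (b x)"
      by (rule tendsto_mult_left)
    \<comment> \<open>The factor contributed by [A, B] converts the derivative in y back into x
      times the derivative in x.\<close>
    moreover have "- (b x * (1 - b x)) * G (b x) = (1 / b x - 1) * \<phi>' (1 / b x - 1)"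
      using b_bounds[of x] by (simp add: G_def power2_eq_square field_simps)
    ultimately show ?thesis unfolding b_inv by (simp add: \<gamma>n_def P(1))
  qed
  have \<phi>n_meas: "\<phi>n n \<in> borel_measurable borel" and \<gamma>n_meas: "\<gamma>n n \<in> borel_measurable borel" for n
    using bm bounded_borel_measurable[OF bounded_borel_poly_b]
    unfolding \<phi>n_def[abs_def] \<gamma>n_def[abs_def] by measurable
  have \<phi>n_bound: "\<bar>\<phi>n n x\<bar> \<le> \<bar>\<phi> 0\<bar> + (M + 1)" for n x
    unfolding \<phi>n_def by (rule P_bound[OF b_bounds])
  have \<gamma>n_bound: "\<bar>\<gamma>n n x\<bar> \<le> M + 1" for n x
  proof -
    have "b x * (1 - b x) \<le> 1 * 1" using b_bounds[of x] by (intro mult_mono) auto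
    then have "\<bar>- (b x * (1 - b x))\<bar> * \<bar>poly (p n) (b x)\<bar> \<le> 1 * (M + 1)"
      using b_bounds[of x] p_bound[of "b x" n] by (intro mult_mono) auto
    then show ?thesis by (simp add: \<gamma>n_def P(1) abs_mult)
  qed
  have bb: "bounded_borel h" if "\<And>n. f n \<in> borel_measurable borel" "\<And>n x. \<bar>f n x\<bar> \<le> K" "\<And>x. (\<lambda>n. f n x) \<longlonglongrightarrow> h x"
    for f :: "nat \<Rightarrow> real \<Rightarrow> real" and h K
  proof (rule bounded_borelI)
    show "h \<in> borel_measurable borel" by (rule borel_measurable_LIMSEQ_real[OF that(3,1)])
    show "\<bar>h x\<bar> \<le> K" for x
      using LIMSEQ_le_const2[OF tendsto_rabs[OF that(3)[of x]]] that(2) by blast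
  qed
  show ?thesis
  proof (rule comm_limit[of \<phi>n \<gamma>n "\<bar>\<phi> 0\<bar> + (M + 1)" _ "M + 1"])
    show "comm (\<phi>n n) (\<gamma>n n)" for n unfolding \<phi>n_def[abs_def] \<gamma>n_def[abs_def] by (rule comm_poly)
    show "bounded_borel (\<lambda>x. \<phi> (max 0 x))" by (rule bb[OF \<phi>n_meas \<phi>n_bound lim\<phi>])
    show "bounded_borel (\<lambda>x. max 0 x * \<phi>' (max 0 x))" by (rule bb[OF \<gamma>n_meas \<gamma>n_bound lim\<gamma>])
  qed (rule \<phi>n_meas \<gamma>n_meas \<phi>n_bound \<gamma>n_bound lim\<phi> lim\<gamma>)+
qed

text \<open>The regularisation \<open>e\<^sup>-\<^sup>a\<^sup>x sin (t x) / (x + a)\<close> is smooth up to the boundary and decays at infinity.\<close>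

lemma comm_sincf: "comm (sincf t) (\<lambda>x. t * cosf t x - sincf t x)"
proof -
  define \<phi> where "\<phi> a x = exp (- a * x) * sin (t * x) / (x + a)" for a x :: real
  define \<phi>' where "\<phi>' a x = exp (- a * x) * (t * cos (t * x) / (x + a) - sin (t * x) / (x + a)\<^sup>2 - a * sin (t * x) / (x + a))"
    for a x :: real
  have comm_a: "comm (\<lambda>x. \<phi> a (max 0 x)) (\<lambda>x. max 0 x * \<phi>' a (max 0 x))" if a: "0 < a" for a
  proof (rule comm_smooth)
    show "(\<phi> a has_real_derivative \<phi>' a x) (at x)" if "0 \<le> x" for x
    proof -
      have "x + a \<noteq> 0" using a that by simp
      then show ?thesis
        unfolding \<phi>_def[abs_def] \<phi>'_def
        by (auto intro!: derivative_eq_intros simp: divide_simps) (simp add: power2_eq_square algebra_simps)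
    qed
    show "continuous_on {0..} (\<phi>' a)"
      unfolding \<phi>'_def[abs_def] using a by (intro continuous_intros) auto
    define K where "K = \<bar>t\<bar> / a + 1 / a\<^sup>2 + 1"
    have le: "\<bar>\<phi>' a x\<bar> \<le> exp (- a * x) * K" if x: "0 \<le> x" for x
    proof -
      have "\<bar>t * cos (t * x) / (x + a)\<bar> \<le> \<bar>t\<bar> / a"
        using a x by (auto simp: abs_mult intro!: frac_le mult_left_le)
      moreover have "\<bar>sin (t * x) / (x + a)\<^sup>2\<bar> \<le> 1 / a\<^sup>2"
        using a x by (auto intro!: frac_le power_mono)
      moreover have "\<bar>a * sin (t * x) / (x + a)\<bar> \<le> 1"
      proof -
        have "a * \<bar>sin (t * x)\<bar> \<le> a * 1" using a by (intro mult_left_mono) auto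
        then have "a * \<bar>sin (t * x)\<bar> \<le> x + a" using x by linarith
        then show ?thesis using a x by (simp add: abs_mult divide_le_eq)
      qed
      ultimately have "\<bar>t * cos (t * x) / (x + a) - sin (t * x) / (x + a)\<^sup>2 - a * sin (t * x) / (x + a)\<bar> \<le> K"
        unfolding K_def by linarith
      then show ?thesis unfolding \<phi>'_def abs_mult by (simp add: mult_left_mono)
    qed
    show "((\<lambda>x. (1 + x)\<^sup>2 * \<phi>' a x) \<longlongrightarrow> 0) at_top"
    proof (rule Lim_null_comparison)
      show "\<forall>\<^sub>F x in at_top. norm ((1 + x)\<^sup>2 * \<phi>' a x) \<le> (1 + x)\<^sup>2 * exp (- a * x) * K"
        using eventually_ge_at_top[of 0]
      proof eventually_elim
        case (elim x)
        then show ?case using mult_left_mono[OF le[OF elim], of "(1 + x)\<^sup>2"] by (simp add: abs_mult mult.assoc)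
      qed
      show "((\<lambda>x. (1 + x)\<^sup>2 * exp (- a * x) * K) \<longlongrightarrow> 0) at_top" using a by real_asymp
    qed
  qed
  define a where "a n = 1 / real (Suc n)" for n
  have a: "0 < a n" for n by (simp add: a_def)
  have a_lim: "a \<longlonglongrightarrow> 0" unfolding a_def[abs_def] by (rule LIMSEQ_Suc[OF lim_1_over_n])
  have s_bound: "\<bar>sin (t * x) / (x + a n)\<bar> \<le> \<bar>t\<bar>" if "0 \<le> x" for x n
  proof -
    have "\<bar>sin (t * x)\<bar> \<le> \<bar>t\<bar> * (x + a n)"
      using abs_sin_le[OF that, of t] a[of n] mult_left_mono[of x "x + a n" "\<bar>t\<bar>"] by linarith
    then show ?thesis using that a[of n] by (simp add: divide_le_eq)
  qed
  show ?thesis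
  proof (rule comm_limit[where C = "\<bar>t\<bar>" and D = "3 * \<bar>t\<bar>"])
    show "comm (\<lambda>x. \<phi> (a n) (max 0 x)) (\<lambda>x. max 0 x * \<phi>' (a n) (max 0 x))" for n by (rule comm_a[OF a])
    show "(\<lambda>x. \<phi> (a n) (max 0 x)) \<in> borel_measurable borel" for n unfolding \<phi>_def by measurable
    show "(\<lambda>x. max 0 x * \<phi>' (a n) (max 0 x)) \<in> borel_measurable borel" for n unfolding \<phi>'_def by measurable
    show "\<bar>\<phi> (a n) (max 0 x)\<bar> \<le> \<bar>t\<bar>" for n x
    proof -
      have "\<bar>exp (- a n * max 0 x)\<bar> * \<bar>sin (t * max 0 x) / (max 0 x + a n)\<bar> \<le> 1 * \<bar>t\<bar>"
        using a[of n] by (intro mult_mono s_bound) auto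
      then show ?thesis by (simp add: \<phi>_def abs_mult)
    qed
    show "\<bar>max 0 x * \<phi>' (a n) (max 0 x)\<bar> \<le> 3 * \<bar>t\<bar>" for n x
    proof -
      \<comment> \<open>The product rule leaves three terms. As m/(m+a) and a m exp(-a m) are at
        most 1, each is bounded by the modulus of t, uniformly in the regularisation parameter;
        hence the constant 3.\<close>
      define m where "m = max 0 x"
      define e where "e = exp (- a n * m)"
      define s where "s = sin (t * m) / (m + a n)"
      define r where "r = m / (m + a n)"
      have m: "0 \<le> m" by (simp add: m_def)
      have e: "0 \<le> e" "e \<le> 1" using m a[of n] by (auto simp: e_def)
      have r: "0 \<le> r" "r \<le> 1" using m a[of n] by (auto simp: r_def divide_le_eq)
      have s: "\<bar>s\<bar> \<le> \<bar>t\<bar>" unfolding s_def by (rule s_bound[OF m])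
      have ame: "0 \<le> a n * m * e" "a n * m * e \<le> 1"
      proof -
        show "0 \<le> a n * m * e" using m e a[of n] by simp
        have "a n * m \<le> exp (a n * m)" using exp_ge_add_one_self[of "a n * m"] by linarith
        then show "a n * m * e \<le> 1" by (simp add: e_def exp_minus field_simps)
      qed
      have "m * \<phi>' (a n) m = (e * r) * (t * cos (t * m)) - (e * r) * s - (a n * m * e) * s"
        using m a[of n] by (simp add: \<phi>'_def e_def s_def r_def power2_eq_square field_simps)
      moreover have "\<bar>(e * r) * (t * cos (t * m))\<bar> \<le> 1 * \<bar>t\<bar>"
        unfolding abs_mult[of "e * r"] using e r by (intro mult_mono) (auto simp: abs_mult mult_le_one intro!: mult_left_le)
      moreover have "\<bar>(e * r) * s\<bar> \<le> 1 * \<bar>t\<bar>"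
        unfolding abs_mult[of "e * r"] using e r s by (intro mult_mono) (auto simp: mult_le_one)
      moreover have "\<bar>(a n * m * e) * s\<bar> \<le> 1 * \<bar>t\<bar>"
        unfolding abs_mult[of "a n * m * e"] using ame s by (intro mult_mono) auto
      ultimately have "\<bar>m * \<phi>' (a n) m\<bar> \<le> 3 * \<bar>t\<bar>" by linarith
      then show ?thesis by (simp add: m_def)
    qed
    show "bounded_borel (\<lambda>x. t * cosf t x - sincf t x)"
      by (intro bounded_borel_diff bounded_borel_scale bounded_borel_cosf bounded_borel_sincf)
    fix x :: real assume x: "0 < x"
    have "(\<lambda>n. exp (- a n * x) * sin (t * x) / (x + a n)) \<longlonglongrightarrow> exp (- 0 * x) * sin (t * x) / (x + 0)"
      using x by (intro tendsto_intros a_lim) auto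
    then show "(\<lambda>n. \<phi> (a n) (max 0 x)) \<longlonglongrightarrow> sincf t x"
      using x by (simp add: \<phi>_def sincf_def)
    have "(\<lambda>n. x * (exp (- a n * x) * (t * cos (t * x) / (x + a n) - sin (t * x) / (x + a n)\<^sup>2 - a n * sin (t * x) / (x + a n))))
        \<longlonglongrightarrow> x * (exp (- 0 * x) * (t * cos (t * x) / (x + 0) - sin (t * x) / (x + 0)\<^sup>2 - 0 * sin (t * x) / (x + 0)))"
      using x by (intro tendsto_intros a_lim) auto
    then show "(\<lambda>n. max 0 x * \<phi>' (a n) (max 0 x)) \<longlonglongrightarrow> t * cosf t x - sincf t x"
      using x by (simp add: \<phi>'_def sincf_def cosf_def power2_eq_square right_diff_distrib)
  qed (rule bounded_borel_sincf)
qed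

end

section \<open>Square integrability in time\<close>

text \<open>The real part of the characteristic function of the normal distribution. Its positivity
  and monotonicity in the modulus of r drive the correlation estimate.\<close>

lemma std_normal_integral_cos: "(\<integral>s. cos (r * s) \<partial>std_normal_distribution) = exp (- r\<^sup>2 / 2)"
proof -
  interpret N: real_distribution std_normal_distribution by (rule real_dist_normal_dist)
  have "(\<integral>s. Re (iexp (r * s)) \<partial>std_normal_distribution) = Re (char std_normal_distribution r)"
    unfolding char_def by (intro integral_Re N.integrable_iexp) auto
  then show ?thesis by (simp add: char_std_normal_distribution Re_exp)
qed

lemma std_normal_integrable_cos: "integrable std_normal_distribution (\<lambda>s. cos (r * s))"
proof -
  interpret N: real_distribution std_normal_distribution by (rule real_dist_normal_dist)
  show ?thesis by (rule N.integrable_const_bound[of _ 1]) auto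
qed

text \<open>Treats the cosine and sine symbols together. The last clause is a smoothed form of the
  orthogonality of positive frequencies: integrated over all times the products would give a
  nonnegative multiple of a delta function in x - y. The linear growth allowed in the second clause
  is that of sin(tx)/x.\<close>

definition wave_kernel :: "(real \<Rightarrow> real \<Rightarrow> real) \<Rightarrow> bool" where
  "wave_kernel k \<longleftrightarrow>
     (\<lambda>p. k (fst p) (snd p)) \<in> borel_measurable (borel \<Otimes>\<^sub>M borel) \<and>
     (\<forall>t x. \<bar>k t x\<bar> \<le> 1 + \<bar>t\<bar>) \<and>
     (\<forall>\<sigma> x y. 0 < x \<longrightarrow> 0 < y \<longrightarrow> 0 \<le> (\<integral>s. k (\<sigma> * s) x * k (\<sigma> * s) y \<partial>std_normal_distribution))"

lemma wave_kernelD: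
  assumes "wave_kernel k"
  shows "(\<lambda>p. k (fst p) (snd p)) \<in> borel_measurable (borel \<Otimes>\<^sub>M borel)" "\<bar>k t x\<bar> \<le> 1 + \<bar>t\<bar>"
    "0 < x \<Longrightarrow> 0 < y \<Longrightarrow> 0 \<le> (\<integral>s. k (\<sigma> * s) x * k (\<sigma> * s) y \<partial>std_normal_distribution)"
  using assms by (auto simp: wave_kernel_def)

lemma wave_kernel_cosf: "wave_kernel cosf"
  unfolding wave_kernel_def
proof (intro conjI allI impI)
  show "(\<lambda>p. cosf (fst p) (snd p)) \<in> borel_measurable (borel \<Otimes>\<^sub>M borel)"
    unfolding cosf_def by measurable
  show "\<bar>cosf t x\<bar> \<le> 1 + \<bar>t\<bar>" for t x
    unfolding cosf_def using abs_cos_le_one[of "t * x"] abs_ge_zero[of t] by linarith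
  fix \<sigma> x y :: real
  have eq: "cosf (\<sigma> * s) x * cosf (\<sigma> * s) y = (cos (\<sigma> * (x - y) * s) + cos (\<sigma> * (x + y) * s)) / 2" for s
    by (simp add: cosf_def cos_times_cos algebra_simps)
  show "0 \<le> (\<integral>s. cosf (\<sigma> * s) x * cosf (\<sigma> * s) y \<partial>std_normal_distribution)"
    unfolding eq by (simp add: std_normal_integrable_cos std_normal_integral_cos)
qed

text \<open>The product of sines averages to a difference of Gaussians at x - y and x + y. For
  positive x and y the former is smaller in modulus, so the difference is nonnegative.\<close>

lemma wave_kernel_sincf: "wave_kernel sincf"
  unfolding wave_kernel_def
proof (intro conjI allI impI)
  show "(\<lambda>p. sincf (fst p) (snd p)) \<in> borel_measurable (borel \<Otimes>\<^sub>M borel)"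
    unfolding sincf_def by measurable
  show "\<bar>sincf t x\<bar> \<le> 1 + \<bar>t\<bar>" for t x using abs_sincf_le[of t x] by simp
  fix \<sigma> x y :: real assume xy: "0 < x" "0 < y"
  have eq: "sincf (\<sigma> * s) x * sincf (\<sigma> * s) y
      = 1 / (2 * x * y) * (cos (\<sigma> * (x - y) * s) - cos (\<sigma> * (x + y) * s))" for s
  proof -
    have "sincf (\<sigma> * s) x * sincf (\<sigma> * s) y = sin (\<sigma> * s * x) * sin (\<sigma> * s * y) / (x * y)"
      using xy by (simp add: sincf_def)
    also have "sin (\<sigma> * s * x) * sin (\<sigma> * s * y) = (cos (\<sigma> * (x - y) * s) - cos (\<sigma> * (x + y) * s)) / 2"
      by (simp add: sin_times_sin algebra_simps)
    finally show ?thesis by simp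
  qed
  have "(\<sigma> * (x - y))\<^sup>2 \<le> (\<sigma> * (x + y))\<^sup>2"
    using xy by (simp add: power_mult_distrib mult_left_mono abs_le_square_iff[symmetric])
  then have "exp (- (\<sigma> * (x + y))\<^sup>2 / 2) \<le> exp (- (\<sigma> * (x - y))\<^sup>2 / 2)" by simp
  moreover have "(\<integral>s. sincf (\<sigma> * s) x * sincf (\<sigma> * s) y \<partial>std_normal_distribution)
      = 1 / (2 * x * y) * (exp (- (\<sigma> * (x - y))\<^sup>2 / 2) - exp (- (\<sigma> * (x + y))\<^sup>2 / 2))"
    unfolding eq by (simp add: std_normal_integrable_cos std_normal_integral_cos)
  ultimately show "0 \<le> (\<integral>s. sincf (\<sigma> * s) x * sincf (\<sigma> * s) y \<partial>std_normal_distribution)"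
    using xy by simp
qed

lemma std_normal_integrable_poly_bounded:
  assumes [measurable]: "f \<in> borel_measurable borel" and "\<And>s. \<bar>f s\<bar> \<le> C * (1 + \<bar>\<sigma> * s\<bar>)\<^sup>2"
  shows "integrable std_normal_distribution (f :: real \<Rightarrow> real)"
proof -
  interpret N: real_distribution std_normal_distribution by (rule real_dist_normal_dist)
  have m: "integrable std_normal_distribution (\<lambda>s. s\<^sup>2)" by (rule integrable_std_normal_distribution_moment)
  show ?thesis
  proof (rule Bochner_Integration.integrable_bound)
    show "integrable std_normal_distribution (\<lambda>s. \<bar>C\<bar> * (2 + 2 * \<sigma>\<^sup>2 * s\<^sup>2))" using m by simp
    show "AE s in std_normal_distribution. norm (f s) \<le> norm (\<bar>C\<bar> * (2 + 2 * \<sigma>\<^sup>2 * s\<^sup>2))"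
    proof (rule AE_I2)
      fix s
      have "(1 + \<bar>\<sigma> * s\<bar>)\<^sup>2 \<le> 2 + 2 * \<sigma>\<^sup>2 * s\<^sup>2"
        using sum_squares_bound[of 1 "\<bar>\<sigma> * s\<bar>"] by (simp add: power2_sum power_mult_distrib)
      then have "\<bar>C\<bar> * (1 + \<bar>\<sigma> * s\<bar>)\<^sup>2 \<le> \<bar>C\<bar> * (2 + 2 * \<sigma>\<^sup>2 * s\<^sup>2)" by (rule mult_left_mono) simp
      moreover have "C * (1 + \<bar>\<sigma> * s\<bar>)\<^sup>2 \<le> \<bar>C\<bar> * (1 + \<bar>\<sigma> * s\<bar>)\<^sup>2" by (rule mult_right_mono) auto
      ultimately show "norm (f s) \<le> norm (\<bar>C\<bar> * (2 + 2 * \<sigma>\<^sup>2 * s\<^sup>2))"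
        using assms(2)[of s] by simp
    qed
  qed simp
qed

lemma std_normal_Fubini:
  fixes F :: "real \<Rightarrow> real \<Rightarrow> real"
  assumes M: "finite_measure M" "sets M = sets borel"
    and F [measurable]: "(\<lambda>p. F (fst p) (snd p)) \<in> borel_measurable (borel \<Otimes>\<^sub>M borel)"
    and bound: "\<And>s x. \<bar>F s x\<bar> \<le> C * (1 + \<bar>\<sigma> * s\<bar>)\<^sup>2"
  shows "(\<integral>s. (\<integral>x. F s x \<partial>M) \<partial>std_normal_distribution) = (\<integral>x. (\<integral>s. F s x \<partial>std_normal_distribution) \<partial>M)"
proof -
  interpret N: real_distribution std_normal_distribution by (rule real_dist_normal_dist)
  interpret M: finite_measure M by (rule M)
  interpret P: pair_sigma_finite std_normal_distribution M ..
  have sets: "sets (std_normal_distribution \<Otimes>\<^sub>M M) = sets (borel \<Otimes>\<^sub>M borel)"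
    by (rule sets_pair_measure_cong) (simp_all add: M(2))
  have F': "case_prod F \<in> borel_measurable (std_normal_distribution \<Otimes>\<^sub>M M)"
    using F by (simp add: measurable_cong_sets[OF sets refl] case_prod_unfold)
  have F_x: "F s \<in> borel_measurable M" for s
  proof -
    have "(\<lambda>x. F (fst (s, x)) (snd (s, x))) \<in> borel_measurable borel"
      by (rule measurable_compose[OF _ F]) simp
    then show ?thesis by (simp add: measurable_cong_sets[OF M(2) refl])
  qed
  have int_x: "integrable M (F s)" for s
    by (rule M.integrable_const_bound[OF AE_I2]) (use bound F_x in auto)
  have absF: "(\<lambda>p. \<bar>case_prod F p\<bar>) \<in> borel_measurable (std_normal_distribution \<Otimes>\<^sub>M M)"
    using F' by measurable
  have "integrable std_normal_distribution (\<lambda>s. \<integral>x. \<bar>F s x\<bar> \<partial>M)"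
  proof (rule std_normal_integrable_poly_bounded)
    have "(\<lambda>s. \<integral>x. \<bar>F s x\<bar> \<partial>M) \<in> borel_measurable std_normal_distribution"
      by (rule M.borel_measurable_lebesgue_integral) (use absF in \<open>simp add: case_prod_unfold\<close>)
    then show "(\<lambda>s. \<integral>x. \<bar>F s x\<bar> \<partial>M) \<in> borel_measurable borel" by simp
    fix s
    have "(\<integral>x. \<bar>F s x\<bar> \<partial>M) \<le> (\<integral>x. C * (1 + \<bar>\<sigma> * s\<bar>)\<^sup>2 \<partial>M)"
      by (rule integral_mono) (use int_x bound in auto)
    then show "\<bar>\<integral>x. \<bar>F s x\<bar> \<partial>M\<bar> \<le> (C * measure M (space M)) * (1 + \<bar>\<sigma> * s\<bar>)\<^sup>2"
      by (simp add: mult_ac)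
  qed
  then have "integrable (std_normal_distribution \<Otimes>\<^sub>M M) (case_prod F)"
    by (intro P.Fubini_integrable F') (use int_x in auto)
  from P.Fubini_integral[OF this] show ?thesis by simp
qed

section \<open>Diagonal elements with square integrable time dependence\<close>

context positive_self_adjoint
begin

text \<open>The diagonal element \<open>cinner h (op (k t) h)\<close>, which is real, written as an
  integral so that Fubini applies to products.\<close>

definition quad :: "(real \<Rightarrow> real \<Rightarrow> real) \<Rightarrow> 'a \<Rightarrow> real \<Rightarrow> real" where
  "quad k h t = (\<integral>x. k t x \<partial>\<mu> h)"

lemma wave_kernel_bounded_borel:
  assumes "wave_kernel k" shows "bounded_borel (k t)"
proof (rule bounded_borelI[OF _ wave_kernelD(2)[OF assms]])
  show "k t \<in> borel_measurable borel"
    using measurable_compose[OF measurable_Pair1'[of t borel borel] wave_kernelD(1)[OF assms]] by simp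
qed

lemma quad_op: "wave_kernel k \<Longrightarrow> quad k h t = inner h (op (k t) h)"
  by (simp add: quad_def inner_op wave_kernel_bounded_borel)

lemma quad_bound: "wave_kernel k \<Longrightarrow> \<bar>quad k h t\<bar> \<le> (1 + \<bar>t\<bar>) * (norm h)\<^sup>2"
  unfolding quad_def
  by (rule integral_bound) (auto intro: wave_kernelD bounded_borel_measurable wave_kernel_bounded_borel)

lemma quad_parallelogram:
  assumes "wave_kernel k"
  shows "quad k (f + g) t + quad k (f - g) t = 2 * quad k f t + 2 * quad k g t"
  by (simp add: quad_op[OF assms] clinearD[OF op_clinear[OF wave_kernel_bounded_borel[OF assms]]]
      inner_add_left inner_add_right inner_diff_left inner_diff_right)

lemma quad_measurable:
  assumes "wave_kernel k" shows "quad k h \<in> borel_measurable borel"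
proof -
  interpret finite_measure "\<mu> h" by (rule finite_\<mu>)
  have sets: "sets (borel \<Otimes>\<^sub>M \<mu> h) = sets (borel \<Otimes>\<^sub>M borel)" by (rule sets_pair_measure_cong) simp_all
  have "case_prod k \<in> borel_measurable (borel \<Otimes>\<^sub>M \<mu> h)"
    unfolding measurable_cong_sets[OF sets refl] case_prod_unfold by (rule wave_kernelD(1)[OF assms])
  from borel_measurable_lebesgue_integral[OF this] show ?thesis by (simp add: quad_def[abs_def])
qed

lemma quad_scaled_bounds:
  assumes k: "wave_kernel k"
  shows "(\<lambda>s. quad k f (\<sigma> * s) * quad k g (\<sigma> * s)) \<in> borel_measurable borel"
    "\<bar>quad k f (\<sigma> * s) * quad k g (\<sigma> * s)\<bar> \<le> ((norm f)\<^sup>2 * (norm g)\<^sup>2) * (1 + \<bar>\<sigma> * s\<bar>)\<^sup>2"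
proof -
  note [measurable] = quad_measurable[OF k]
  show "(\<lambda>s. quad k f (\<sigma> * s) * quad k g (\<sigma> * s)) \<in> borel_measurable borel" by measurable
  have "\<bar>quad k f (\<sigma> * s)\<bar> * \<bar>quad k g (\<sigma> * s)\<bar> \<le> ((1 + \<bar>\<sigma> * s\<bar>) * (norm f)\<^sup>2) * ((1 + \<bar>\<sigma> * s\<bar>) * (norm g)\<^sup>2)"
    by (intro mult_mono quad_bound k) auto
  then show "\<bar>quad k f (\<sigma> * s) * quad k g (\<sigma> * s)\<bar> \<le> ((norm f)\<^sup>2 * (norm g)\<^sup>2) * (1 + \<bar>\<sigma> * s\<bar>)\<^sup>2"
    by (simp add: abs_mult power2_eq_square mult_ac)
qed

text \<open>Positivity of the correlation of two quadratic forms replaces Plancherel's theorem: by Fubini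
  it reduces to the pointwise positivity of the kernels.\<close>

lemma quad_correlation_nonneg:
  assumes k: "wave_kernel k"
  shows "0 \<le> (\<integral>s. quad k f (\<sigma> * s) * quad k g (\<sigma> * s) \<partial>std_normal_distribution)"
proof -
  note [measurable] = quad_measurable[OF k] wave_kernelD(1)[OF k]
  have k_scaled: "(\<lambda>p. k (\<sigma> * fst p) (snd p)) \<in> borel_measurable (borel \<Otimes>\<^sub>M borel)"
    using measurable_compose[OF _ wave_kernelD(1)[OF k], of "\<lambda>p. (\<sigma> * fst p, snd p)"] by simp
  have k_scaled_x: "(\<lambda>s. k (\<sigma> * s) y) \<in> borel_measurable borel" for y
    using measurable_compose[OF measurable_Pair2'[of y borel borel] k_scaled] by simp
  have "(\<integral>s. quad k f (\<sigma> * s) * quad k g (\<sigma> * s) \<partial>std_normal_distribution)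
      = (\<integral>s. (\<integral>y. quad k f (\<sigma> * s) * k (\<sigma> * s) y \<partial>\<mu> g) \<partial>std_normal_distribution)"
    by (simp add: quad_def)
  also have "\<dots> = (\<integral>y. (\<integral>s. quad k f (\<sigma> * s) * k (\<sigma> * s) y \<partial>std_normal_distribution) \<partial>\<mu> g)"
  proof (rule std_normal_Fubini[OF finite_\<mu> sets_\<mu>])
    show "(\<lambda>p. quad k f (\<sigma> * fst p) * k (\<sigma> * fst p) (snd p)) \<in> borel_measurable (borel \<Otimes>\<^sub>M borel)"
      by (intro borel_measurable_times k_scaled) measurable
    fix s x
    have "\<bar>quad k f (\<sigma> * s)\<bar> * \<bar>k (\<sigma> * s) x\<bar> \<le> ((1 + \<bar>\<sigma> * s\<bar>) * (norm f)\<^sup>2) * (1 + \<bar>\<sigma> * s\<bar>)"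
      by (intro mult_mono quad_bound k wave_kernelD(2)[OF k]) auto
    then show "\<bar>quad k f (\<sigma> * s) * k (\<sigma> * s) x\<bar> \<le> (norm f)\<^sup>2 * (1 + \<bar>\<sigma> * s\<bar>)\<^sup>2"
      by (simp add: abs_mult power2_eq_square mult_ac)
  qed
  also have "\<dots> \<ge> 0"
  proof (rule integral_nonneg_AE, rule AE_mp[OF AE_positive AE_I2], rule impI)
    fix y :: real assume y: "0 < y"
    have "(\<integral>s. quad k f (\<sigma> * s) * k (\<sigma> * s) y \<partial>std_normal_distribution)
        = (\<integral>s. (\<integral>x. k (\<sigma> * s) x * k (\<sigma> * s) y \<partial>\<mu> f) \<partial>std_normal_distribution)"
      by (simp add: quad_def)
    also have "\<dots> = (\<integral>x. (\<integral>s. k (\<sigma> * s) x * k (\<sigma> * s) y \<partial>std_normal_distribution) \<partial>\<mu> f)"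
    proof (rule std_normal_Fubini[OF finite_\<mu> sets_\<mu>])
      show "(\<lambda>p. k (\<sigma> * fst p) (snd p) * k (\<sigma> * fst p) y) \<in> borel_measurable (borel \<Otimes>\<^sub>M borel)"
        by (intro borel_measurable_times k_scaled measurable_compose[OF measurable_fst k_scaled_x])
      fix s x
      have "\<bar>k (\<sigma> * s) x\<bar> * \<bar>k (\<sigma> * s) y\<bar> \<le> (1 + \<bar>\<sigma> * s\<bar>) * (1 + \<bar>\<sigma> * s\<bar>)"
        by (intro mult_mono wave_kernelD(2)[OF k]) auto
      then show "\<bar>k (\<sigma> * s) x * k (\<sigma> * s) y\<bar> \<le> 1 * (1 + \<bar>\<sigma> * s\<bar>)\<^sup>2"
        by (simp add: abs_mult power2_eq_square)
    qed
    also have "\<dots> \<ge> 0"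
    proof (rule integral_nonneg_AE, rule AE_mp[OF AE_positive AE_I2], rule impI)
      fix x :: real assume "0 < x"
      then show "0 \<le> (\<integral>s. k (\<sigma> * s) x * k (\<sigma> * s) y \<partial>std_normal_distribution)"
        using y by (rule wave_kernelD(3)[OF k])
    qed
    finally show "0 \<le> (\<integral>s. quad k f (\<sigma> * s) * k (\<sigma> * s) y \<partial>std_normal_distribution)" .
  qed
  finally show ?thesis .
qed

definition quad_sq :: "(real \<Rightarrow> real \<Rightarrow> real) \<Rightarrow> 'a \<Rightarrow> ennreal" where
  "quad_sq k h = (\<integral>\<^sup>+t. ennreal ((quad k h t)\<^sup>2) \<partial>lborel)"

text \<open>The factor n compensates the spreading of the Gaussian: the weight on the right tends to
  a positive constant as n grows.\<close>

lemma nn_integral_std_normal_scaled: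
  assumes [measurable]: "f \<in> borel_measurable borel" and n: "0 < n"
  shows "ennreal n * (\<integral>\<^sup>+s. ennreal (f (n * s)) \<partial>std_normal_distribution)
    = (\<integral>\<^sup>+t. ennreal (std_normal_density (t / n)) * ennreal (f t) \<partial>lborel)"
proof -
  have "(\<integral>\<^sup>+t. ennreal (std_normal_density (t / n)) * ennreal (f t) \<partial>lborel)
      = ennreal \<bar>n\<bar> * (\<integral>\<^sup>+s. ennreal (std_normal_density ((0 + n * s) / n)) * ennreal (f (0 + n * s)) \<partial>lborel)"
    using n by (intro nn_integral_real_affine) auto
  also have "(\<integral>\<^sup>+s. ennreal (std_normal_density ((0 + n * s) / n)) * ennreal (f (0 + n * s)) \<partial>lborel)
      = (\<integral>\<^sup>+s. ennreal (f (n * s)) \<partial>std_normal_distribution)"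
    using n by (subst nn_integral_density) auto
  finally show ?thesis using n by simp
qed

text \<open>The forms at f + g and f - g have a square integrable sum by the parallelogram law.
  Under each Gaussian weight their correlation is nonnegative, so the square of the first is
  dominated by the square of the sum; Fatou's lemma removes the weight.\<close>

lemma quad_sq_add:
  assumes k: "wave_kernel k" and f: "quad_sq k f < \<infinity>" and g: "quad_sq k g < \<infinity>"
  shows "quad_sq k (f + g) < \<infinity>"
proof -
  note [measurable] = quad_measurable[OF k]
  let ?p = "quad k (f + g)" and ?m = "quad k (f - g)"
  define s where "s t = ?p t + ?m t" for t
  have [measurable]: "s \<in> borel_measurable borel" unfolding s_def[abs_def] by measurable
  \<comment> \<open>The constant 8 comes from expanding the square of 2a + 2b.\<close>
  have s_le: "(s t)\<^sup>2 \<le> 8 * (quad k f t)\<^sup>2 + 8 * (quad k g t)\<^sup>2" for t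
    using sum_squares_bound[of "2 * quad k f t" "2 * quad k g t"]
    by (simp add: s_def quad_parallelogram[OF k] power2_sum power_mult_distrib)
  have "(\<integral>\<^sup>+t. ennreal ((s t)\<^sup>2) \<partial>lborel) \<le> (\<integral>\<^sup>+t. 8 * ennreal ((quad k f t)\<^sup>2) + 8 * ennreal ((quad k g t)\<^sup>2) \<partial>lborel)"
  proof (intro nn_integral_mono)
    fix t
    have "ennreal ((s t)\<^sup>2) \<le> ennreal (8 * (quad k f t)\<^sup>2 + 8 * (quad k g t)\<^sup>2)" by (rule ennreal_leI[OF s_le])
    also have "\<dots> = 8 * ennreal ((quad k f t)\<^sup>2) + 8 * ennreal ((quad k g t)\<^sup>2)"
      by (simp add: ennreal_plus ennreal_mult')
    finally show "ennreal ((s t)\<^sup>2) \<le> 8 * ennreal ((quad k f t)\<^sup>2) + 8 * ennreal ((quad k g t)\<^sup>2)" .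
  qed
  also have "\<dots> = 8 * quad_sq k f + 8 * quad_sq k g"
    by (simp add: nn_integral_add nn_integral_cmult quad_sq_def)
  also have "\<dots> < \<infinity>" using f g by (simp add: ennreal_mult_less_top)
  finally have s_fin: "(\<integral>\<^sup>+t. ennreal ((s t)\<^sup>2) \<partial>lborel) < \<infinity>" .
  \<comment> \<open>The maximum of the density and also the limit of the spreading weights: it
    bounds the right-hand side from above and reappears on the left in the limit.\<close>
  define c0 where "c0 = std_normal_density 0"
  have c0: "0 < c0" by (simp add: c0_def normal_density_pos)
  have dens_le: "std_normal_density t \<le> c0" for t
    by (simp add: c0_def std_normal_density_def divide_right_mono)
  have main: "(\<integral>\<^sup>+t. ennreal (std_normal_density (t / n)) * ennreal ((?p t)\<^sup>2) \<partial>lborel)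
      \<le> ennreal c0 * (\<integral>\<^sup>+t. ennreal ((s t)\<^sup>2) \<partial>lborel)" if n: "0 < n" for n
  proof -
    have int: "integrable std_normal_distribution (\<lambda>t. quad k u (n * t) * quad k v (n * t))" for u v
      by (rule std_normal_integrable_poly_bounded[OF quad_scaled_bounds[OF k]])
    have int2: "integrable std_normal_distribution (\<lambda>t. (quad k u (n * t))\<^sup>2)" for u
      using int[of u u] by (simp add: power2_eq_square)
    have s_sq: "(s (n * t))\<^sup>2 = (?p (n * t))\<^sup>2 + 2 * (?p (n * t) * ?m (n * t)) + (?m (n * t))\<^sup>2" for t
      by (simp add: s_def power2_sum)
    have int_s: "integrable std_normal_distribution (\<lambda>t. (s (n * t))\<^sup>2)"
      unfolding s_sq using int2 int by (intro Bochner_Integration.integrable_add integrable_mult_right) auto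
    have "(\<integral>t. (s (n * t))\<^sup>2 \<partial>std_normal_distribution) = (\<integral>t. (?p (n * t))\<^sup>2 \<partial>std_normal_distribution)
        + 2 * (\<integral>t. ?p (n * t) * ?m (n * t) \<partial>std_normal_distribution) + (\<integral>t. (?m (n * t))\<^sup>2 \<partial>std_normal_distribution)"
      unfolding s_sq using int2 int by simp
    also have "\<dots> \<ge> (\<integral>t. (?p (n * t))\<^sup>2 \<partial>std_normal_distribution)"
      using quad_correlation_nonneg[OF k, of "f + g" n "f - g"] by (simp add: add_increasing2)
    finally have le: "(\<integral>t. (?p (n * t))\<^sup>2 \<partial>std_normal_distribution) \<le> (\<integral>t. (s (n * t))\<^sup>2 \<partial>std_normal_distribution)" .
    have "(\<integral>\<^sup>+t. ennreal ((?p (n * t))\<^sup>2) \<partial>std_normal_distribution) \<le> (\<integral>\<^sup>+t. ennreal ((s (n * t))\<^sup>2) \<partial>std_normal_distribution)"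
      using le by (simp add: nn_integral_eq_integral int2 int_s ennreal_leI)
    then have "ennreal n * (\<integral>\<^sup>+t. ennreal ((?p (n * t))\<^sup>2) \<partial>std_normal_distribution)
        \<le> ennreal n * (\<integral>\<^sup>+t. ennreal ((s (n * t))\<^sup>2) \<partial>std_normal_distribution)"
      by (rule mult_left_mono) simp
    then have "(\<integral>\<^sup>+t. ennreal (std_normal_density (t / n)) * ennreal ((?p t)\<^sup>2) \<partial>lborel)
        \<le> (\<integral>\<^sup>+t. ennreal (std_normal_density (t / n)) * ennreal ((s t)\<^sup>2) \<partial>lborel)"
      using n nn_integral_std_normal_scaled[of "\<lambda>t. (?p t)\<^sup>2" n] nn_integral_std_normal_scaled[of "\<lambda>t. (s t)\<^sup>2" n]
      by simp
    also have "\<dots> \<le> (\<integral>\<^sup>+t. ennreal c0 * ennreal ((s t)\<^sup>2) \<partial>lborel)"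
      by (intro nn_integral_mono mult_right_mono ennreal_leI dens_le) auto
    also have "\<dots> = ennreal c0 * (\<integral>\<^sup>+t. ennreal ((s t)\<^sup>2) \<partial>lborel)" by (rule nn_integral_cmult) simp
    finally show ?thesis .
  qed
  have lim: "(\<lambda>n. ennreal (std_normal_density (t / Suc n)) * ennreal ((?p t)\<^sup>2)) \<longlonglongrightarrow> ennreal c0 * ennreal ((?p t)\<^sup>2)" for t
  proof -
    have "isCont std_normal_density 0" unfolding std_normal_density_def by (intro continuous_intros) auto
    moreover have "(\<lambda>n. t * (1 / Suc n)) \<longlonglongrightarrow> t * 0" by (intro tendsto_intros LIMSEQ_Suc[OF lim_1_over_n])
    ultimately have "(\<lambda>n. std_normal_density (t / Suc n)) \<longlonglongrightarrow> c0"
      unfolding c0_def using isCont_tendsto_compose[of 0 std_normal_density] by simp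
    then have "(\<lambda>n. std_normal_density (t / Suc n) * (?p t)\<^sup>2) \<longlonglongrightarrow> c0 * (?p t)\<^sup>2" by (rule tendsto_mult_right)
    then have "(\<lambda>n. ennreal (std_normal_density (t / Suc n) * (?p t)\<^sup>2)) \<longlonglongrightarrow> ennreal (c0 * (?p t)\<^sup>2)" by (rule tendsto_ennrealI)
    then show ?thesis using c0 by (simp add: ennreal_mult'')
  qed
  have "ennreal c0 * quad_sq k (f + g) = (\<integral>\<^sup>+t. ennreal c0 * ennreal ((?p t)\<^sup>2) \<partial>lborel)"
    unfolding quad_sq_def by (rule nn_integral_cmult[symmetric]) simp
  also have "\<dots> = (\<integral>\<^sup>+t. liminf (\<lambda>n. ennreal (std_normal_density (t / Suc n)) * ennreal ((?p t)\<^sup>2)) \<partial>lborel)"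
    by (intro nn_integral_cong lim_imp_Liminf[symmetric] lim) simp
  also have "\<dots> \<le> liminf (\<lambda>n. \<integral>\<^sup>+t. ennreal (std_normal_density (t / Suc n)) * ennreal ((?p t)\<^sup>2) \<partial>lborel)"
    by (rule nn_integral_liminf) simp
  also have "\<dots> \<le> ennreal c0 * (\<integral>\<^sup>+t. ennreal ((s t)\<^sup>2) \<partial>lborel)"
    by (intro Liminf_le always_eventually allI main) auto
  also have "\<dots> < \<infinity>" using s_fin by (simp add: ennreal_mult_less_top)
  finally show ?thesis using c0 by (auto simp: ennreal_mult_less_top)
qed

lemma quad_sq_scale:
  assumes k: "wave_kernel k" and f: "quad_sq k f < \<infinity>"
  shows "quad_sq k (a *\<^sub>C f) < \<infinity>"
proof -
  note [measurable] = quad_measurable[OF k]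
  have "complex_of_real (quad k (a *\<^sub>C f) t) = complex_of_real ((cmod a)\<^sup>2 * quad k f t)" for t
  proof -
    note bb = wave_kernel_bounded_borel[OF k, of t]
    have "complex_of_real (quad k h t) = cinner h (op (k t) h)" for h by (simp add: quad_def cinner_op[OF bb])
    then show ?thesis
      by (simp add: clinearD[OF op_clinear[OF bb]] cinner_scaleC_left cinner_scaleC_right
          complex_norm_square mult.assoc[symmetric] del: of_real_power)
  qed
  then have "quad k (a *\<^sub>C f) t = (cmod a)\<^sup>2 * quad k f t" for t using of_real_eq_iff by blast
  then have "quad_sq k (a *\<^sub>C f) = (\<integral>\<^sup>+t. ennreal (((cmod a)\<^sup>2)\<^sup>2) * ennreal ((quad k f t)\<^sup>2) \<partial>lborel)"
    unfolding quad_sq_def by (simp add: power_mult_distrib ennreal_mult')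
  also have "\<dots> = ennreal (((cmod a)\<^sup>2)\<^sup>2) * quad_sq k f"
    unfolding quad_sq_def by (rule nn_integral_cmult) simp
  finally show ?thesis using f by (simp add: ennreal_mult_less_top)
qed

end

section \<open>Decay in time\<close>

definition sq_int :: "(real \<Rightarrow> complex) \<Rightarrow> bool" where
  "sq_int z \<longleftrightarrow> z \<in> borel_measurable borel \<and> integrable lborel (\<lambda>t. (cmod (z t))\<^sup>2)"

lemma sq_int_mult: "sq_int z \<Longrightarrow> sq_int (\<lambda>t. a * z t)"
  by (auto simp: sq_int_def norm_mult power_mult_distrib)

lemma sq_int_add:
  assumes "sq_int y" "sq_int z" shows "sq_int (\<lambda>t. y t + z t)"
proof -
  have [measurable]: "y \<in> borel_measurable borel" "z \<in> borel_measurable borel"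
    and int: "integrable lborel (\<lambda>t. (cmod (y t))\<^sup>2)" "integrable lborel (\<lambda>t. (cmod (z t))\<^sup>2)"
    using assms by (auto simp: sq_int_def)
  have "integrable lborel (\<lambda>t. (cmod (y t + z t))\<^sup>2)"
  proof (rule Bochner_Integration.integrable_bound)
    show "integrable lborel (\<lambda>t. 2 * (cmod (y t))\<^sup>2 + 2 * (cmod (z t))\<^sup>2)" using int by simp
    show "AE t in lborel. norm ((cmod (y t + z t))\<^sup>2) \<le> norm (2 * (cmod (y t))\<^sup>2 + 2 * (cmod (z t))\<^sup>2)"
    proof (rule AE_I2)
      fix t
      have "(cmod (y t + z t))\<^sup>2 \<le> (cmod (y t) + cmod (z t))\<^sup>2"
        by (intro power_mono norm_triangle_ineq) simp
      also have "\<dots> \<le> 2 * (cmod (y t))\<^sup>2 + 2 * (cmod (z t))\<^sup>2"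
        using sum_squares_bound[of "cmod (y t)" "cmod (z t)"] by (simp add: power2_sum)
      finally show "norm ((cmod (y t + z t))\<^sup>2) \<le> norm (2 * (cmod (y t))\<^sup>2 + 2 * (cmod (z t))\<^sup>2)" by simp
    qed
  qed simp
  then show ?thesis by (simp add: sq_int_def)
qed

lemma sq_int_diff: "sq_int y \<Longrightarrow> sq_int z \<Longrightarrow> sq_int (\<lambda>t. y t - z t)"
  using sq_int_add[OF _ sq_int_mult[of z "-1"], of y] by simp

lemma sq_int_Re:
  assumes "sq_int z" shows "integrable lborel (\<lambda>t. (Re (z t))\<^sup>2)"
proof (rule Bochner_Integration.integrable_bound)
  have [measurable]: "z \<in> borel_measurable borel" using assms by (simp add: sq_int_def)
  show "integrable lborel (\<lambda>t. (cmod (z t))\<^sup>2)" using assms by (simp add: sq_int_def)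
  show "AE t in lborel. norm ((Re (z t))\<^sup>2) \<le> norm ((cmod (z t))\<^sup>2)"
    by (intro AE_I2) (simp add: abs_Re_le_cmod abs_le_square_iff[symmetric])
  show "(\<lambda>t. (Re (z t))\<^sup>2) \<in> borel_measurable lborel" by measurable
qed

text \<open>The derivative of \<open>t y\<^sup>2\<close> is \<open>y\<^sup>2 + 2 y \<gamma>\<close>, which is integrable.\<close>

lemma weighted_derivative_decay:
  fixes y \<gamma> :: "real \<Rightarrow> real"
  assumes deriv: "\<And>t. 1 \<le> t \<Longrightarrow> (y has_real_derivative \<gamma> t / t) (at t)"
    and int: "integrable lborel (\<lambda>t. (y t)\<^sup>2)" "integrable lborel (\<lambda>t. (\<gamma> t)\<^sup>2)"
  shows "\<exists>C. \<forall>t\<ge>1. t * (y t)\<^sup>2 \<le> C"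
proof -
  \<comment> \<open>An integrable majorant of the derivative of \<open>t * (y t)\<^sup>2\<close>:
    the mixed term is at most \<open>(y t)\<^sup>2 + (\<gamma> t)\<^sup>2\<close>.\<close>
  define h where "h t = 2 * (y t)\<^sup>2 + (\<gamma> t)\<^sup>2" for t
  have "integrable lborel h" unfolding h_def[abs_def] using int by simp
  then have h: "h integrable_on UNIV" by (rule integrable_on_lborel)
  have h_nonneg: "0 \<le> h t" for t by (simp add: h_def)
  have "t * (y t)\<^sup>2 \<le> 1 * (y 1)\<^sup>2 + integral UNIV h" if t: "1 \<le> t" for t
  proof -
    have "((\<lambda>t. (y t)\<^sup>2 + 2 * y t * \<gamma> t) has_integral (t * (y t)\<^sup>2 - 1 * (y 1)\<^sup>2)) {1..t}"
    proof (rule fundamental_theorem_of_calculus[OF t])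
      fix s assume s: "s \<in> {1..t}"
      then have D: "(y has_real_derivative \<gamma> s / s) (at s)" by (intro deriv) simp
      have "((\<lambda>t. t * (y t * y t)) has_real_derivative (1 * (y s * y s) + (\<gamma> s / s * y s + \<gamma> s / s * y s) * s)) (at s)"
        by (rule DERIV_mult[OF DERIV_ident DERIV_mult[OF D D]])
      moreover have "1 * (y s * y s) + (\<gamma> s / s * y s + \<gamma> s / s * y s) * s = (y s)\<^sup>2 + 2 * y s * \<gamma> s"
        using s by (simp add: power2_eq_square field_simps)
      ultimately have "((\<lambda>t. t * (y t)\<^sup>2) has_real_derivative ((y s)\<^sup>2 + 2 * y s * \<gamma> s)) (at s)"
        by (simp add: power2_eq_square)
      then show "((\<lambda>t. t * (y t)\<^sup>2) has_vector_derivative ((y s)\<^sup>2 + 2 * y s * \<gamma> s)) (at s within {1..t})"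
        by (simp add: has_real_derivative_iff_has_vector_derivative has_vector_derivative_at_within)
    qed
    moreover have h_sub: "h integrable_on {1..t}"
      using integrable_on_subcbox[OF h, of 1 t] by simp
    moreover have "(y s)\<^sup>2 + 2 * y s * \<gamma> s \<le> h s" for s
      using sum_squares_bound[of "y s" "\<gamma> s"] by (simp add: h_def)
    ultimately have "t * (y t)\<^sup>2 - 1 * (y 1)\<^sup>2 \<le> integral {1..t} h"
      by (intro has_integral_le[OF _ integrable_integral]) auto
    also have "\<dots> \<le> integral UNIV h" by (rule integral_subset_le[OF _ h_sub h]) (auto simp: h_nonneg)
    finally show ?thesis by simp
  qed
  then show ?thesis by blast
qed

text \<open>The bracket is at most 2 for small times and at most twice the modulus of t otherwise;
  negative times are reflected by the symmetry of the modulus.\<close>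

lemma japanese_bracket_decay:
  fixes z :: "real \<Rightarrow> complex"
  assumes large: "\<And>t. 1 \<le> t \<Longrightarrow> t * (cmod (z t))\<^sup>2 \<le> C" and small: "\<And>t. \<bar>t\<bar> \<le> 1 \<Longrightarrow> cmod (z t) \<le> D"
    and sym: "\<And>t. cmod (z (- t)) = cmod (z t)"
  shows "\<exists>K. \<forall>t. cmod (z t) \<le> K * japanese_bracket t powr (-1/2)"
proof -
  have D: "0 \<le> D" using order_trans[OF norm_ge_zero small[of 0]] by simp
  have C: "0 \<le> C" using order_trans[OF _ large[of 1]] by simp
  have J: "1 \<le> japanese_bracket t" for t by (simp add: japanese_bracket_def)
  have bound: "japanese_bracket t * (cmod (z t))\<^sup>2 \<le> 2 * C + 2 * D\<^sup>2" for t
  proof (cases "\<bar>t\<bar> \<le> 1")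
    case True
    have "t\<^sup>2 \<le> 1" using True by (simp add: abs_square_le_1)
    then have "japanese_bracket t \<le> 2"
      unfolding japanese_bracket_def by (intro real_le_lsqrt) auto
    moreover have "(cmod (z t))\<^sup>2 \<le> D\<^sup>2" using small[OF True] by (intro power_mono) auto
    ultimately have "japanese_bracket t * (cmod (z t))\<^sup>2 \<le> 2 * D\<^sup>2" by (intro mult_mono) auto
    then show ?thesis using C by simp
  next
    case False
    have "1 + t\<^sup>2 \<le> (2 * \<bar>t\<bar>)\<^sup>2"
      using False abs_square_le_1[of t] by (simp add: power_mult_distrib)
    then have "japanese_bracket t \<le> 2 * \<bar>t\<bar>"
      unfolding japanese_bracket_def by (intro real_le_lsqrt) auto
    then have "japanese_bracket t * (cmod (z t))\<^sup>2 \<le> 2 * \<bar>t\<bar> * (cmod (z t))\<^sup>2" by (rule mult_right_mono) simp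
    also have "\<dots> = 2 * (\<bar>t\<bar> * (cmod (z \<bar>t\<bar>))\<^sup>2)" using sym[of t] by (cases "0 \<le> t") auto
    also have "\<dots> \<le> 2 * C" using large[of "\<bar>t\<bar>"] False by simp
    finally have "japanese_bracket t * (cmod (z t))\<^sup>2 \<le> 2 * C" .
    moreover have "0 \<le> D\<^sup>2" by simp
    ultimately show ?thesis by linarith
  qed
  have "cmod (z t) \<le> sqrt (2 * C + 2 * D\<^sup>2) * japanese_bracket t powr (-1/2)" for t
  proof -
    have "sqrt (japanese_bracket t) * cmod (z t) = sqrt (japanese_bracket t * (cmod (z t))\<^sup>2)"
      by (simp add: real_sqrt_mult)
    also have "\<dots> \<le> sqrt (2 * C + 2 * D\<^sup>2)" by (rule real_sqrt_le_mono[OF bound])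
    finally have "cmod (z t) \<le> sqrt (2 * C + 2 * D\<^sup>2) / sqrt (japanese_bracket t)"
      using J[of t] by (simp add: field_simps)
    also have "japanese_bracket t powr (-1/2) = 1 / sqrt (japanese_bracket t)"
      using J[of t] by (simp add: powr_minus_divide powr_half_sqrt)
    then have "sqrt (2 * C + 2 * D\<^sup>2) / sqrt (japanese_bracket t) = sqrt (2 * C + 2 * D\<^sup>2) * japanese_bracket t powr (-1/2)"
      by simp
    finally show ?thesis .
  qed
  then show ?thesis by blast
qed

text \<open>The Lipschitz constant in time is independent of x. This dominates the difference
  quotients when a matrix element is differentiated.\<close>

lemma abs_sincf_diff_le: "\<bar>sincf a x - sincf b x\<bar> \<le> \<bar>a - b\<bar>"
proof (cases "x = 0")
  case False
  have "\<bar>sin (a * x) - sin (b * x)\<bar> = 2 * \<bar>sin ((a * x - b * x) / 2)\<bar> * \<bar>cos ((a * x + b * x) / 2)\<bar>"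
    by (simp add: sin_diff_sin abs_mult)
  also have "\<dots> \<le> 2 * \<bar>(a * x - b * x) / 2\<bar> * 1"
    by (intro mult_mono abs_sin_x_le_abs_x abs_cos_le_one) auto
  also have "\<dots> = \<bar>a - b\<bar> * \<bar>x\<bar>" by (simp add: abs_mult[symmetric] algebra_simps)
  finally show ?thesis
    using False by (simp add: sincf_def diff_divide_distrib[symmetric] divide_le_eq)
qed (simp add: sincf_def)

lemma sincf_has_derivative: "((\<lambda>t. sincf t x) has_real_derivative cosf t x) (at t)"
proof (cases "x = 0")
  case True
  then show ?thesis by (simp add: sincf_def cosf_def)
next
  case False
  then show ?thesis
    unfolding sincf_def cosf_def by (auto intro!: derivative_eq_intros)
qed

section \<open>Matrix elements of the propagators as functions of time\<close>

context positive_self_adjoint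
begin

definition matel :: "(real \<Rightarrow> real \<Rightarrow> real) \<Rightarrow> 'a \<Rightarrow> 'a \<Rightarrow> real \<Rightarrow> complex" where
  "matel k f g t = cinner f (op (k t) g)"

lemma matel_self: "wave_kernel k \<Longrightarrow> matel k h h t = quad k h t"
  by (simp add: matel_def quad_def cinner_op wave_kernel_bounded_borel)

lemma sq_int_quad:
  assumes k: "wave_kernel k" and fin: "quad_sq k h < \<infinity>"
  shows "sq_int (\<lambda>t. complex_of_real (quad k h t))"
proof -
  note [measurable] = quad_measurable[OF k]
  have "integrable lborel (\<lambda>t. (quad k h t)\<^sup>2)"
    by (rule integrableI_nonneg) (use fin in \<open>auto simp: quad_sq_def\<close>)
  then show ?thesis by (simp add: sq_int_def)
qed

text \<open>Polarization writes the element through diagonal elements at f plus multiples of g, all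
  of which remain in the class by \<open>quad_sq_add\<close> and
  \<open>quad_sq_scale\<close>.\<close>

lemma sq_int_matel:
  assumes k: "wave_kernel k" and f: "quad_sq k f < \<infinity>" and g: "quad_sq k g < \<infinity>"
  shows "sq_int (matel k f g)"
proof -
  have q: "sq_int (\<lambda>t. complex_of_real (quad k (f + a *\<^sub>C g) t))" for a
    by (intro sq_int_quad k quad_sq_add f quad_sq_scale g)
  have pol: "4 * matel k f g t = complex_of_real (quad k (f + 1 *\<^sub>C g) t) - complex_of_real (quad k (f + (-1) *\<^sub>C g) t)
      - \<i> * complex_of_real (quad k (f + \<i> *\<^sub>C g) t) + \<i> * complex_of_real (quad k (f + (-\<i>) *\<^sub>C g) t)" for t
    unfolding matel_self[OF k, symmetric] matel_def scaleC_one
    by (rule cinner_polarization) (rule clinearD[OF op_clinear[OF wave_kernel_bounded_borel[OF k]]])+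
  have "matel k f g t = 1 / 4 * (complex_of_real (quad k (f + 1 *\<^sub>C g) t) - complex_of_real (quad k (f + (-1) *\<^sub>C g) t)
      - \<i> * complex_of_real (quad k (f + \<i> *\<^sub>C g) t) + \<i> * complex_of_real (quad k (f + (-\<i>) *\<^sub>C g) t))" for t
    unfolding pol[symmetric] by simp
  then have "matel k f g = (\<lambda>t. 1 / 4 * (complex_of_real (quad k (f + 1 *\<^sub>C g) t) - complex_of_real (quad k (f + (-1) *\<^sub>C g) t)
      - \<i> * complex_of_real (quad k (f + \<i> *\<^sub>C g) t) + \<i> * complex_of_real (quad k (f + (-\<i>) *\<^sub>C g) t)))"
    by (rule ext)
  moreover have "sq_int (\<lambda>t. 1 / 4 * (complex_of_real (quad k (f + 1 *\<^sub>C g) t) - complex_of_real (quad k (f + (-1) *\<^sub>C g) t)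
      - \<i> * complex_of_real (quad k (f + \<i> *\<^sub>C g) t) + \<i> * complex_of_real (quad k (f + (-\<i>) *\<^sub>C g) t)))"
    by (intro sq_int_mult sq_int_add sq_int_diff q)
  ultimately show ?thesis by simp
qed

text \<open>Difference quotients of the symbol are bounded by 1 and converge to the cosine, so weak
  convergence of operators applies. The complex weight w selects real or imaginary parts and later
  absorbs the factor 1/(ic).\<close>

lemma matel_sincf_has_derivative:
  "((\<lambda>t. Re (w * matel sincf f g t)) has_real_derivative Re (w * matel cosf f g t)) (at t)"
  unfolding has_field_derivative_iff tendsto_at_iff_sequentially
proof (intro allI impI)
  fix T :: "nat \<Rightarrow> real" assume T: "\<forall>i. T i \<in> UNIV - {t}" "T \<longlonglongrightarrow> t"
  define \<phi> where "\<phi> n x = 1 / (T n - t) * (sincf (T n) x - sincf t x)" for n x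
  have bb: "bounded_borel (\<lambda>x. sincf (T n) x - sincf t x)" for n
    by (intro bounded_borel_diff bounded_borel_sincf)
  have "(\<lambda>n. cinner f (op (\<phi> n) g)) \<longlonglongrightarrow> cinner f (op (cosf t) g)"
  proof (rule cinner_op_limit[where C = 1])
    show "\<phi> n \<in> borel_measurable borel" for n
      unfolding \<phi>_def[abs_def] by (rule bounded_borel_measurable[OF bounded_borel_scale[OF bb]])
    show "cosf t \<in> borel_measurable borel" by (rule bounded_borel_measurable[OF bounded_borel_cosf])
    show "\<bar>\<phi> n x\<bar> \<le> 1" for n x
      using abs_sincf_diff_le[of "T n" x t] T(1) by (simp add: \<phi>_def abs_mult divide_le_eq)
    show "AE x in \<mu> u. (\<lambda>n. \<phi> n x) \<longlonglongrightarrow> cosf t x" for u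
    proof (rule AE_I2)
      fix x
      have "((\<lambda>s. (sincf s x - sincf t x) / (s - t)) \<longlongrightarrow> cosf t x) (at t)"
        using sincf_has_derivative[of x t] unfolding has_field_derivative_iff .
      then show "(\<lambda>n. \<phi> n x) \<longlonglongrightarrow> cosf t x"
        using T unfolding tendsto_at_iff_sequentially by (simp add: \<phi>_def o_def)
    qed
  qed (rule bounded_borel_cosf)
  then have "(\<lambda>n. Re (w * cinner f (op (\<phi> n) g))) \<longlonglongrightarrow> Re (w * cinner f (op (cosf t) g))"
    by (intro tendsto_intros)
  moreover have "Re (w * cinner f (op (\<phi> n) g)) = (Re (w * matel sincf f g (T n)) - Re (w * matel sincf f g t)) / (T n - t)" for n
  proof -
    have "cinner f (op (\<phi> n) g) = complex_of_real (1 / (T n - t)) * (matel sincf f g (T n) - matel sincf f g t)"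
      unfolding \<phi>_def[abs_def] op_scale[OF bb] op_diff[OF bounded_borel_sincf bounded_borel_sincf]
      by (simp add: matel_def cinner_scaleR_right cinner_diff_right)
    then have "w * cinner f (op (\<phi> n) g) = complex_of_real (1 / (T n - t)) * (w * matel sincf f g (T n) - w * matel sincf f g t)"
      by (simp only: mult.left_commute right_diff_distrib)
    then show ?thesis by (simp only: Re_complex_of_real times_complex.sel Im_complex_of_real minus_complex.sel) simp
  qed
  ultimately show "((\<lambda>s. (Re (w * matel sincf f g s) - Re (w * matel sincf f g t)) / (s - t)) \<circ> T)
      \<longlonglongrightarrow> Re (w * matel cosf f g t)"
    by (simp add: o_def matel_def)
qed

lemma matel_bounds:
  "cmod (matel cosf f g t) \<le> norm f * norm g" "cmod (matel sincf f g t) \<le> \<bar>t\<bar> * (norm f * norm g)"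
proof -
  have "norm (op (cosf t) g) \<le> 1 * norm g"
    by (rule op_norm_le[OF bounded_borel_measurable[OF bounded_borel_cosf]]) (simp add: cosf_def)
  then show "cmod (matel cosf f g t) \<le> norm f * norm g"
    unfolding matel_def using cmod_cinner_le[of f "op (cosf t) g"] mult_left_mono[of "norm (op (cosf t) g)" "norm g" "norm f"]
    by simp
  have "norm (op (sincf t) g) \<le> \<bar>t\<bar> * norm g"
    by (rule op_norm_le[OF bounded_borel_measurable[OF bounded_borel_sincf] abs_sincf_le])
  then show "cmod (matel sincf f g t) \<le> \<bar>t\<bar> * (norm f * norm g)"
    unfolding matel_def
    using cmod_cinner_le[of f "op (sincf t) g"] mult_left_mono[of "norm (op (sincf t) g)" "\<bar>t\<bar> * norm g" "norm f"]
    by (simp add: mult_ac)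
qed

lemma matel_uminus:
  "cmod (matel cosf f g (- t)) = cmod (matel cosf f g t)" "cmod (matel sincf f g (- t)) = cmod (matel sincf f g t)"
proof -
  have "cosf (- t) = cosf t" by (simp add: cosf_def fun_eq_iff)
  then show "cmod (matel cosf f g (- t)) = cmod (matel cosf f g t)" by (simp add: matel_def)
  have "sincf (- t) = (\<lambda>x. (-1) * sincf t x)" by (simp add: sincf_def fun_eq_iff)
  then have "op (sincf (- t)) g = (-1) *\<^sub>R op (sincf t) g"
    using op_scale[OF bounded_borel_sincf, of "-1" t g] by simp
  then show "cmod (matel sincf f g (- t)) = cmod (matel sincf f g t)"
    by (simp add: matel_def)
qed

lemma u_eq_op: "u\<^sub>1 H t f = op (cosf t) f" "u\<^sub>2 H t f = op (sincf t) f"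
  using functional_calculus_op[OF bounded_borel_cosf, of t f] functional_calculus_op[OF bounded_borel_sincf, of t f]
  unfolding u\<^sub>1_def u\<^sub>2_def cosf_def sincf_def by auto

lemma \<E>_quad_sq:
  assumes "h \<in> \<E> H" shows "quad_sq cosf h < \<infinity>" "quad_sq sincf h < \<infinity>"
proof -
  have sqrt_fin: "x < top" if "sqrt_ennreal x < top" for x
    using that by (auto simp: sqrt_ennreal_def less_top split: if_splits)
  have "sqrt_ennreal (L2_norm_time (\<lambda>t. cinner h (u\<^sub>1 H t h))) < top"
    "sqrt_ennreal (L2_norm_time (\<lambda>t. cinner h (u\<^sub>2 H t h))) < top"
    using assms by (auto simp: \<E>_def H_norm_def)
  then have "(\<integral>\<^sup>+t. ennreal ((cmod (matel cosf h h t))\<^sup>2) \<partial>lborel) < top"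
    "(\<integral>\<^sup>+t. ennreal ((cmod (matel sincf h h t))\<^sup>2) \<partial>lborel) < top"
    unfolding matel_def u_eq_op[symmetric] by (auto simp: L2_norm_time_def dest!: sqrt_fin)
  then show "quad_sq cosf h < \<infinity>" "quad_sq sincf h < \<infinity>"
    by (simp_all add: matel_self[OF wave_kernel_cosf] matel_self[OF wave_kernel_sincf] quad_sq_def)
qed

lemma sq_int_matel_\<E>:
  assumes "f \<in> \<E> H" "g \<in> \<E> H"
  shows "sq_int (matel cosf f g)" "sq_int (matel sincf f g)"
  using \<E>_quad_sq[OF assms(1)] \<E>_quad_sq[OF assms(2)]
  by (auto intro: sq_int_matel wave_kernel_cosf wave_kernel_sincf)

end

section \<open>Decay of the matrix elements\<close>

context conjugate_operator
begin

lemma matel_commutator: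
  assumes f: "f \<in> dom A" and g: "g \<in> dom A" and c: "c \<noteq> 0"
  shows "t * matel cosf f g t = matel sincf f g t
    + 1 / (\<i> * c) * (matel sincf (A \<cdot> f) g t - matel sincf f (A \<cdot> g) t)"
proof -
  have "cinner (A \<cdot> f) (op (sincf t) g) - cinner (op (sincf t) f) (A \<cdot> g)
      = \<i> * c * cinner f (op (\<lambda>x. t * cosf t x - sincf t x) g)"
    using comm_sincf[of t] f g by (simp add: comm_def)
  also have "op (\<lambda>x. t * cosf t x - sincf t x) g = t *\<^sub>R op (cosf t) g - op (sincf t) g"
    by (simp add: op_diff[OF bounded_borel_scale[OF bounded_borel_cosf] bounded_borel_sincf]
        op_scale[OF bounded_borel_cosf])
  finally have "matel sincf (A \<cdot> f) g t - matel sincf f (A \<cdot> g) t = \<i> * c * (t * matel cosf f g t - matel sincf f g t)"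
    by (simp add: matel_def symmetric_opD(3)[OF op_symmetric[OF bounded_borel_sincf]] cinner_diff_right cinner_scaleR_right)
  then show ?thesis using c by simp
qed

text \<open>For the sine element, \<open>rel\<close> is directly a formula for t times the
  derivative. The cosine element is isolated from \<open>rel\<close> as a quotient by t and
  differentiated: only sine elements get differentiated, so \<open>H\<close> never acts on a
  vector.\<close>

lemma matel_decay:
  assumes f: "f \<in> dom A" "f \<in> \<E> H" "A \<cdot> f \<in> \<E> H" and g: "g \<in> dom A" "g \<in> \<E> H" "A \<cdot> g \<in> \<E> H"
    and c: "c \<noteq> 0"
  shows "\<exists>C. \<forall>t\<ge>1. t * (Re (w * matel cosf f g t))\<^sup>2 \<le> C"
    and "\<exists>C. \<forall>t\<ge>1. t * (Re (w * matel sincf f g t))\<^sup>2 \<le> C"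
proof -
  define \<kappa> where "\<kappa> = 1 / (\<i> * complex_of_real c)"
  note L2 = sq_int_matel_\<E>[OF f(2) g(2)] sq_int_matel_\<E>[OF f(3) g(2)] sq_int_matel_\<E>[OF f(2) g(3)]
  have rel: "t * Re (w * matel cosf f g t) = Re (w * matel sincf f g t)
      + (Re (w * \<kappa> * matel sincf (A \<cdot> f) g t) - Re (w * \<kappa> * matel sincf f (A \<cdot> g) t))" for t
  proof -
    have "w * (t * matel cosf f g t) = w * matel sincf f g t
        + (w * \<kappa> * matel sincf (A \<cdot> f) g t - w * \<kappa> * matel sincf f (A \<cdot> g) t)"
      unfolding matel_commutator[OF f(1) g(1) c] \<kappa>_def by (simp only: algebra_simps)
    then have "Re (complex_of_real t * (w * matel cosf f g t)) = Re (w * matel sincf f g t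
        + (w * \<kappa> * matel sincf (A \<cdot> f) g t - w * \<kappa> * matel sincf f (A \<cdot> g) t))"
      by (simp only: mult.left_commute)
    then show ?thesis by (simp only: Re_complex_of_real times_complex.sel Im_complex_of_real minus_complex.sel plus_complex.sel)
  qed
  note D = matel_sincf_has_derivative
  show "\<exists>C. \<forall>t\<ge>1. t * (Re (w * matel sincf f g t))\<^sup>2 \<le> C"
  proof (rule weighted_derivative_decay[where \<gamma> = "\<lambda>t. Re (w * matel sincf f g t
      + (w * \<kappa> * matel sincf (A \<cdot> f) g t - w * \<kappa> * matel sincf f (A \<cdot> g) t))"])
    fix t :: real assume "1 \<le> t"
    then have "Re (w * matel sincf f g t
      + (w * \<kappa> * matel sincf (A \<cdot> f) g t - w * \<kappa> * matel sincf f (A \<cdot> g) t)) / t = Re (w * matel cosf f g t)"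
      unfolding plus_complex.sel minus_complex.sel rel[symmetric] by simp
    then show "((\<lambda>t. Re (w * matel sincf f g t)) has_real_derivative Re (w * matel sincf f g t
      + (w * \<kappa> * matel sincf (A \<cdot> f) g t - w * \<kappa> * matel sincf f (A \<cdot> g) t)) / t) (at t)"
      using D[of w f g t] by simp
  qed (intro sq_int_Re sq_int_mult sq_int_add sq_int_diff L2)+
  show "\<exists>C. \<forall>t\<ge>1. t * (Re (w * matel cosf f g t))\<^sup>2 \<le> C"
  proof (rule weighted_derivative_decay[where \<gamma> = "\<lambda>t. Re (w * \<kappa> * matel cosf (A \<cdot> f) g t - w * \<kappa> * matel cosf f (A \<cdot> g) t)"])
    fix t :: real assume t: "1 \<le> t"
    define N where "N t = Re (w * matel sincf f g t)
      + (Re (w * \<kappa> * matel sincf (A \<cdot> f) g t) - Re (w * \<kappa> * matel sincf f (A \<cdot> g) t))" for t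
    define N' where "N' = Re (w * matel cosf f g t)
      + (Re (w * \<kappa> * matel cosf (A \<cdot> f) g t) - Re (w * \<kappa> * matel cosf f (A \<cdot> g) t))"
    have "(N has_real_derivative N') (at t)"
      unfolding N_def[abs_def] N'_def by (intro DERIV_add DERIV_diff D)
    then have "((\<lambda>t. N t / t) has_real_derivative (N' * t - N t * 1) / (t * t)) (at t)"
      using t by (intro DERIV_divide DERIV_ident) auto
    \<comment> \<open>The part of \<open>N'\<close> that is the cosine element itself cancels
      against \<open>N t / t\<close>; cosine elements involving \<open>A \<cdot> f\<close> and
      \<open>A \<cdot> g\<close> remain.\<close>
    moreover have "(N' * t - N t * 1) / (t * t) = Re (w * \<kappa> * matel cosf (A \<cdot> f) g t - w * \<kappa> * matel cosf f (A \<cdot> g) t) / t"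
      using t unfolding N_def rel[symmetric] N'_def by (simp add: field_simps)
    \<comment> \<open>Dividing \<open>rel\<close> by s requires s nonzero, which holds near t; a
      derivative depends only on values nearby.\<close>
    moreover have "\<forall>\<^sub>F s in nhds t. N s / s = Re (w * matel cosf f g s)"
    proof -
      have "\<forall>\<^sub>F s in nhds t. s \<in> {0<..}" using t by (intro eventually_nhds_in_open) auto
      then show ?thesis
      proof eventually_elim
        case (elim s)
        have "N s = s * Re (w * matel cosf f g s)" by (simp only: N_def rel)
        then show ?case using elim by simp
      qed
    qed
    ultimately show "((\<lambda>t. Re (w * matel cosf f g t)) has_real_derivative
        Re (w * \<kappa> * matel cosf (A \<cdot> f) g t - w * \<kappa> * matel cosf f (A \<cdot> g) t) / t) (at t)"
      using DERIV_cong_ev[OF refl] by metis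
  qed (intro sq_int_Re sq_int_mult sq_int_add sq_int_diff L2)+
qed

lemma matel_japanese_decay:
  assumes f: "f \<in> dom A" "f \<in> \<E> H" "A \<cdot> f \<in> \<E> H" and g: "g \<in> dom A" "g \<in> \<E> H" "A \<cdot> g \<in> \<E> H"
    and c: "c \<noteq> 0" and k: "k = cosf \<or> k = sincf"
  shows "\<exists>K. \<forall>t. cmod (matel k f g t) \<le> K * japanese_bracket t powr (-1/2)"
proof -
  have "\<exists>C. \<forall>t\<ge>1. t * (Re (w * matel k f g t))\<^sup>2 \<le> C" for w
    using k matel_decay[OF f g c, of w] by auto
  \<comment> \<open>The weight \<open>- \<i>\<close> turns the imaginary part into a real
    part.\<close>
  from this[of 1] this[of "- \<i>"] obtain C1 C2 where
    "\<And>t. 1 \<le> t \<Longrightarrow> t * (Re (matel k f g t))\<^sup>2 \<le> C1" "\<And>t. 1 \<le> t \<Longrightarrow> t * (Im (matel k f g t))\<^sup>2 \<le> C2"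
    by auto
  then have large: "t * (cmod (matel k f g t))\<^sup>2 \<le> C1 + C2" if "1 \<le> t" for t
    unfolding cmod_power2 distrib_left using that by (intro add_mono) auto
  have small: "cmod (matel k f g t) \<le> norm f * norm g" if "\<bar>t\<bar> \<le> 1" for t
    using k
  proof
    assume "k = sincf"
    then have "cmod (matel k f g t) \<le> \<bar>t\<bar> * (norm f * norm g)" using matel_bounds(2) by simp
    also have "\<dots> \<le> 1 * (norm f * norm g)" using that by (intro mult_right_mono) auto
    finally show ?thesis by simp
  qed (simp add: matel_bounds(1))
  have "cmod (matel k f g (- t)) = cmod (matel k f g t)" for t
    using k matel_uminus by auto
  with large small show ?thesis by (rule japanese_bracket_decay)
qed

end

theorem proposition7p2:
  fixes H A :: "'n::finite L2 \<rightharpoonup> 'n L2" and c :: real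
  assumes "self_adjoint H" and "self_adjoint A"
    and "positive_operator H"
    and "C1_class A H"
    and "c \<noteq> 0"
    and "commutation_relation H A c"
  shows "\<forall>f g. f \<in> dom A \<inter> \<E> H \<and> g \<in> dom A \<inter> \<E> H \<and> A \<cdot> f \<in> \<E> H \<and> A \<cdot> g \<in> \<E> H \<longrightarrow>
           (\<exists>C. \<forall>t. cmod (\<psi> H f g t) \<le> C * japanese_bracket t powr (-1/2))"
proof (intro allI impI, elim conjE IntE)
  interpret conjugate_operator H A c by unfold_locales (rule assms)+
  fix f g assume f: "f \<in> dom A" "f \<in> \<E> H" "A \<cdot> f \<in> \<E> H" and g: "g \<in> dom A" "g \<in> \<E> H" "A \<cdot> g \<in> \<E> H"
  obtain K1 where K1: "\<And>t. cmod (matel cosf f f t) \<le> K1 * japanese_bracket t powr (-1/2)"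
    using matel_japanese_decay[OF f f assms(5), of cosf] by blast
  obtain K2 where K2: "\<And>t. cmod (matel sincf f g t) \<le> K2 * japanese_bracket t powr (-1/2)"
    using matel_japanese_decay[OF f g assms(5), of sincf] by blast
  have "cmod (\<psi> H f g t) \<le> (K1 + K2) * japanese_bracket t powr (-1/2)" for t
  proof -
    have "cmod (\<psi> H f g t) \<le> cmod (matel cosf f f t) + cmod (matel sincf f g t)"
      unfolding \<psi>_def u_eq_op matel_def by (rule norm_triangle_ineq)
    also have "\<dots> \<le> (K1 + K2) * japanese_bracket t powr (-1/2)"
      unfolding distrib_right by (rule add_mono[OF K1 K2])
    finally show ?thesis .
  qed
  then show "\<exists>C. \<forall>t. cmod (\<psi> H f g t) \<le> C * japanese_bracket t powr (-1/2)" by blast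
qed

end
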